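(* Let $d\ge1$, $H>0$, let $\{X(t):t\ge0\}$ be a non-deterministic $H$-selfsimilar additive process on $\mathbb{R}^d$, let $\mu$ be the distribution of $X(1)$, and let $C\in[0,\infty]$. Then $$\limsup_{t\to\infty}\frac{|X(t)|}{t^H(\log_{(2)}t)/\log_{(3)}t}=C\quad\text{a.s.}$$ if and only if $C=\inf\{r>0:K(r)=0\}$ (with $\inf\emptyset=\infty$), equivalently, if and only if $$\lim_{r\to\infty}\frac{-\log\mu(|x|>r)}{r\log r}=C^{-1}.$$
   Context: $|x|$ is the Euclidean norm; $\log_{(n)}$ is the $n$-fold iteration of the logarithm; "decreasing" is in the wide sense; conventions $0^{-1}=\infty$, $\infty^{-1}=0$. $\mu(|x|>r):=\mu(\{x:|x|>r\})$. An $\mathbb{R}^d$-valued process $\{X(t):t\ge0\}$ is an $H$-selfsimilar additive process ($H>0$) if: (1) $\{X(ct)\}\stackrel{d}{=}\{c^HX(t)\}$ (equality of finite-dimensional distributions) for every $c>0$; (2) it has independent increments (stationarity not assumed); (3) almost surely its paths are right-continuous with left limits. It is non-deterministic if it is not of the form $X(t)=t^Hc$ with $c\in\mathbb{R}^d$. The distribution $\mu$ of $X(1)$ is selfdecomposable, hence infinitely divisible; let $\nu$ be its Lévy measure. If $\nu\ne0$, then $\nu(B)=\int_{S^{d-1}}\sigma(d\xi)\int_0^\infty1_B(r\xi)k_\xi(r)r^{-1}dr$, where $\sigma$ is a finite non-zero measure on the unit sphere $S^{d-1}$ and $k_\xi(r)\ge0$ is measurable in $\xi$ and decreasing in $r>0$;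 put $K(r):=\int_{S^{d-1}}k_\xi(r)\sigma(d\xi)$ for $r>0$. If $\nu=0$ (Gaussian case), $K\equiv0$. *)

theory Defs
  imports "HOL-Probability.Probability"
begin

text \<open>
  Processes are functions on all of \<open>real\<close>; only their values at nonnegative times are
  constrained or used.
\<close>

locale selfsimilar_additive_process = prob_space M
  for M :: "'w measure" and H :: real and X :: "real \<Rightarrow> 'w \<Rightarrow> real ^ 'd" +
  assumes exponent_pos: "H > 0"
    and random_variable: "\<And>t. t \<ge> 0 \<Longrightarrow> X t \<in> borel_measurable M"
    and selfsimilar: "\<And>c J. c > 0 \<Longrightarrow> finite J \<Longrightarrow> J \<subseteq> {0..} \<Longrightarrow>
      distr M (\<Pi>\<^sub>M t\<in>J. borel) (\<lambda>w. \<lambda>t\<in>J. X (c * t) w) =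
      distr M (\<Pi>\<^sub>M t\<in>J. borel) (\<lambda>w. \<lambda>t\<in>J. (c powr H) *\<^sub>R X t w)"
    and independent_increments: "\<And>(n :: nat) s. 0 \<le> s 0 \<Longrightarrow> strict_mono_on {..n} s \<Longrightarrow>
      indep_vars (\<lambda>_. borel) (\<lambda>i w. X (s (Suc i)) w - X (s i) w) {..<n}"
    and cadlag: "AE w in M.
      (\<forall>t\<ge>0. ((\<lambda>u. X u w) \<longlongrightarrow> X t w) (at_right t)) \<and>
      (\<forall>t>0. \<exists>l. ((\<lambda>u. X u w) \<longlongrightarrow> l) (at_left t))"

definition deterministic_process ::
    "'w measure \<Rightarrow> real \<Rightarrow> (real \<Rightarrow> 'w \<Rightarrow> real ^ 'd) \<Rightarrow> bool" where
  "deterministic_process M H X \<longleftrightarrow>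
    (\<exists>c. AE w in M. \<forall>t\<ge>0. X t w = (t powr H) *\<^sub>R c)"

text \<open>
  \<open>levy_measure_of \<mu> \<nu>\<close>: the measure \<open>\<nu>\<close> is the third component of a generating triplet
  \<open>(A, \<nu>, \<gamma>)\<close> in the Levy--Khintchine representation of \<open>\<mu>\<close>, with truncation to the closed
  unit ball. The triplet is unique, and it exists iff \<open>\<mu>\<close> is infinitely divisible.
\<close>

definition levy_measure_of :: "(real ^ 'd) measure \<Rightarrow> (real ^ 'd) measure \<Rightarrow> bool" where
  "levy_measure_of \<mu> \<nu> \<longleftrightarrow>
    sets \<nu> = sets borel \<and>
    emeasure \<nu> {0} = 0 \<and>
    (\<integral>\<^sup>+ x. ennreal (min ((norm x)\<^sup>2) 1) \<partial>\<nu>) < \<infinity> \<and>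
    (\<exists>(A :: real ^ 'd ^ 'd) \<gamma>.
      transpose A = A \<and> (\<forall>z. 0 \<le> z \<bullet> (A *v z)) \<and>
      (\<forall>z. (CLINT x|\<mu>. iexp (z \<bullet> x)) =
        exp (- complex_of_real (z \<bullet> (A *v z)) / 2
             + (CLINT x|\<nu>. iexp (z \<bullet> x) - 1
                  - \<i> * complex_of_real (z \<bullet> x) * indicator (cball 0 1) x)
             + \<i> * complex_of_real (\<gamma> \<bullet> z))))"

text \<open>
  \<open>polar_decomposition \<nu> \<sigma> k\<close>: the representation
  \<open>\<nu>(B) = \<integral> \<sigma>(d\<xi>) \<integral>\<^sub>0\<^sup>\<infinity> 1\<^sub>B(r \<xi>) k\<^sub>\<xi>(r) r\<^sup>-\<^sup>1 dr\<close>, with \<open>\<sigma>\<close> a finite non-zero measure on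
  the unit sphere.
\<close>

definition polar_decomposition ::
    "(real ^ 'd) measure \<Rightarrow> (real ^ 'd) measure \<Rightarrow> (real ^ 'd \<Rightarrow> real \<Rightarrow> real) \<Rightarrow> bool" where
  "polar_decomposition \<nu> \<sigma> k \<longleftrightarrow>
    space \<sigma> = sphere 0 1 \<and> sets \<sigma> = sets (restrict_space borel (sphere 0 1)) \<and>
    emeasure \<sigma> (sphere 0 1) \<noteq> 0 \<and> emeasure \<sigma> (sphere 0 1) < \<infinity> \<and>
    (\<forall>\<xi>\<in>sphere 0 1. \<forall>r>0. 0 \<le> k \<xi> r) \<and>
    (\<forall>r>0. (\<lambda>\<xi>. k \<xi> r) \<in> borel_measurable \<sigma>) \<and>
    (\<forall>\<xi>\<in>sphere 0 1. antimono_on {0<..} (k \<xi>)) \<and>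
    (\<forall>B\<in>sets borel. emeasure \<nu> B =
      (\<integral>\<^sup>+ \<xi>. (\<integral>\<^sup>+ r\<in>{0<..}. indicator B (r *\<^sub>R \<xi>) * ennreal (k \<xi> r / r) \<partial>lborel) \<partial>\<sigma>))"

text \<open>
  The pair \<open>(\<sigma>, k)\<close> is not unique, and \<open>K\<close> is determined by \<open>\<nu>\<close> only up to its values at
  countably many points of discontinuity. Hence \<open>K\<close> is a relation rather than a function of
  \<open>\<nu>\<close>; \<open>inf {r > 0. K r = 0}\<close> does not depend on the choice.
\<close>

definition radial_function :: "(real ^ 'd) measure \<Rightarrow> (real \<Rightarrow> ennreal) \<Rightarrow> bool" where
  "radial_function \<nu> K \<longleftrightarrow>
    (if \<nu> = null_measure borel then \<forall>r>0. K r = 0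
     else \<exists>\<sigma> k. polar_decomposition \<nu> \<sigma> k \<and>
            (\<forall>r>0. K r = (\<integral>\<^sup>+ \<xi>. ennreal (k \<xi> r) \<partial>\<sigma>)))"

text \<open>The value \<open>\<infinity>\<close> at \<open>p \<le> 0\<close> replaces the library convention \<open>ln 0 = 0\<close>.\<close>

definition neg_log :: "real \<Rightarrow> ereal" where
  "neg_log p = (if p \<le> 0 then \<infinity> else ereal (- ln p))"

end

theory Submission
  imports Defs "HOL-Real_Asymp.Real_Asymp"
begin

text \<open>
  Write \<open>C\<^sub>0 = inf {r > 0. K r = 0}\<close>, which is the radius of the smallest centred ball carrying
  \<open>\<nu>\<close>. Both equivalences follow once \<open>- ln \<mu>(|x| > r) / (r ln r) \<rightarrow> 1 / C\<^sub>0\<close> and the \<open>limsup\<close>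
  equals \<open>C\<^sub>0\<close> almost surely.

  For the tail, every projection \<open>z \<bullet> X(1)\<close> is a weak limit of shifted Gaussian plus compound
  Poisson laws. If \<open>\<nu>\<close> lives on \<open>|x| \<le> R\<close>, Fatou bounds the exponential moment at \<open>s\<close> by
  \<open>exp (O(s\<^sup>2) e\<^bsup>sR\<^esup>)\<close>, and \<open>s \<approx> ln r / R\<close> in Markov's inequality gives \<open>exp (- r ln r / R)\<close>.
  Conversely, if \<open>\<nu>\<close> charges \<open>z \<bullet> x > R\<close>, these jumps form an independent compound Poisson
  component, and having \<open>n \<approx> r / R\<close> of them costs \<open>1 / n! \<approx> exp (- r ln r / R)\<close>.

  The upper bound for the \<open>limsup\<close> is Borel--Cantelli along \<open>t = a\<^sup>n\<close> with Ottaviani's maximal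
  inequality. For the lower bound, if the tails of the increments \<open>X(a\<^sup>n\<^sup>+\<^sup>1) - X(a\<^sup>n)\<close> were summable
  at level \<open>c < C\<^sub>0\<close>, then monotonicity would make the tail of \<open>X(1) - X(1/a)\<close> at most
  \<open>exp (- r ln r / c)\<close> up to small changes of \<open>c\<close>; summing over the scales of
  \<open>X(1) = \<Sum>\<^sub>j (X(a\<^sup>-\<^sup>j) - X(a\<^sup>-\<^sup>j\<^sup>-\<^sup>1))\<close> the same would hold for \<open>X(1)\<close>, contradicting the tail
  asymptotics. This route also covers \<open>C\<^sub>0 = \<infinity>\<close>, where the tail of an increment need not be
  comparable with that of \<open>X(1)\<close> by a direct subtraction.
\<close>

section \<open>Compound Poisson distributions on the line\<close>

text \<open>The normalisation is dictated by the tail: along t = a^n, ln t is a multiple of n, and r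
  = c ln n / ln (ln n) satisfies r ln r ~ c ln n. Hence exp (- r ln r / C0) is about n^(- c / C0),
  where C0 is the support radius, and the series over n changes from convergent to divergent at c =
  C0. Selfsimilarity makes each X(a^(n+1)) - X(a^n) a rescaled copy of X(1) - X(1/a), so both halves
  concern the tail of one fixed law. Only the exponent on the scale r ln r matters, and each
  estimate is claimed for every c strictly on one side of C0. The slack absorbs factors exp (O(r)),
  finite sums over directions, shifts of r and factors 1 - \<eta>. The jumps are not extracted from
  the paths. The Levy-Khintchine formula is matched with explicit convolutions through
  characteristic functions, so what is known is a weak limit. This shapes the estimates: exponential
  moments pass to the limit as inequalities, lower tail bounds need closed half-lines at continuity
  points, and the part of the law other than the chosen large jumps only has to be controlled from
  below, uniformly along the sequence.\<close>

lemma real_distribution_convolution: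
  assumes "real_distribution P" "real_distribution Q"
  shows "real_distribution (P \<star> Q)"
proof -
  interpret P: real_distribution P by fact
  interpret Q: real_distribution Q by fact
  interpret PQ: pair_prob_space P Q ..
  have "prob_space (P \<star> Q)"
    unfolding convolution_def by (intro PQ.prob_space_distr) simp
  then show ?thesis
    by (simp add: real_distribution_def real_distribution_axioms_def)
qed

lemma char_convolution:
  assumes "real_distribution P" "real_distribution Q"
  shows "char (P \<star> Q) t = char P t * char Q t"
proof -
  interpret P: real_distribution P by fact
  interpret Q: real_distribution Q by fact
  interpret PQ: pair_prob_space P Q ..
  have int: "integrable (P \<Otimes>\<^sub>M Q) (\<lambda>x. iexp (t * (fst x + snd x)))"
    by (rule PQ.integrable_iexp) auto
  have "char (P \<star> Q) t = (CLINT x|P \<Otimes>\<^sub>M Q. iexp (t * (fst x + snd x)))"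
    unfolding char_def convolution_def by (simp add: integral_distr split_beta')
  also have "\<dots> = (CLINT x|P. CLINT y|Q. iexp (t * (x + y)))"
    by (subst PQ.integral_fst'[symmetric]) (use int in auto)
  also have "\<dots> = (CLINT x|P. iexp (t * x) * (CLINT y|Q. iexp (t * y)))"
    by (simp add: exp_add ring_distribs)
  finally show ?thesis by (simp add: char_def)
qed

lemma nn_integral_exp_convolution:
  fixes s :: real
  assumes "real_distribution P" "real_distribution Q"
  shows "(\<integral>\<^sup>+x. ennreal (exp (s * x)) \<partial>(P \<star> Q)) =
    (\<integral>\<^sup>+x. ennreal (exp (s * x)) \<partial>P) * (\<integral>\<^sup>+x. ennreal (exp (s * x)) \<partial>Q)"
proof -
  interpret P: real_distribution P by fact
  interpret Q: real_distribution Q by fact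
  have "(\<integral>\<^sup>+x. ennreal (exp (s * x)) \<partial>(P \<star> Q)) = (\<integral>\<^sup>+x. \<integral>\<^sup>+y. ennreal (exp (s * (x + y))) \<partial>Q \<partial>P)"
    by (rule nn_integral_convolution) (auto intro: P.finite_measure Q.finite_measure)
  also have "\<dots> = (\<integral>\<^sup>+x. \<integral>\<^sup>+y. ennreal (exp (s * x)) * ennreal (exp (s * y)) \<partial>Q \<partial>P)"
    by (simp add: ring_distribs exp_add ennreal_mult)
  also have "\<dots> = (\<integral>\<^sup>+x. ennreal (exp (s * x)) * (\<integral>\<^sup>+y. ennreal (exp (s * y)) \<partial>Q) \<partial>P)"
    by (intro nn_integral_cong nn_integral_cmult) simp
  also have "\<dots> = (\<integral>\<^sup>+x. ennreal (exp (s * x)) \<partial>P) * (\<integral>\<^sup>+y. ennreal (exp (s * y)) \<partial>Q)"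
    by (rule nn_integral_multc) simp
  finally show ?thesis .
qed

lemma measure_convolution_ge:
  fixes a b :: real
  assumes "real_distribution P" "real_distribution Q"
  shows "measure P {a..} * measure Q {b..} \<le> measure (P \<star> Q) {a + b..}"
    and "measure P {..a} * measure Q {..b} \<le> measure (P \<star> Q) {..a + b}"
proof -
  interpret P: real_distribution P by fact
  interpret Q: real_distribution Q by fact
  interpret PQ: pair_prob_space P Q ..
  have *: "measure P A * measure Q B \<le> measure (P \<star> Q) C"
    if [measurable]: "A \<in> sets borel" "B \<in> sets borel" "C \<in> sets borel"
      and sub: "\<And>x y. x \<in> A \<Longrightarrow> y \<in> B \<Longrightarrow> x + y \<in> C" for A B C :: "real set"
  proof -
    have "measure P A * measure Q B = measure (P \<Otimes>\<^sub>M Q) (A \<times> B)"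
      by (simp add: measure_def Q.emeasure_pair_measure_Times enn2real_mult)
    also have "\<dots> \<le> measure (P \<Otimes>\<^sub>M Q) ((\<lambda>(x, y). x + y) -` C \<inter> space (P \<Otimes>\<^sub>M Q))"
    proof (rule PQ.finite_measure_mono)
      show "(\<lambda>(x, y). x + y) -` C \<inter> space (P \<Otimes>\<^sub>M Q) \<in> sets (P \<Otimes>\<^sub>M Q)"
        by (rule measurable_sets[of _ _ borel]) auto
    qed (use sub in \<open>auto simp: space_pair_measure\<close>)
    also have "\<dots> = measure (P \<star> Q) C"
      unfolding convolution_def by (rule measure_distr[symmetric]) auto
    finally show ?thesis .
  qed
  show "measure P {a..} * measure Q {b..} \<le> measure (P \<star> Q) {a + b..}"
    by (rule *) auto
  show "measure P {..a} * measure Q {..b} \<le> measure (P \<star> Q) {..a + b}"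
    by (rule *) auto
qed

primrec convolution_power :: "real measure \<Rightarrow> nat \<Rightarrow> real measure" where
  "convolution_power Q 0 = return borel 0"
| "convolution_power Q (Suc n) = (Q \<star> convolution_power Q n)"

lemma real_distribution_return: "real_distribution (return borel x)"
  by (simp add: real_distribution_def real_distribution_axioms_def prob_space_return)

lemma char_return: "char (return borel x) t = iexp (t * x)"
  unfolding char_def by (rule integral_return) auto

lemma real_distribution_convolution_power:
  "real_distribution Q \<Longrightarrow> real_distribution (convolution_power Q n)"
  by (induction n) (auto intro: real_distribution_return real_distribution_convolution)

lemma char_convolution_power:
  "real_distribution Q \<Longrightarrow> char (convolution_power Q n) t = char Q t ^ n"
  by (induction n)
    (simp_all add: char_return char_convolution real_distribution_convolution_power)

lemma nn_integral_exp_convolution_power: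
  fixes s :: real
  shows "real_distribution Q \<Longrightarrow> (\<integral>\<^sup>+x. ennreal (exp (s * x)) \<partial>convolution_power Q n) =
    (\<integral>\<^sup>+x. ennreal (exp (s * x)) \<partial>Q) ^ n"
  by (induction n)
    (simp_all add: nn_integral_return nn_integral_exp_convolution
      real_distribution_convolution_power)

lemma measure_convolution_power_ge:
  assumes Q: "real_distribution Q" and ge: "measure Q {a..} = 1"
  shows "measure (convolution_power Q n) {real n * a..} = 1"
proof (induction n)
  case (Suc n)
  interpret QQ: real_distribution "Q \<star> convolution_power Q n"
    by (intro real_distribution_convolution real_distribution_convolution_power Q)
  have "1 = measure Q {a..} * measure (convolution_power Q n) {real n * a..}"
    using Suc ge by simp
  also have "\<dots> \<le> measure (Q \<star> convolution_power Q n) {a + real n * a..}"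
    by (intro measure_convolution_ge real_distribution_convolution_power Q)
  finally show ?case
    using QQ.prob_le_1[of "{a + real n * a..}"] by (simp add: algebra_simps order.antisym)
qed (simp add: measure_return)

definition compound_poisson :: "real \<Rightarrow> real measure \<Rightarrow> real measure" where
  "compound_poisson l Q = measure_pmf (poisson_pmf l) \<bind> convolution_power Q"

context
  fixes Q :: "real measure" and l :: real
  assumes Q: "real_distribution Q" and l: "0 < l"
begin

lemma convolution_power_measurable:
  "convolution_power Q \<in> measurable (measure_pmf (poisson_pmf l)) (subprob_algebra borel)"
proof -
  have "convolution_power Q n \<in> space (subprob_algebra borel)" for n
  proof -
    interpret real_distribution "convolution_power Q n"
      by (rule real_distribution_convolution_power[OF Q])
    show ?thesis
      by (auto simp: space_subprob_algebra intro: prob_space_imp_subprob_space prob_space_axioms)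
  qed
  then show ?thesis by (simp add: measurable_def)
qed

lemma real_distribution_compound_poisson: "real_distribution (compound_poisson l Q)"
proof -
  have "prob_space (compound_poisson l Q)"
    unfolding compound_poisson_def
  proof (rule measure_pmf.prob_space_bind[OF _ convolution_power_measurable])
    show "AE x in measure_pmf (poisson_pmf l). prob_space (convolution_power Q x)"
      using real_distribution_convolution_power[OF Q]
      by (auto simp: real_distribution_def)
  qed
  moreover have "sets (compound_poisson l Q) = sets borel"
    unfolding compound_poisson_def
    by (rule sets_bind[where N=borel])
       (simp_all add: real_distribution.events_eq_borel[OF real_distribution_convolution_power[OF Q]])
  ultimately show ?thesis
    by (simp add: real_distribution_def real_distribution_axioms_def)
qed

lemma integral_compound_poisson:
  fixes f :: "real \<Rightarrow> real"
  assumes "f \<in> borel_measurable borel" "\<And>x. \<bar>f x\<bar> \<le> B"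
  shows "(LINT x|compound_poisson l Q. f x) =
    (LINT n|measure_pmf (poisson_pmf l). LINT x|convolution_power Q n. f x)"
  unfolding compound_poisson_def
proof (rule integral_bind[where B=B and B'=1, OF assms(1) _ convolution_power_measurable])
  have "emeasure (convolution_power Q x) (space (convolution_power Q x)) = 1" for x
    using real_distribution_convolution_power[OF Q, of x]
    by (simp only: prob_space.emeasure_space_1 real_distribution_def)
  then show "AE x in measure_pmf (poisson_pmf l).
      emeasure (convolution_power Q x) (space (convolution_power Q x)) \<le> ennreal 1"
    by simp
qed (use assms in \<open>auto intro: measure_pmf.finite_measure\<close>)

lemma char_compound_poisson:
  "char (compound_poisson l Q) t = exp (complex_of_real l * (char Q t - 1))"
proof -
  let ?p = "measure_pmf (poisson_pmf l)"
  interpret CP: real_distribution "compound_poisson l Q"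
    by (rule real_distribution_compound_poisson)
  interpret Q: real_distribution Q by (rule Q)
  have int: "integrable P (\<lambda>x. iexp (t * x))" if "real_distribution P" for P
  proof -
    interpret real_distribution P by fact
    show ?thesis by (rule integrable_iexp) auto
  qed
  have Re: "Re (char P t) = (LINT x|P. cos (t * x))"
    and Im: "Im (char P t) = (LINT x|P. sin (t * x))" if "real_distribution P" for P
    unfolding char_def
    using integral_Re[OF int[OF that]] integral_Im[OF int[OF that]]
    by (simp_all add: Re_exp Im_exp)
  have intp: "integrable ?p (\<lambda>n. char Q t ^ n)"
    by (rule measure_pmf.integrable_const_bound[where B=1])
       (auto simp: norm_power intro!: power_le_one Q.cmod_char_le_1)
  have "char (compound_poisson l Q) t = (CLINT n|?p. char Q t ^ n)"
  \<comment> \<open>The mixture formula is available for bounded real integrands, so cosine and sine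
    are treated separately.\<close>
  proof (rule complex_eqI)
    have "Re (char (compound_poisson l Q) t) = (LINT x|compound_poisson l Q. cos (t * x))"
      by (rule Re) (rule real_distribution_compound_poisson)
    also have "\<dots> = (LINT n|?p. LINT x|convolution_power Q n. cos (t * x))"
      by (rule integral_compound_poisson[where B=1]) auto
    also have "\<dots> = (LINT n|?p. Re (char Q t ^ n))"
      using Re[OF real_distribution_convolution_power[OF Q]] Q
      by (simp add: char_convolution_power)
    also have "\<dots> = Re (CLINT n|?p. char Q t ^ n)"
      by (rule integral_Re[OF intp])
    finally show "Re (char (compound_poisson l Q) t) = Re (CLINT n|?p. char Q t ^ n)" .
    have "Im (char (compound_poisson l Q) t) = (LINT x|compound_poisson l Q. sin (t * x))"
      by (rule Im) (rule real_distribution_compound_poisson)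
    also have "\<dots> = (LINT n|?p. LINT x|convolution_power Q n. sin (t * x))"
      by (rule integral_compound_poisson[where B=1]) auto
    also have "\<dots> = (LINT n|?p. Im (char Q t ^ n))"
      using Im[OF real_distribution_convolution_power[OF Q]] Q
      by (simp add: char_convolution_power)
    also have "\<dots> = Im (CLINT n|?p. char Q t ^ n)"
      by (rule integral_Im[OF intp])
    finally show "Im (char (compound_poisson l Q) t) = Im (CLINT n|?p. char Q t ^ n)" .
  qed
  also have "\<dots> = (CLINT n|count_space UNIV. pmf (poisson_pmf l) n *\<^sub>R char Q t ^ n)"
    unfolding measure_pmf_eq_density by (rule integral_density) auto
  also have "\<dots> = (\<Sum>n. pmf (poisson_pmf l) n *\<^sub>R char Q t ^ n)"
  proof (rule integral_count_space_nat)
    show "integrable (count_space UNIV) (\<lambda>n. pmf (poisson_pmf l) n *\<^sub>R char Q t ^ n)"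
      using intp unfolding measure_pmf_eq_density by (subst (asm) integrable_density) auto
  qed
  also have "\<dots> = exp (complex_of_real l * (char Q t - 1))"
  proof (rule sums_unique[symmetric])
    have "(\<lambda>n. exp (complex_of_real (- l)) * ((complex_of_real l * char Q t) ^ n /\<^sub>R fact n)) sums
        (exp (complex_of_real (- l)) * exp (complex_of_real l * char Q t))"
      by (intro sums_mult exp_converges)
    also have "exp (complex_of_real (- l)) * exp (complex_of_real l * char Q t) =
        exp (complex_of_real l * (char Q t - 1))"
      by (simp add: exp_add[symmetric] algebra_simps)
    also have "(\<lambda>n. exp (complex_of_real (- l)) * ((complex_of_real l * char Q t) ^ n /\<^sub>R fact n)) =
        (\<lambda>n. pmf (poisson_pmf l) n *\<^sub>R char Q t ^ n)"
      using l by (auto simp: scaleR_conv_of_real power_mult_distrib exp_of_real field_simps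
        simp flip: exp_of_real)
    finally show "(\<lambda>n. pmf (poisson_pmf l) n *\<^sub>R char Q t ^ n) sums
        exp (complex_of_real l * (char Q t - 1))" .
  qed
  finally show ?thesis .
qed

lemma nn_integral_exp_compound_poisson:
  fixes s :: real
  assumes m: "(\<integral>\<^sup>+x. ennreal (exp (s * x)) \<partial>Q) = ennreal m" "0 \<le> m"
  shows "(\<integral>\<^sup>+x. ennreal (exp (s * x)) \<partial>compound_poisson l Q) = ennreal (exp (l * (m - 1)))"
proof -
  let ?p = "measure_pmf (poisson_pmf l)"
  have "(\<integral>\<^sup>+x. ennreal (exp (s * x)) \<partial>compound_poisson l Q) =
      (\<integral>\<^sup>+n. \<integral>\<^sup>+x. ennreal (exp (s * x)) \<partial>convolution_power Q n \<partial>?p)"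
    unfolding compound_poisson_def
    by (rule nn_integral_bind[OF _ convolution_power_measurable]) simp
  also have "\<dots> = (\<integral>\<^sup>+n. ennreal (m ^ n) \<partial>?p)"
    using m by (simp add: nn_integral_exp_convolution_power[OF Q] ennreal_power)
  also have "\<dots> = (\<Sum>n. ennreal (pmf (poisson_pmf l) n * m ^ n))"
    by (simp add: nn_integral_measure_pmf nn_integral_count_space_nat ennreal_mult m(2))
  also have "\<dots> = ennreal (exp (l * (m - 1)))"
  proof (rule suminf_ennreal_eq)
    have "(\<lambda>n. exp (- l) * ((l * m) ^ n /\<^sub>R fact n)) sums (exp (- l) * exp (l * m))"
      by (intro sums_mult exp_converges)
    also have "exp (- l) * exp (l * m) = exp (l * (m - 1))"
      by (simp add: exp_add[symmetric] algebra_simps)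
    finally show "(\<lambda>n. pmf (poisson_pmf l) n * m ^ n) sums exp (l * (m - 1))"
      using l by (simp add: power_mult_distrib field_simps)
  qed (use l m in auto)
  finally show ?thesis .
qed

text \<open>Only the event of exactly \<open>n\<close> jumps is kept; each of them is almost surely
  at least \<open>a\<close>, so their sum is at least \<open>n * a\<close>. The bound holds for
  either sign of \<open>a\<close>.\<close>

lemma measure_compound_poisson_ge:
  assumes "measure Q {a..} = 1"
  shows "exp (- l) * l ^ n / fact n \<le> measure (compound_poisson l Q) {real n * a..}"
proof -
  let ?p = "measure_pmf (poisson_pmf l)"
  interpret CP: real_distribution "compound_poisson l Q"
    by (rule real_distribution_compound_poisson)
  have "exp (- l) * l ^ n / fact n = measure ?p {n}"
    using l by (simp add: measure_pmf_single)
  also have "\<dots> = (LINT k|?p. indicator {n} k)"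
    by simp
  also have "\<dots> \<le> (LINT k|?p. measure (convolution_power Q k) {real n * a..})"
  proof (rule integral_mono)
    show "integrable ?p (\<lambda>k. measure (convolution_power Q k) {real n * a..})"
      using real_distribution_convolution_power[OF Q]
      by (intro measure_pmf.integrable_const_bound[where B=1])
         (auto simp: real_distribution_def intro!: prob_space.prob_le_1)
    show "indicator {n} k \<le> measure (convolution_power Q k) {real n * a..}" for k
      using measure_convolution_power_ge[OF Q assms, of n] by (auto simp: indicator_def)
  qed (rule measure_pmf.integrable_const_bound[where B=1], auto)
  also have "\<dots> = (LINT k|?p. LINT x|convolution_power Q k. indicator {real n * a..} x)"
    using real_distribution_convolution_power[OF Q]
    by (auto intro!: Bochner_Integration.integral_cong
        simp: real_distribution.events_eq_borel sets_eq_imp_space_eq[OF real_distribution.events_eq_borel])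
  also have "\<dots> = (LINT x|compound_poisson l Q. indicator {real n * a..} x)"
    by (rule integral_compound_poisson[where B=1, symmetric]) auto
  finally show ?thesis by simp
qed

end

text \<open>The compound Poisson law whose jump intensity is the image of the finite measure \<rho>
  under \<open>f\<close>. The jump law is the normalised image, so mass zero has to be split
  off.\<close>

definition poisson_image :: "'a measure \<Rightarrow> ('a \<Rightarrow> real) \<Rightarrow> real measure" where
  "poisson_image \<rho> f = (if measure \<rho> (space \<rho>) = 0 then return borel 0 else
     compound_poisson (measure \<rho> (space \<rho>))
       (distr (density \<rho> (\<lambda>_. ennreal (1 / measure \<rho> (space \<rho>)))) borel f))"

context
  fixes \<rho> :: "'a measure" and f :: "'a \<Rightarrow> real"
  assumes fin: "finite_measure \<rho>" and f[measurable]: "f \<in> borel_measurable \<rho>"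
begin

interpretation finite_measure \<rho> by (rule fin)

lemma real_distribution_normalized:
  assumes "measure \<rho> (space \<rho>) \<noteq> 0"
  shows "real_distribution (distr (density \<rho> (\<lambda>_. ennreal (1 / measure \<rho> (space \<rho>)))) borel f)"
proof -
  have pos: "measure \<rho> (space \<rho>) > 0" using assms by (simp add: less_le)
  have "emeasure (density \<rho> (\<lambda>_. ennreal (1 / measure \<rho> (space \<rho>)))) (space \<rho>) = 1"
    using pos by (simp add: emeasure_density emeasure_eq_measure ennreal_mult[symmetric])
  then have "prob_space (density \<rho> (\<lambda>_. ennreal (1 / measure \<rho> (space \<rho>))))"
    by (intro prob_spaceI) simp
  then have "prob_space (distr (density \<rho> (\<lambda>_. ennreal (1 / measure \<rho> (space \<rho>)))) borel f)"
    by (rule prob_space.prob_space_distr) simp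
  then show ?thesis
    by (simp add: real_distribution_def real_distribution_axioms_def)
qed

lemma AE_zero_mass: "measure \<rho> (space \<rho>) = 0 \<Longrightarrow> AE x in \<rho>. P x"
  using AE_iff_measurable[of "space \<rho>" \<rho> "\<lambda>_. False"]
  by (auto simp: emeasure_eq_measure)

lemma real_distribution_poisson_image: "real_distribution (poisson_image \<rho> f)"
proof (cases "measure \<rho> (space \<rho>) = 0")
  case False
  then show ?thesis
    using real_distribution_normalized[OF False]
    by (auto simp: poisson_image_def less_le intro!: real_distribution_compound_poisson)
qed (simp add: poisson_image_def real_distribution_return)

lemma integrable_iexp_comp: "integrable \<rho> (\<lambda>x. iexp (t * f x))"
  by (rule integrable_const_bound[where B=1]) auto

lemma char_poisson_image:
  "char (poisson_image \<rho> f) t = exp (CLINT x|\<rho>. iexp (t * f x) - 1)"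
proof (cases "measure \<rho> (space \<rho>) = 0")
  case True
  have "(CLINT x|\<rho>. iexp (t * f x) - 1) = (CLINT x|\<rho>. 0)"
    by (rule integral_cong_AE) (use AE_zero_mass[OF True] in auto)
  then show ?thesis
    using True by (simp add: poisson_image_def char_return)
next
  case False
  let ?l = "measure \<rho> (space \<rho>)"
  let ?Q = "distr (density \<rho> (\<lambda>_. ennreal (1 / ?l))) borel f"
  have pos: "?l > 0" using False by (simp add: less_le)
  have "char ?Q t = (CLINT x|density \<rho> (\<lambda>_. ennreal (1 / ?l)). iexp (t * f x))"
    by (simp add: char_def integral_distr)
  also have "\<dots> = (CLINT x|\<rho>. (1 / ?l) *\<^sub>R iexp (t * f x))"
    by (rule integral_density) auto
  also have "\<dots> = (1 / ?l) *\<^sub>R (CLINT x|\<rho>. iexp (t * f x))"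
    by (rule integral_scaleR_right)
  finally have Q: "char ?Q t = (1 / ?l) *\<^sub>R (CLINT x|\<rho>. iexp (t * f x))" .
  have "(CLINT x|\<rho>. iexp (t * f x) - 1) = (CLINT x|\<rho>. iexp (t * f x)) - complex_of_real ?l"
    using integrable_iexp_comp by (simp add: scaleR_conv_of_real)
  also have "\<dots> = complex_of_real ?l * (char ?Q t - 1)"
    using pos unfolding Q by (simp add: scaleR_conv_of_real field_simps)
  finally show ?thesis
    using char_compound_poisson[OF real_distribution_normalized[OF False] pos] False
    by (simp add: poisson_image_def)
qed

lemma nn_integral_exp_poisson_image:
  fixes s :: real
  assumes int: "integrable \<rho> (\<lambda>x. exp (s * f x))"
  shows "(\<integral>\<^sup>+x. ennreal (exp (s * x)) \<partial>poisson_image \<rho> f) =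
    ennreal (exp (LINT x|\<rho>. exp (s * f x) - 1))"
proof (cases "measure \<rho> (space \<rho>) = 0")
  case True
  have "(LINT x|\<rho>. exp (s * f x) - 1) = (LINT x|\<rho>. 0)"
    by (rule integral_cong_AE) (use AE_zero_mass[OF True] in auto)
  then show ?thesis
    using True by (simp add: poisson_image_def nn_integral_return)
next
  case False
  let ?l = "measure \<rho> (space \<rho>)"
  let ?Q = "distr (density \<rho> (\<lambda>_. ennreal (1 / ?l))) borel f"
  let ?m = "(1 / ?l) * (LINT x|\<rho>. exp (s * f x))"
  have pos: "?l > 0" using False by (simp add: less_le)
  have "(\<integral>\<^sup>+x. ennreal (exp (s * x)) \<partial>?Q) =
      (\<integral>\<^sup>+x. ennreal (exp (s * f x)) \<partial>density \<rho> (\<lambda>_. ennreal (1 / ?l)))"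
    by (simp add: nn_integral_distr)
  also have "\<dots> = (\<integral>\<^sup>+x. ennreal (1 / ?l) * ennreal (exp (s * f x)) \<partial>\<rho>)"
    by (rule nn_integral_density) auto
  also have "\<dots> = ennreal (1 / ?l) * (\<integral>\<^sup>+x. ennreal (exp (s * f x)) \<partial>\<rho>)"
    by (rule nn_integral_cmult) auto
  also have "\<dots> = ennreal (1 / ?l) * ennreal (LINT x|\<rho>. exp (s * f x))"
    using int by (subst nn_integral_eq_integral) auto
  also have "\<dots> = ennreal ?m"
    using pos by (intro ennreal_mult[symmetric]) (auto intro: integral_nonneg_AE)
  finally have Q: "(\<integral>\<^sup>+x. ennreal (exp (s * x)) \<partial>?Q) = ennreal ?m" .
  have nn: "0 \<le> ?m" using pos by (auto intro: integral_nonneg_AE)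
  have "(LINT x|\<rho>. exp (s * f x) - 1) = (LINT x|\<rho>. exp (s * f x)) - ?l"
    using int by simp
  also have "\<dots> = ?l * (?m - 1)"
    using pos by (simp add: field_simps)
  finally show ?thesis
    using nn_integral_exp_compound_poisson[OF real_distribution_normalized[OF False] pos Q nn] False
    by (simp add: poisson_image_def)
qed

lemma measure_poisson_image_ge:
  assumes ge: "AE x in \<rho>. a \<le> f x"
  shows "exp (- measure \<rho> (space \<rho>)) * measure \<rho> (space \<rho>) ^ n / fact n
    \<le> measure (poisson_image \<rho> f) {real n * a..}"
proof (cases "measure \<rho> (space \<rho>) = 0")
  case True
  then show ?thesis
    by (cases n) (auto simp: poisson_image_def measure_return)
next
  case False
  let ?l = "measure \<rho> (space \<rho>)"
  let ?Q = "distr (density \<rho> (\<lambda>_. ennreal (1 / ?l))) borel f"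
  have pos: "?l > 0" using False by (simp add: less_le)
  interpret Q: real_distribution ?Q by (rule real_distribution_normalized[OF False])
  have "AE x in ?Q. a \<le> x"
    using ge by (subst AE_distr_iff) (auto simp: AE_density)
  then have "measure ?Q {a..} = 1"
    by (subst Q.prob_eq_1) auto
  from measure_compound_poisson_ge[OF real_distribution_normalized[OF False] pos this] False
  show ?thesis by (simp add: poisson_image_def)
qed

end

section \<open>Levy--Khintchine distributions on the line\<close>

text \<open>The factor y^2 makes small jumps integrable against a Levy measure, and the exponential
  factor is the source of the growth exp (s R) of the log moment. Both signs of \<open>y\<close> are
  covered, since projected jumps may be negative.\<close>

lemma exp_minus_one_minus_le:
  fixes y :: real
  shows "exp y - 1 - y \<le> y\<^sup>2 * exp \<bar>y\<bar>"
proof -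
  have 1: "exp y - 1 \<le> y * exp y" for y :: real
    using exp_ge_add_one_self[of "- y"] by (simp add: exp_minus field_simps)
  have "exp y - 1 - y \<le> y * (exp y - 1)"
    using 1[of y] by (simp add: algebra_simps)
  also have "\<dots> \<le> y\<^sup>2 * exp \<bar>y\<bar>"
  proof (cases "y \<ge> 0")
    case True
    then show ?thesis
      using mult_left_mono[OF 1[of y] True] by (simp add: power2_eq_square)
  next
    case False
    have "1 - exp y \<le> - y"
      using exp_ge_add_one_self[of y] by linarith
    then have "(- y) * (1 - exp y) \<le> (- y) * (- y)"
      using False by (intro mult_left_mono) auto
    also have "\<dots> \<le> y\<^sup>2 * exp \<bar>y\<bar>"
      using mult_left_mono[of 1 "exp \<bar>y\<bar>" "y\<^sup>2"] by (simp add: power2_eq_square)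
    finally show ?thesis by (simp add: algebra_simps)
  qed
  finally show ?thesis .
qed

lemma norm_iexp_minus_one_minus_le:
  "norm (iexp y - 1 - \<i> * complex_of_real y) \<le> y\<^sup>2"
proof -
  have "norm (iexp y - 1 - \<i> * complex_of_real y) \<le> \<bar>y\<bar>\<^sup>2 / 2"
    using iexp_approx1[of y 1] by (simp add: numeral_2_eq_2 algebra_simps)
  also have "\<dots> \<le> y\<^sup>2" by simp
  finally show ?thesis .
qed

text \<open>The standard normal law is scaled instead of using a density, so that variance 0 is
  included as the point mass at 0.\<close>

definition centred_normal :: "real \<Rightarrow> real measure" where
  "centred_normal a = distr std_normal_distribution borel (\<lambda>x. sqrt a * x)"

lemma real_distribution_centred_normal: "real_distribution (centred_normal a)"
proof -
  interpret real_distribution std_normal_distribution by (rule real_dist_normal_dist)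
  have "prob_space (centred_normal a)"
    unfolding centred_normal_def by (rule prob_space_distr) simp
  then show ?thesis
    by (simp add: centred_normal_def real_distribution_def real_distribution_axioms_def)
qed

lemma char_centred_normal:
  assumes "a \<ge> 0"
  shows "char (centred_normal a) t = exp (- complex_of_real (a * t\<^sup>2) / 2)"
proof -
  have "char (centred_normal a) t = char std_normal_distribution (sqrt a * t)"
    unfolding char_def centred_normal_def by (subst integral_distr) (auto simp: mult_ac)
  also have "\<dots> = exp (complex_of_real (- (sqrt a * t)\<^sup>2 / 2))"
    by (simp only: char_std_normal_distribution exp_of_real)
  also have "(sqrt a * t)\<^sup>2 = a * t\<^sup>2"
    using assms by (simp add: power_mult_distrib)
  finally show ?thesis by simp
qed

lemma nn_integral_exp_centred_normal:
  fixes s :: real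
  assumes "a \<ge> 0"
  shows "(\<integral>\<^sup>+x. ennreal (exp (s * x)) \<partial>centred_normal a) = ennreal (exp (a * s\<^sup>2 / 2))"
proof -
  let ?u = "s * sqrt a"
  interpret N: prob_space "density lborel (\<lambda>x. ennreal (normal_density ?u 1 x))"
    by (rule prob_space_normal_density) simp
  have "(\<integral>\<^sup>+x. ennreal (exp (s * x)) \<partial>centred_normal a) =
      (\<integral>\<^sup>+x. ennreal (exp (s * (sqrt a * x))) \<partial>std_normal_distribution)"
    unfolding centred_normal_def by (subst nn_integral_distr) auto
  also have "\<dots> = (\<integral>\<^sup>+x. ennreal (std_normal_density x) * ennreal (exp (s * (sqrt a * x))) \<partial>lborel)"
    by (subst nn_integral_density) auto
  also have "\<dots> = (\<integral>\<^sup>+x. ennreal (exp (?u\<^sup>2 / 2)) * ennreal (normal_density ?u 1 x) \<partial>lborel)"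
    by (intro nn_integral_cong)
       (simp add: normal_density_def ennreal_mult[symmetric] exp_add[symmetric] power2_eq_square field_simps)
  also have "\<dots> = ennreal (exp (?u\<^sup>2 / 2)) * (\<integral>\<^sup>+x. ennreal (normal_density ?u 1 x) \<partial>lborel)"
    by (rule nn_integral_cmult) auto
  also have "(\<integral>\<^sup>+x. ennreal (normal_density ?u 1 x) \<partial>lborel) = 1"
    using N.emeasure_space_1 by (simp add: emeasure_density)
  finally show ?thesis
    using assms by (simp add: power_mult_distrib mult.commute)
qed


section \<open>Weak limits of tails and exponential moments\<close>

lemma weak_conv_upper_closed_tail:
  fixes D :: "nat \<Rightarrow> real measure"
  assumes D: "\<And>n. real_distribution (D n)" and P: "real_distribution P"
    and wc: "weak_conv_m D P" and ev: "\<forall>\<^sub>F n in sequentially. c \<le> measure (D n) {x..}"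
  shows "c \<le> measure P {x - 1..}"
proof -
  interpret P: real_distribution P by fact
  \<comment> \<open>\<open>x\<close> itself may be an atom of \<open>P\<close>. Atoms are countable,
    so an interval of length 1 contains a continuity point; this is where the loss of 1 in the
    conclusion comes from.\<close>
  have "uncountable ({x - 1<..<x} - {y. measure P {y} \<noteq> 0})"
    by (intro uncountable_minus_countable P.countable_support uncountable_open_interval[THEN iffD2]) simp
  then have "{x - 1<..<x} - {y. measure P {y} \<noteq> 0} \<noteq> {}"
    by (metis countable_empty)
  then obtain y where y: "x - 1 < y" "y < x" "measure P {y} = 0"
    by auto
  have "(\<lambda>n. measure (D n) {y..}) \<longlonglongrightarrow> measure P {y..}"
    using y by (intro weak_conv_imp_continuity_set_conv[OF D P wc])
      (auto simp: frontier_real_atLeast P.emeasure_eq_measure)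
  moreover have "\<forall>\<^sub>F n in sequentially. c \<le> measure (D n) {y..}"
    using ev
  proof eventually_elim
    case (elim n)
    interpret D: real_distribution "D n" by (rule D)
    have "measure (D n) {x..} \<le> measure (D n) {y..}"
      using y by (intro D.finite_measure_mono) auto
    with elim show ?case by linarith
  qed
  ultimately have "c \<le> measure P {y..}"
    by (rule tendsto_lowerbound) simp
  also have "\<dots> \<le> measure P {x - 1..}"
    using y by (intro P.finite_measure_mono) auto
  finally show ?thesis .
qed

lemma weak_conv_lower_tight:
  fixes D :: "nat \<Rightarrow> real measure"
  assumes D: "\<And>n. real_distribution (D n)" and P: "real_distribution P"
    and wc: "weak_conv_m D P" and e: "0 < e"
  shows "\<exists>m. \<forall>\<^sub>F n in sequentially. measure (D n) {..m} < e"
proof -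
  interpret P: real_distribution P by fact
  have "\<forall>\<^sub>F x in at_bot. cdf P x < e"
    using P.cdf_lim_at_bot e by (rule order_tendstoD)
  then obtain m0 where m0: "cdf P m0 < e"
    by (meson eventually_at_bot_linorder order_refl)
  have "uncountable ({m0 - 1<..<m0} - {y. measure P {y} \<noteq> 0})"
    by (intro uncountable_minus_countable P.countable_support uncountable_open_interval[THEN iffD2]) simp
  then have "{m0 - 1<..<m0} - {y. measure P {y} \<noteq> 0} \<noteq> {}"
    by (metis countable_empty)
  then obtain m where m: "m < m0" "measure P {m} = 0"
    by auto
  have "(\<lambda>n. measure (D n) {..m}) \<longlonglongrightarrow> measure P {..m}"
    using m by (intro weak_conv_imp_continuity_set_conv[OF D P wc])
      (auto simp: frontier_real_atMost P.emeasure_eq_measure)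
  moreover have "measure P {..m} < e"
    using m m0 P.cdf_nondecreasing[of m m0] by (simp add: cdf_def)
  ultimately show ?thesis
    by (metis order_tendstoD(2))
qed

text \<open>For unbounded \<open>h\<close> weak convergence gives an inequality only. The Skorohod
  representation turns it into pointwise convergence, after which Fatou's lemma applies.\<close>

lemma weak_conv_nn_integral_le:
  fixes D :: "nat \<Rightarrow> real measure" and h :: "real \<Rightarrow> real"
  assumes D: "\<And>n. real_distribution (D n)" and P: "real_distribution P"
    and wc: "weak_conv_m D P" and h: "continuous_on UNIV h"
    and bound: "\<And>n. (\<integral>\<^sup>+x. ennreal (h x) \<partial>D n) \<le> c"
  shows "(\<integral>\<^sup>+x. ennreal (h x) \<partial>P) \<le> c"
proof -
  from Skorohod[OF D P wc] obtain \<Omega> :: "real measure" and Y Z where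
    \<Omega>: "prob_space \<Omega>" and [measurable]: "\<And>n. Y n \<in> measurable \<Omega> borel" and
    dY: "\<And>n. distr \<Omega> borel (Y n) = D n" and Z': "Z \<in> measurable \<Omega> lborel" and
    dZ: "distr \<Omega> borel Z = P" and lim: "\<And>x. x \<in> space \<Omega> \<Longrightarrow> (\<lambda>n. Y n x) \<longlonglongrightarrow> Z x"
    by blast
  have [measurable]: "Z \<in> borel_measurable \<Omega>" using Z' by simp
  have [measurable]: "h \<in> borel_measurable borel"
    using h by (rule borel_measurable_continuous_onI)
  have "(\<integral>\<^sup>+x. ennreal (h x) \<partial>P) = (\<integral>\<^sup>+x. ennreal (h (Z x)) \<partial>\<Omega>)"
    unfolding dZ[symmetric] by (subst nn_integral_distr) auto
  also have "\<dots> = (\<integral>\<^sup>+x. liminf (\<lambda>n. ennreal (h (Y n x))) \<partial>\<Omega>)"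
  proof (intro nn_integral_cong)
    fix x assume x: "x \<in> space \<Omega>"
    have "isCont h (Z x)" using h by (simp add: continuous_on_eq_continuous_at)
    then have "(\<lambda>n. ennreal (h (Y n x))) \<longlonglongrightarrow> ennreal (h (Z x))"
      by (intro tendsto_ennrealI isCont_tendsto_compose[OF _ lim[OF x]])
    then show "ennreal (h (Z x)) = liminf (\<lambda>n. ennreal (h (Y n x)))"
      by (simp add: lim_imp_Liminf)
  qed
  also have "\<dots> \<le> liminf (\<lambda>n. \<integral>\<^sup>+x. ennreal (h (Y n x)) \<partial>\<Omega>)"
    by (rule nn_integral_liminf) simp
  also have "\<dots> = liminf (\<lambda>n. \<integral>\<^sup>+x. ennreal (h x) \<partial>D n)"
    unfolding dY[symmetric] by (subst nn_integral_distr) auto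
  also have "\<dots> \<le> liminf (\<lambda>n. c)"
    by (intro Liminf_mono always_eventually allI bound)
  finally show ?thesis by (simp add: Liminf_const)
qed

text \<open>
  The jumps are kept on an abstract space, with \<open>f\<close> their projection to the line and \<open>g\<close> their
  size, since the truncation set of a projected Levy measure is not an interval.
\<close>

locale levy_khintchine_line = real_distribution P for P :: "real measure" +
  fixes \<nu> :: "'a measure" and f g :: "'a \<Rightarrow> real" and a \<gamma> :: real
  assumes f[measurable]: "f \<in> borel_measurable \<nu>" and g[measurable]: "g \<in> borel_measurable \<nu>"
    and abs_f_le: "\<And>x. \<bar>f x\<bar> \<le> g x" and a_nonneg: "0 \<le> a"
    and finite_min: "(\<integral>\<^sup>+ x. ennreal (min ((g x)\<^sup>2) 1) \<partial>\<nu>) < \<infinity>"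
    and char_eq: "\<And>t. char P t = exp (- complex_of_real (a * t\<^sup>2) / 2
      + (CLINT x|\<nu>. iexp (t * f x) - 1 - \<i> * complex_of_real (t * f x) * indicator {x. g x \<le> 1} x)
      + \<i> * complex_of_real (t * \<gamma>))"
begin

lemma g_nonneg: "0 \<le> g x"
  using abs_f_le[of x] by linarith

lemma integrable_min: "integrable \<nu> (\<lambda>x. min ((g x)\<^sup>2) 1)"
  using finite_min by (intro integrableI_nonneg) auto

abbreviation "trunc t x \<equiv>
  iexp (t * f x) - 1 - \<i> * complex_of_real (t * f x) * indicator {x. g x \<le> 1} x"

text \<open>The constant serves two regimes: t^2 comes from the second-order Taylor bound where
  \<open>g x \<le> 1\<close>, and 2 is the trivial bound on the difference of two unimodular numbers
  elsewhere.\<close>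

lemma norm_trunc_le: "norm (trunc t x) \<le> (t\<^sup>2 + 2) * min ((g x)\<^sup>2) 1"
proof (cases "g x \<le> 1")
  case True
  have "(f x)\<^sup>2 \<le> (g x)\<^sup>2"
    using abs_f_le[of x] by (simp add: abs_le_square_iff[symmetric] g_nonneg)
  then have "(t * f x)\<^sup>2 \<le> t\<^sup>2 * (g x)\<^sup>2"
    by (simp add: power_mult_distrib mult_left_mono)
  also have "\<dots> \<le> (t\<^sup>2 + 2) * (g x)\<^sup>2"
    by (intro mult_right_mono) auto
  finally show ?thesis
    using True norm_iexp_minus_one_minus_le[of "t * f x"] g_nonneg[of x]
    by (simp add: min_absorb1 power_le_one)
next
  case False
  then have "1 \<le> (g x)\<^sup>2" by (intro one_le_power) auto
  moreover have "norm (iexp (t * f x) - 1) \<le> 2"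
    using norm_triangle_ineq4[of "iexp (t * f x)" 1] by simp
  ultimately show ?thesis using False by (simp add: min_absorb2 add_increasing)
qed

lemma integrable_trunc: "integrable \<nu> (trunc t)"
proof (rule Bochner_Integration.integrable_bound)
  show "integrable \<nu> (\<lambda>x. (t\<^sup>2 + 2) * min ((g x)\<^sup>2) 1)"
    using integrable_min by simp
  show "AE x in \<nu>. norm (trunc t x) \<le> norm ((t\<^sup>2 + 2) * min ((g x)\<^sup>2) 1)"
    using norm_trunc_le by (intro AE_I2) (auto simp: abs_mult intro: order_trans)
qed simp

text \<open>Jump sizes bounded away from 0 force finite \<nu>-mass, which is what allows the jumps
  in \<open>A\<close> to be represented by a compound Poisson law.\<close>

definition large_jumps :: "'a set \<Rightarrow> bool" where
  "large_jumps A \<longleftrightarrow> A \<in> sets \<nu> \<and> (\<exists>d>0. \<forall>x\<in>A. d < g x)"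

abbreviation "jumps A \<equiv> density \<nu> (indicator A)"

lemma large_jumps_measurable: "large_jumps A \<Longrightarrow> A \<in> sets \<nu>"
  by (simp add: large_jumps_def)

lemma large_jumps_subset: "large_jumps A \<Longrightarrow> B \<subseteq> A \<Longrightarrow> B \<in> sets \<nu> \<Longrightarrow> large_jumps B"
  unfolding large_jumps_def by blast

lemma large_jumps_Un: "large_jumps A \<Longrightarrow> large_jumps B \<Longrightarrow> large_jumps (A \<union> B)"
  unfolding large_jumps_def
proof safe
  fix d e :: real assume "0 < d" "0 < e" "\<forall>x\<in>A. d < g x" "\<forall>x\<in>B. e < g x"
  then show "\<exists>d>0. \<forall>x\<in>A \<union> B. d < g x"
    by (intro exI[of _ "min d e"]) auto
qed auto

lemma integrable_indicator_large:
  assumes "large_jumps A"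
  shows "integrable \<nu> (indicator A :: 'a \<Rightarrow> real)"
proof -
  from assms obtain d where d: "0 < d" "\<And>x. x \<in> A \<Longrightarrow> d < g x" and [measurable]: "A \<in> sets \<nu>"
    by (auto simp: large_jumps_def)
  let ?c = "1 / min (d\<^sup>2) 1"
  show ?thesis
  proof (rule Bochner_Integration.integrable_bound)
    show "integrable \<nu> (\<lambda>x. ?c * min ((g x)\<^sup>2) 1)"
      using integrable_min by simp
    have ge: "1 \<le> ?c * min ((g x)\<^sup>2) 1" if "x \<in> A" for x
    proof -
      have "d\<^sup>2 \<le> (g x)\<^sup>2" using d(1) d(2)[OF that] by (intro power_mono) auto
      then have "min (d\<^sup>2) 1 \<le> min ((g x)\<^sup>2) 1" by auto
      then show ?thesis using d(1) by (simp add: pos_le_divide_eq)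
    qed
    show "AE x in \<nu>. norm (indicator A x :: real) \<le> norm (?c * min ((g x)\<^sup>2) 1)"
    proof (intro AE_I2)
      show "norm (indicator A x :: real) \<le> norm (?c * min ((g x)\<^sup>2) 1)" for x
        using order_trans[OF ge[of x] abs_ge_self] by (cases "x \<in> A") simp_all
    qed
  qed simp
qed

lemma finite_measure_jumps: assumes "large_jumps A" shows "finite_measure (jumps A)"
proof
  have [measurable]: "A \<in> sets \<nu>" using assms by (rule large_jumps_measurable)
  have "emeasure \<nu> A < \<infinity>"
    using integrable_indicator_large[OF assms] by (simp add: integrable_indicator_iff sets.Int_space_eq2)
  then show "emeasure (jumps A) (space (jumps A)) \<noteq> \<infinity>"
    by (simp add: emeasure_density sets.Int_space_eq2)
qed

lemma measure_jumps: assumes "large_jumps A"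
  shows "measure (jumps A) (space (jumps A)) = measure \<nu> A"
  using large_jumps_measurable[OF assms] sets.sets_into_space[OF large_jumps_measurable[OF assms]]
  by (simp add: measure_def emeasure_density Int_absorb1)

definition cpois :: "'a set \<Rightarrow> real measure" where
  "cpois A = poisson_image (jumps A) f"

lemma real_distribution_cpois: "large_jumps A \<Longrightarrow> real_distribution (cpois A)"
  unfolding cpois_def by (rule real_distribution_poisson_image) (auto intro: finite_measure_jumps)

lemma char_cpois:
  assumes "large_jumps A"
  shows "char (cpois A) t = exp (CLINT x|\<nu>. indicator A x *\<^sub>R (iexp (t * f x) - 1))"
proof -
  have [measurable]: "A \<in> sets \<nu>" using assms by (rule large_jumps_measurable)
  have "char (cpois A) t = exp (CLINT x|jumps A. iexp (t * f x) - 1)"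
    unfolding cpois_def by (rule char_poisson_image[OF finite_measure_jumps[OF assms]]) simp
  also have "(CLINT x|jumps A. iexp (t * f x) - 1) =
      (CLINT x|\<nu>. indicator A x *\<^sub>R (iexp (t * f x) - 1))"
    unfolding ennreal_indicator[symmetric] by (rule integral_density) auto
  finally show ?thesis .
qed

lemma nn_integral_exp_cpois:
  fixes s :: real
  assumes A: "large_jumps A" and int: "integrable \<nu> (\<lambda>x. indicator A x * exp (s * f x))"
  shows "(\<integral>\<^sup>+x. ennreal (exp (s * x)) \<partial>cpois A) =
    ennreal (exp (LINT x|\<nu>. indicator A x * (exp (s * f x) - 1)))"
proof -
  have [measurable]: "A \<in> sets \<nu>" using A by (rule large_jumps_measurable)
  have "integrable (jumps A) (\<lambda>x. exp (s * f x))"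
    unfolding ennreal_indicator[symmetric] by (subst integrable_density) (use int in auto)
  then have "(\<integral>\<^sup>+x. ennreal (exp (s * x)) \<partial>cpois A) =
      ennreal (exp (LINT x|jumps A. exp (s * f x) - 1))"
    unfolding cpois_def
    by (intro nn_integral_exp_poisson_image[OF finite_measure_jumps[OF A]]) simp_all
  also have "(LINT x|jumps A. exp (s * f x) - 1) =
      (LINT x|\<nu>. indicator A x *\<^sub>R (exp (s * f x) - 1))"
    unfolding ennreal_indicator[symmetric] by (rule integral_density) auto
  finally show ?thesis by simp
qed

lemma measure_cpois_ge:
  assumes A: "large_jumps A" and ge: "\<And>x. x \<in> A \<Longrightarrow> r \<le> f x"
  shows "exp (- measure \<nu> A) * measure \<nu> A ^ n / fact n \<le> measure (cpois A) {real n * r..}"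
proof -
  have [measurable]: "A \<in> sets \<nu>" using A by (rule large_jumps_measurable)
  have "AE x in jumps A. r \<le> f x"
    using ge by (subst AE_density) (auto intro!: AE_I2 simp: indicator_def)
  from measure_poisson_image_ge[OF finite_measure_jumps[OF A] _ this, of n]
  show ?thesis
    unfolding cpois_def measure_jumps[OF A] by simp
qed

section \<open>Gaussian plus compound Poisson approximants\<close>

definition cutoff :: "'a set \<Rightarrow> nat \<Rightarrow> 'a set" where
  "cutoff B n = {x \<in> space \<nu>. inverse (real (Suc n)) < g x} \<union> B"

lemma large_jumps_cutoff: assumes "large_jumps B" shows "large_jumps (cutoff B n)"
proof -
  have "large_jumps {x \<in> space \<nu>. inverse (real (Suc n)) < g x}"
    unfolding large_jumps_def by (intro conjI exI[of _ "inverse (real (Suc n))"]) auto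
  then show ?thesis unfolding cutoff_def using assms by (rule large_jumps_Un)
qed

text \<open>The compound Poisson factors are not compensated; the compensator of the retained jumps
  of size at most 1 is therefore subtracted from the drift.\<close>

definition drift :: "'a set \<Rightarrow> nat \<Rightarrow> real" where
  "drift B n = \<gamma> - (LINT x|\<nu>. indicator (cutoff B n) x * (f x * indicator {x. g x \<le> 1} x))"

text \<open>Everything in the approximant except the jumps in \<open>B\<close>. Since each cutoff
  contains \<open>B\<close>, the same factor \<open>cpois B\<close> splits off from all
  approximants, independently of \<open>n\<close>.\<close>

definition base_part :: "'a set \<Rightarrow> nat \<Rightarrow> real measure" where
  "base_part B n = (return borel (drift B n) \<star> (centred_normal a \<star> cpois (cutoff B n - B)))"

definition approximant :: "'a set \<Rightarrow> nat \<Rightarrow> real measure" where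
  "approximant B n = (base_part B n \<star> cpois B)"

context
  fixes B assumes B: "large_jumps B"
begin

lemma sets_B[measurable]: "B \<in> sets \<nu>"
  using B by (rule large_jumps_measurable)

lemma sets_cutoff[measurable]: "cutoff B n \<in> sets \<nu>"
  using large_jumps_cutoff[OF B] by (rule large_jumps_measurable)

lemma large_jumps_diff: "large_jumps (cutoff B n - B)"
  by (rule large_jumps_subset[OF large_jumps_cutoff[OF B]]) auto

lemma real_distribution_base_part: "real_distribution (base_part B n)"
  unfolding base_part_def
  by (intro real_distribution_convolution real_distribution_return real_distribution_centred_normal
      real_distribution_cpois large_jumps_diff)

lemma real_distribution_approximant: "real_distribution (approximant B n)"
  unfolding approximant_def
  by (intro real_distribution_convolution real_distribution_base_part real_distribution_cpois B)

lemma integrable_cutoff_bounded: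
  fixes h :: "'a \<Rightarrow> 'b::{banach, second_countable_topology}"
  assumes [measurable]: "h \<in> borel_measurable \<nu>" and A: "large_jumps A"
    and le: "AE x in \<nu>. x \<in> A \<longrightarrow> norm (h x) \<le> c"
  shows "integrable \<nu> (\<lambda>x. indicator A x *\<^sub>R h x)"
proof (rule Bochner_Integration.integrable_bound)
  have [measurable]: "A \<in> sets \<nu>" using A by (rule large_jumps_measurable)
  show "integrable \<nu> (\<lambda>x. indicator A x * c)"
    by (intro integrable_mult_left integrable_indicator_large A)
  show "(\<lambda>x. indicator A x *\<^sub>R h x) \<in> borel_measurable \<nu>"
    by simp
  show "AE x in \<nu>. norm (indicator A x *\<^sub>R h x) \<le> norm (indicator A x * c)"
    using le by eventually_elim (auto simp: indicator_def)
qed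

lemma integrable_cutoff_small:
  "integrable \<nu> (\<lambda>x. indicator (cutoff B n) x * (f x * indicator {x. g x \<le> 1} x))"
proof -
  have "norm (f x * indicator {x. g x \<le> 1} x) \<le> 1" for x
    using abs_f_le[of x] by (auto simp: indicator_def)
  then have "integrable \<nu> (\<lambda>x. indicator (cutoff B n) x *\<^sub>R (f x * indicator {x. g x \<le> 1} x))"
    by (intro integrable_cutoff_bounded[where c=1] large_jumps_cutoff B) auto
  then show ?thesis by simp
qed

lemma integrable_cutoff_iexp:
  "large_jumps A \<Longrightarrow> integrable \<nu> (\<lambda>x. indicator A x *\<^sub>R (iexp (t * f x) - 1))"
  by (rule integrable_cutoff_bounded[where c=2])
     (auto intro!: AE_I2 order_trans[OF norm_triangle_ineq4])

text \<open>The two jump factors have disjoint supports with union \<open>cutoff B n\<close>, so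
  their exponents add up to one integral; adding and subtracting the compensator turns it into the
  truncated integrand and cancels the correction in \<open>drift\<close>.\<close>

lemma char_approximant:
  "char (approximant B n) t = exp (- complex_of_real (a * t\<^sup>2) / 2
      + (CLINT x|\<nu>. indicator (cutoff B n) x *\<^sub>R trunc t x) + \<i> * complex_of_real (t * \<gamma>))"
proof -
  let ?A = "cutoff B n"
  have "char (approximant B n) t = exp (\<i> * complex_of_real (t * drift B n))
      * (exp (- complex_of_real (a * t\<^sup>2) / 2)
      * exp (CLINT x|\<nu>. indicator (?A - B) x *\<^sub>R (iexp (t * f x) - 1)))
      * exp (CLINT x|\<nu>. indicator B x *\<^sub>R (iexp (t * f x) - 1))"
    unfolding approximant_def base_part_def
    by (simp add: char_convolution real_distribution_convolution real_distribution_return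
      real_distribution_centred_normal real_distribution_cpois large_jumps_diff B
      real_distribution_base_part char_cpois char_centred_normal[OF a_nonneg] char_return)
  also have "\<dots> = exp (\<i> * complex_of_real (t * drift B n) - complex_of_real (a * t\<^sup>2) / 2
      + ((CLINT x|\<nu>. indicator (?A - B) x *\<^sub>R (iexp (t * f x) - 1))
      + (CLINT x|\<nu>. indicator B x *\<^sub>R (iexp (t * f x) - 1))))"
    by (simp add: exp_add[symmetric] algebra_simps)
  also have "(CLINT x|\<nu>. indicator (?A - B) x *\<^sub>R (iexp (t * f x) - 1))
      + (CLINT x|\<nu>. indicator B x *\<^sub>R (iexp (t * f x) - 1)) =
      (CLINT x|\<nu>. indicator ?A x *\<^sub>R (iexp (t * f x) - 1))"
    by (subst Bochner_Integration.integral_add[symmetric,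
          OF integrable_cutoff_iexp[OF large_jumps_diff] integrable_cutoff_iexp[OF B]])
       (auto intro!: Bochner_Integration.integral_cong simp: indicator_def cutoff_def)
  also have "(CLINT x|\<nu>. indicator ?A x *\<^sub>R (iexp (t * f x) - 1)) =
      (CLINT x|\<nu>. indicator ?A x *\<^sub>R trunc t x)
      + (CLINT x|\<nu>. \<i> * complex_of_real t *
          complex_of_real (indicator ?A x * (f x * indicator {x. g x \<le> 1} x)))"
  proof (subst Bochner_Integration.integral_add[symmetric])
    show "integrable \<nu> (\<lambda>x. indicator ?A x *\<^sub>R trunc t x)"
      by (rule integrable_mult_indicator[OF sets_cutoff integrable_trunc])
    show "integrable \<nu> (\<lambda>x. \<i> * complex_of_real t *
        complex_of_real (indicator ?A x * (f x * indicator {x. g x \<le> 1} x)))"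
      by (intro integrable_mult_right integrable_of_real integrable_cutoff_small)
  qed (auto intro!: Bochner_Integration.integral_cong simp: indicator_def)
  also have "(CLINT x|\<nu>. \<i> * complex_of_real t *
      complex_of_real (indicator ?A x * (f x * indicator {x. g x \<le> 1} x))) =
      \<i> * complex_of_real t * complex_of_real (\<gamma> - drift B n)"
    unfolding drift_def by (simp only: integral_mult_right_zero integral_complex_of_real) simp
  also have "exp (\<i> * complex_of_real (t * drift B n) - complex_of_real (a * t\<^sup>2) / 2
      + ((CLINT x|\<nu>. indicator ?A x *\<^sub>R trunc t x)
      + \<i> * complex_of_real t * complex_of_real (\<gamma> - drift B n))) =
      exp (- complex_of_real (a * t\<^sup>2) / 2
      + (CLINT x|\<nu>. indicator ?A x *\<^sub>R trunc t x) + \<i> * complex_of_real (t * \<gamma>))"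
    by (rule arg_cong[where f=exp]) (simp add: algebra_simps)
  finally show ?thesis .
qed

lemma weak_conv_approximant: "weak_conv_m (approximant B) P"
proof (rule levy_continuity)
  fix t
  have "(\<lambda>n. CLINT x|\<nu>. indicator (cutoff B n) x *\<^sub>R trunc t x) \<longlonglongrightarrow> (CLINT x|\<nu>. trunc t x)"
  proof (rule integral_dominated_convergence[where w="\<lambda>x. norm (trunc t x)"])
    show "AE x in \<nu>. (\<lambda>n. indicator (cutoff B n) x *\<^sub>R trunc t x) \<longlonglongrightarrow> trunc t x"
    proof (intro AE_I2)
      fix x assume x: "x \<in> space \<nu>"
      show "(\<lambda>n. indicator (cutoff B n) x *\<^sub>R trunc t x) \<longlonglongrightarrow> trunc t x"
      \<comment> \<open>A jump of positive size belongs to all late cutoffs. Where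
        \<open>g x = 0\<close> the projection \<open>f x\<close> is 0 as well, so the truncated
        integrand vanishes and membership is irrelevant.\<close>
      proof (cases "g x > 0")
        case True
        have "\<forall>\<^sub>F n in sequentially. inverse (real (Suc n)) < g x"
          using LIMSEQ_inverse_real_of_nat True by (rule order_tendstoD)
        then have "\<forall>\<^sub>F n in sequentially. indicator (cutoff B n) x *\<^sub>R trunc t x = trunc t x"
          by eventually_elim (use x in \<open>auto simp: cutoff_def\<close>)
        then show ?thesis by (rule tendsto_eventually)
      next
        case False
        then have "f x = 0" using abs_f_le[of x] by linarith
        then show ?thesis by simp
      qed
    qed
    show "integrable \<nu> (\<lambda>x. norm (trunc t x))"
      by (rule integrable_norm[OF integrable_trunc])
  qed (auto simp: indicator_def)
  then show "(\<lambda>n. char (approximant B n) t) \<longlonglongrightarrow> char P t"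
    unfolding char_approximant char_eq by (intro tendsto_intros)
qed (auto intro: real_distribution_approximant real_distribution_axioms)

end


section \<open>Tail estimates for a one-dimensional projection\<close>

lemma nn_integral_exp_le:
  fixes s R :: real
  assumes s: "0 \<le> s" and R: "0 < R" "AE x in \<nu>. g x \<le> R"
  shows "(\<integral>\<^sup>+x. ennreal (exp (s * x)) \<partial>P) \<le> ennreal (exp (s * \<bar>\<gamma>\<bar> + a * s\<^sup>2 / 2
    + (1 + s\<^sup>2) * exp (s * R) * (LINT x|\<nu>. min ((g x)\<^sup>2) 1)))"
proof -
  \<comment> \<open>With \<open>B\<close> empty no jumps are split off. The exponential moments of
    the approximants are bounded uniformly in \<open>n\<close>, and the bound then passes to
    \<open>P\<close>.\<close>
  have large0: "large_jumps {}" by (auto simp: large_jumps_def intro: exI[of _ 1])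
  let ?C = "ennreal (exp (s * \<bar>\<gamma>\<bar> + a * s\<^sup>2 / 2
    + (1 + s\<^sup>2) * exp (s * R) * (LINT x|\<nu>. min ((g x)\<^sup>2) 1)))"
  have bound: "(\<integral>\<^sup>+x. ennreal (exp (s * x)) \<partial>approximant {} n) \<le> ?C" for n
  proof -
    let ?A = "cutoff {} n"
    let ?V = "LINT x|\<nu>. min ((g x)\<^sup>2) 1"
    note large = large_jumps_cutoff[OF large0, of n]
    note [measurable] = large_jumps_measurable[OF large]
    have intA: "integrable \<nu> (\<lambda>x. indicator ?A x * exp (s * f x))"
    proof -
      have "AE x in \<nu>. x \<in> ?A \<longrightarrow> norm (exp (s * f x)) \<le> exp (s * R)"
        using R(2)
      proof eventually_elim
        case (elim x)
        then have "f x \<le> R" using abs_f_le[of x] by linarith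
        then show ?case using s by (auto intro: mult_left_mono)
      qed
      from integrable_cutoff_bounded[OF large0 _ large this] show ?thesis by simp
    qed
    have int0: "integrable \<nu> (\<lambda>x. indicator {} x * exp (s * f x))" by simp
    have intI: "integrable \<nu> (indicator ?A :: 'a \<Rightarrow> real)"
      by (rule integrable_indicator_large[OF large])
    note intS = integrable_cutoff_small[OF large0, of n]
    have "(\<integral>\<^sup>+x. ennreal (exp (s * x)) \<partial>approximant {} n) =
        ennreal (exp (s * drift {} n)) * (ennreal (exp (a * s\<^sup>2 / 2))
        * ennreal (exp (LINT x|\<nu>. indicator ?A x * (exp (s * f x) - 1))))"
      using nn_integral_exp_cpois[OF large0 int0] nn_integral_exp_cpois[OF large intA]
      unfolding approximant_def base_part_def
      by (simp add: nn_integral_exp_convolution real_distribution_convolution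
        real_distribution_return real_distribution_centred_normal real_distribution_cpois
        large0 large nn_integral_exp_centred_normal[OF a_nonneg] nn_integral_return)
    also have "\<dots> = ennreal (exp (s * drift {} n + a * s\<^sup>2 / 2
        + (LINT x|\<nu>. indicator ?A x * (exp (s * f x) - 1))))"
      by (simp add: ennreal_mult[symmetric] exp_add)
    also have "s * drift {} n + a * s\<^sup>2 / 2 + (LINT x|\<nu>. indicator ?A x * (exp (s * f x) - 1)) =
        s * \<gamma> + a * s\<^sup>2 / 2 + ((LINT x|\<nu>. indicator ?A x * (exp (s * f x) - 1))
          - s * (LINT x|\<nu>. indicator ?A x * (f x * indicator {x. g x \<le> 1} x)))"
      by (simp add: drift_def algebra_simps)
    also have "(LINT x|\<nu>. indicator ?A x * (exp (s * f x) - 1))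
          - s * (LINT x|\<nu>. indicator ?A x * (f x * indicator {x. g x \<le> 1} x)) =
        (LINT x|\<nu>. (indicator ?A x * exp (s * f x) - indicator ?A x)
          - s * (indicator ?A x * (f x * indicator {x. g x \<le> 1} x)))"
      using intA intI intS by (simp add: algebra_simps)
    also have "ennreal (exp (s * \<gamma> + a * s\<^sup>2 / 2 + \<dots>)) \<le>
        ennreal (exp (s * \<bar>\<gamma>\<bar> + a * s\<^sup>2 / 2 + (1 + s\<^sup>2) * exp (s * R) * ?V))"
    proof (intro ennreal_leI exp_le_cancel_iff[THEN iffD2] add_mono order_refl)
      show "s * \<gamma> \<le> s * \<bar>\<gamma>\<bar>" using s by (intro mult_left_mono) auto
      have "(LINT x|\<nu>. (indicator ?A x * exp (s * f x) - indicator ?A x)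
          - s * (indicator ?A x * (f x * indicator {x. g x \<le> 1} x)))
        \<le> (LINT x|\<nu>. (1 + s\<^sup>2) * exp (s * R) * min ((g x)\<^sup>2) 1)"
      proof (rule integral_mono_AE)
        show "AE x in \<nu>. (indicator ?A x * exp (s * f x) - indicator ?A x)
            - s * (indicator ?A x * (f x * indicator {x. g x \<le> 1} x))
            \<le> (1 + s\<^sup>2) * exp (s * R) * min ((g x)\<^sup>2) 1"
          using R(2)
        proof eventually_elim
          case (elim x)
          have nn: "0 \<le> (1 + s\<^sup>2) * exp (s * R) * min ((g x)\<^sup>2) 1" by simp
          have fR: "\<bar>s * f x\<bar> \<le> s * R"
            using mult_left_mono[OF abs_f_le s, of x] mult_left_mono[OF elim s] s
            by (simp add: abs_mult)
          show ?case
          \<comment> \<open>Small jumps use the term s^2 of the factor 1 + s^2, through the Taylor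
            remainder; jumps larger than 1 have no compensator and use the term 1.\<close>
          proof (cases "g x \<le> 1")
            case True
            have "exp (s * f x) - 1 - s * f x \<le> (s * f x)\<^sup>2 * exp \<bar>s * f x\<bar>"
              by (rule exp_minus_one_minus_le)
            also have "\<dots> \<le> (s\<^sup>2 * (g x)\<^sup>2) * exp (s * R)"
            proof (rule mult_mono)
              have "(f x)\<^sup>2 \<le> (g x)\<^sup>2"
                using abs_f_le[of x] by (simp add: abs_le_square_iff[symmetric] g_nonneg)
              then show "(s * f x)\<^sup>2 \<le> s\<^sup>2 * (g x)\<^sup>2"
                by (simp add: power_mult_distrib mult_left_mono)
            qed (use fR in auto)
            also have "\<dots> \<le> (1 + s\<^sup>2) * exp (s * R) * (g x)\<^sup>2"
              by (simp add: algebra_simps)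
            finally show ?thesis
              using True nn g_nonneg[of x]
              by (auto simp: indicator_def min_absorb1 power_le_one algebra_simps)
          next
            case False
            then have "1 \<le> (g x)\<^sup>2" by (intro one_le_power) auto
            then have m: "min ((g x)\<^sup>2) 1 = 1" by simp
            have "exp (s * f x) \<le> exp (s * R)" using fR by auto
            also have "\<dots> \<le> (1 + s\<^sup>2) * exp (s * R)"
              by (simp add: algebra_simps)
            finally show ?thesis
              using False m nn unfolding m by (auto simp: indicator_def)
          qed
        qed
      qed (use intA intI intS integrable_min in auto)
      then show "(LINT x|\<nu>. (indicator ?A x * exp (s * f x) - indicator ?A x)
          - s * (indicator ?A x * (f x * indicator {x. g x \<le> 1} x)))
        \<le> (1 + s\<^sup>2) * exp (s * R) * ?V" by simp
    qed
    finally show ?thesis .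
  qed
  show ?thesis
    by (rule weak_conv_nn_integral_le[OF real_distribution_approximant[OF large0]
        real_distribution_axioms weak_conv_approximant[OF large0] _ bound])
       (intro continuous_intros)
qed

text \<open>The base part cannot be very negative with high probability, since otherwise the
  approximants would not be tight. It thus costs only a fixed shift \<open>m\<close> and a factor
  1/2, both independent of the number \<open>n\<close> of large jumps.\<close>

lemma measure_upper_tail_ge:
  assumes r: "0 < r"
  defines "l \<equiv> measure \<nu> {x \<in> space \<nu>. r < f x}"
  shows "\<exists>m. \<forall>n. exp (- l) * l ^ n / fact n / 2 \<le> measure P {real n * r - m..}"
proof -
  let ?B = "{x \<in> space \<nu>. r < f x}"
  have B: "large_jumps ?B"
    unfolding large_jumps_def using r abs_f_le by (auto intro!: exI[of _ r]) (smt (verit) abs_f_le)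
  interpret L: real_distribution "cpois ?B" by (rule real_distribution_cpois[OF B])
  interpret E: real_distribution "base_part ?B n" for n by (rule real_distribution_base_part[OF B])
  note D = real_distribution_approximant[OF B]
  note wc = weak_conv_approximant[OF B]
  obtain m1 where m1: "1 / 2 \<le> measure (cpois ?B) {..m1}"
  proof -
    have "\<forall>\<^sub>F x in at_top. 1 / 2 < cdf (cpois ?B) x"
      using L.cdf_lim_at_top_prob by (rule order_tendstoD) simp
    then show ?thesis using that
      unfolding eventually_at_top_linorder cdf_def by (meson less_imp_le order_refl)
  qed
  obtain m2 where m2: "\<forall>\<^sub>F n in sequentially. measure (approximant ?B n) {..m2} < 1 / 4"
    using weak_conv_lower_tight[OF D real_distribution_axioms wc, of "1 / 4"] by auto
  let ?m = "m1 - m2"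
  \<comment> \<open>If the base part were at most m2 - m1 with probability above 1/2, then, together
    with \<open>cpois ?B\<close> being at most m1 with probability at least 1/2, the approximant
    would be at most m2 with probability above 1/4.\<close>
  have base: "\<forall>\<^sub>F n in sequentially. 1 / 2 \<le> measure (base_part ?B n) {- ?m..}"
    using m2
  proof eventually_elim
    case (elim n)
    have "measure (base_part ?B n) {..- ?m} * (1 / 2) \<le>
        measure (base_part ?B n) {..- ?m} * measure (cpois ?B) {..m1}"
      by (intro mult_left_mono m1) simp
    also have "\<dots> \<le> measure (approximant ?B n) {..- ?m + m1}"
      unfolding approximant_def
      by (intro measure_convolution_ge E.real_distribution_axioms L.real_distribution_axioms)
    finally have "measure (base_part ?B n) {..- ?m} \<le> 1 / 2"
      using elim by simp
    moreover have "measure (base_part ?B n) {..- ?m} + measure (base_part ?B n) {- ?m<..} = 1"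
    proof -
      have "measure (base_part ?B n) (UNIV - {..- ?m}) = 1 - measure (base_part ?B n) {..- ?m}"
        using E.prob_compl[of "{..- ?m}" n] by simp
      moreover have "UNIV - {..- ?m} = {- ?m<..}" by auto
      ultimately show ?thesis by simp
    qed
    moreover have "measure (base_part ?B n) {- ?m<..} \<le> measure (base_part ?B n) {- ?m..}"
      by (intro E.finite_measure_mono) auto
    ultimately show ?case by linarith
  qed
  \<comment> \<open>The additional 1 in the shift is the loss in passing to the weak limit.\<close>
  have "exp (- l) * l ^ n / fact n / 2 \<le> measure P {real n * r - (?m + 1)..}" for n
  proof -
    have "\<forall>\<^sub>F j in sequentially. exp (- l) * l ^ n / fact n / 2
        \<le> measure (approximant ?B j) {- ?m + real n * r..}"
      using base
    proof eventually_elim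
      case (elim j)
      have "exp (- l) * l ^ n / fact n / 2 = 1 / 2 * (exp (- l) * l ^ n / fact n)" by simp
      also have "\<dots> \<le> measure (base_part ?B j) {- ?m..} * measure (cpois ?B) {real n * r..}"
        using elim unfolding l_def by (intro mult_mono measure_cpois_ge B) auto
      also have "\<dots> \<le> measure (approximant ?B j) {- ?m + real n * r..}"
        unfolding approximant_def
        by (intro measure_convolution_ge E.real_distribution_axioms L.real_distribution_axioms)
      finally show ?case .
    qed
    from weak_conv_upper_closed_tail[OF D real_distribution_axioms wc this]
    show ?thesis by (simp add: algebra_simps)
  qed
  then show ?thesis by blast
qed

end

lemma (in levy_khintchine_line) measure_upper_tail_le:
  fixes s R r :: real
  assumes s: "0 \<le> s" and R: "0 < R" "AE x in \<nu>. g x \<le> R"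
  shows "measure P {r..} \<le> exp (- s * r + (s * \<bar>\<gamma>\<bar> + a * s\<^sup>2 / 2
    + (1 + s\<^sup>2) * exp (s * R) * (LINT x|\<nu>. min ((g x)\<^sup>2) 1)))"
proof -
  let ?e = "s * \<bar>\<gamma>\<bar> + a * s\<^sup>2 / 2 + (1 + s\<^sup>2) * exp (s * R) * (LINT x|\<nu>. min ((g x)\<^sup>2) 1)"
  have "ennreal (measure P {r..}) = emeasure P {r..}"
    by (simp add: emeasure_eq_measure)
  also have "\<dots> \<le> emeasure P {x \<in> space P. 1 \<le> ennreal (exp (- s * r)) * ennreal (exp (s * x))}"
  proof (rule emeasure_mono)
    show "{r..} \<subseteq> {x \<in> space P. 1 \<le> ennreal (exp (- s * r)) * ennreal (exp (s * x))}"
      using s by (auto simp: ennreal_mult[symmetric] exp_add[symmetric] mult_left_mono)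
  qed auto
  also have "\<dots> \<le> ennreal (exp (- s * r)) * (\<integral>\<^sup>+x. ennreal (exp (s * x)) \<partial>P)"
    using nn_integral_Markov_inequality[where M=P and A="space P"
        and u="\<lambda>x. ennreal (exp (s * x))" and c="ennreal (exp (- s * r))"]
    by simp
  also have "\<dots> \<le> ennreal (exp (- s * r)) * ennreal (exp ?e)"
    by (intro mult_left_mono nn_integral_exp_le assms) auto
  also have "\<dots> = ennreal (exp (- s * r + ?e))"
    by (subst ennreal_mult[symmetric]) (simp_all add: exp_add[symmetric])
  finally show ?thesis by (simp add: ennreal_le_iff)
qed

text \<open>With s = u ln r / R the factor exp (s R) is r^u, so for u < 1 the log moment is o(r ln
  r). The gain at level \<open>u * r\<close> is s u r = u^2 r ln r / R; one factor \<open>u\<close>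
  comes from \<open>s\<close>, the other from the level forced by the approximation of
  directions.\<close>

lemma (in levy_khintchine_line) eventually_upper_tail_le:
  assumes R: "0 < R" "AE x in \<nu>. g x \<le> R" and u: "0 < u" "u < 1" and k: "k < u\<^sup>2 / R"
  shows "\<forall>\<^sub>F r in at_top. measure P {u * r..} \<le> exp (- k * r * ln r)"
proof -
  define V where "V = (LINT x|\<nu>. min ((g x)\<^sup>2) 1)"
  define h where "h r = u * ln r / R * \<bar>\<gamma>\<bar> + a * (u * ln r / R)\<^sup>2 / 2
    + (1 + (u * ln r / R)\<^sup>2) * r powr u * V" for r
  have "((\<lambda>r. h r / (r * ln r)) \<longlongrightarrow> 0) at_top"
    unfolding h_def using u R by real_asymp
  moreover have "0 < u\<^sup>2 / R - k" using k by simp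
  ultimately have "\<forall>\<^sub>F r in at_top. h r / (r * ln r) < u\<^sup>2 / R - k"
    by (rule order_tendstoD)
  then show ?thesis using eventually_gt_at_top[of 1]
  proof eventually_elim
    case (elim r)
    let ?s = "u * ln r / R"
    have pos: "0 < r * ln r" using elim by (intro mult_pos_pos) auto
    have "exp (?s * R) = r powr u"
      using R elim by (simp add: powr_def)
    then have "measure P {u * r..} \<le> exp (- ?s * (u * r) + h r)"
      using measure_upper_tail_le[of ?s R "u * r"] R u elim
      by (simp add: h_def V_def)
    also have "\<dots> \<le> exp (- k * r * ln r)"
    proof -
      have "h r \<le> (u\<^sup>2 / R - k) * (r * ln r)"
        using elim(1) pos by (simp add: pos_divide_less_eq)
      then show ?thesis by (simp add: power2_eq_square algebra_simps)
    qed
    finally show ?case .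
  qed
qed

lemma (in levy_khintchine_line) eventually_upper_tail_ge:
  assumes c: "0 < c" "c < r1" and pos: "0 < emeasure \<nu> {x \<in> space \<nu>. r1 < f x}"
  shows "\<forall>\<^sub>F r in at_top. exp (- r * ln r / c) \<le> measure P {r + 1..}"
proof -
  let ?B = "{x \<in> space \<nu>. r1 < f x}"
  define l where "l = measure \<nu> ?B"
  have r1: "0 < r1" using c by simp
  have "large_jumps ?B"
    unfolding large_jumps_def using r1 abs_f_le by (auto intro!: exI[of _ r1]) (smt (verit) abs_f_le)
  from integrable_indicator_large[OF this] have "emeasure \<nu> ?B < \<infinity>"
    by (simp add: integrable_indicator_iff sets.Int_space_eq2)
  with pos have l: "0 < l"
    unfolding l_def measure_def by (simp add: enn2real_positive_iff top.not_eq_extremum)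
  obtain m where m: "\<And>n. exp (- l) * l ^ n / fact n / 2 \<le> measure P {real n * r1 - m..}"
    using measure_upper_tail_ge[OF r1] unfolding l_def by blast
  \<comment> \<open>Powers of \<open>l0 \<le> 1\<close> decrease in the exponent, so the integer
    \<open>n\<close> may be replaced by its upper bound \<open>y r\<close> there.\<close>
  define l0 where "l0 = min l 1"
  have l0: "0 < l0" "l0 \<le> 1" "l0 \<le> l" using l by (auto simp: l0_def)
  \<comment> \<open>\<open>y r\<close> is (r + 1 + m) / r1 + 1, a real upper bound for the number
    \<open>n\<close> of jumps chosen below. It makes the whole estimate an explicit function of
    \<open>r\<close>, with n! bounded by y^y.\<close>
  define y where "y r = (r + (1 + m + r1)) / r1" for r
  have "((\<lambda>r. (- l - ln 2 + y r * ln l0 - y r * ln (y r)) / (r * ln r)) \<longlongrightarrow> - inverse r1) at_top"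
    unfolding y_def using r1 by real_asymp
  moreover have "- 1 / c < - inverse r1" using c by (simp add: field_simps)
  ultimately have "\<forall>\<^sub>F r in at_top. - 1 / c < (- l - ln 2 + y r * ln l0 - y r * ln (y r)) / (r * ln r)"
    by (rule order_tendstoD)
  moreover have "\<forall>\<^sub>F r in at_top. 1 \<le> y r"
    unfolding y_def using r1 by real_asymp
  moreover have "\<forall>\<^sub>F r in at_top. 0 \<le> (r + 1 + m) / r1"
    using r1 by real_asymp
  ultimately show ?thesis using eventually_gt_at_top[of 1]
  proof eventually_elim
    case (elim r)
    \<comment> \<open>The least number of jumps of size \<open>r1\<close> that reaches r + 1 after
      the loss \<open>m\<close>.\<close>
    define n where "n = nat \<lceil>(r + 1 + m) / r1\<rceil>"
    have n1: "(r + 1 + m) / r1 \<le> real n" unfolding n_def by linarith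
    have n2: "real n \<le> y r"
    proof -
      have "real n \<le> (r + 1 + m) / r1 + 1" unfolding n_def using elim(3) by linarith
      also have "\<dots> = y r" using r1 by (simp add: y_def field_simps)
      finally show ?thesis .
    qed
    have rln: "0 < r * ln r" using elim by (intro mult_pos_pos) auto
    have "- r * ln r / c \<le> - l - ln 2 + y r * ln l0 - y r * ln (y r)"
      using elim(1) rln by (simp add: pos_less_divide_eq)
    then have "exp (- r * ln r / c) \<le> exp (- l - ln 2 + y r * ln l0 - y r * ln (y r))"
      by simp
    also have "\<dots> = exp (- l) * (l0 powr y r / y r powr y r) / 2"
      using l0 elim(2) by (simp add: exp_diff exp_add powr_def exp_minus field_simps)
    also have "\<dots> \<le> exp (- l) * (l ^ n / fact n) / 2"
    proof (intro divide_right_mono mult_left_mono frac_le)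
      have "l0 powr y r \<le> l0 powr real n"
        using l0 n2 by (intro powr_mono') auto
      also have "\<dots> = l0 ^ n" using l0 by (simp add: powr_realpow)
      also have "\<dots> \<le> l ^ n" using l0 by (intro power_mono) auto
      finally show "l0 powr y r \<le> l ^ n" .
      have "fact n \<le> real (n ^ n)"
        by (rule fact_le_power)
      also have "\<dots> \<le> y r ^ n"
        using n2 by (simp add: power_mono)
      also have "\<dots> = y r powr real n" using elim(2) by (simp add: powr_realpow)
      also have "\<dots> \<le> y r powr y r" using elim(2) n2 by (intro powr_mono) auto
      finally show "fact n \<le> y r powr y r" .
    qed (use l in auto)
    also have "\<dots> \<le> measure P {real n * r1 - m..}"
      using m[of n] by simp
    also have "\<dots> \<le> measure P {r + 1..}"
    proof (rule finite_measure_mono)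
      have "r + 1 + m \<le> real n * r1" using n1 r1 by (simp add: pos_divide_le_eq)
      then show "{real n * r1 - m..} \<subseteq> {r + 1..}" by auto
    qed simp
    finally show ?case .
  qed
qed

section \<open>Tails of multivariate distributions\<close>

text \<open>Compactness of the sphere: the caps \<open>u < z \<bullet> x\<close> cover it. The norm
  tail is thereby reduced to finitely many projections, at the price of a factor \<open>u\<close>
  arbitrarily close to 1.\<close>

lemma finite_sphere_net:
  fixes u :: real
  assumes "u < 1"
  obtains Z :: "('a::euclidean_space) set"
  where "finite Z" "Z \<subseteq> sphere 0 1" "\<And>x. \<exists>z\<in>Z. u * norm x \<le> z \<bullet> x" "Z \<noteq> {}"
proof -
  have "compact (sphere (0::'a) 1)" by simp
  moreover have "\<And>z. z \<in> sphere (0::'a) 1 \<Longrightarrow> open {x. u < z \<bullet> x}"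
    by (intro open_Collect_less continuous_intros)
  moreover have "sphere (0::'a) 1 \<subseteq> (\<Union>z\<in>sphere 0 1. {x. u < z \<bullet> x})"
    using assms by (auto simp: dot_square_norm intro!: bexI)
  ultimately obtain Z where Z: "Z \<subseteq> sphere (0::'a) 1" "finite Z"
      "sphere 0 1 \<subseteq> (\<Union>z\<in>Z. {x. u < z \<bullet> x})"
    by (rule compactE_image)
  have ne: "Z \<noteq> {}"
  proof
    assume "Z = {}"
    moreover obtain b :: 'a where "b \<in> Basis" using nonempty_Basis by blast
    ultimately show False using Z(3) by (auto simp: norm_Basis)
  qed
  have "\<exists>z\<in>Z. u * norm x \<le> z \<bullet> x" for x
  proof (cases "x = 0")
    case True
    then show ?thesis using ne by auto
  next
    case False
    then have "x /\<^sub>R norm x \<in> sphere 0 1" by simp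
    with Z(3) obtain z where "z \<in> Z" "u < z \<bullet> (x /\<^sub>R norm x)" by blast
    then show ?thesis using False by (intro bexI[of _ z]) (auto simp: field_simps)
  qed
  with Z ne that show ?thesis by blast
qed

lemma borel_measurable_inner_const:
  fixes z :: "'a::euclidean_space"
  assumes "sets M = sets borel"
  shows "(\<bullet>) z \<in> borel_measurable M"
  unfolding measurable_cong_sets[OF assms refl]
  by (rule borel_measurable_continuous_onI) (intro continuous_intros)

text \<open>The jump space stays multivariate, with the norm as jump size, so truncation by the unit
  ball is unchanged by the projection and \<nu> need not be pushed forward. One pair
  \<open>A\<close>, \<gamma> serves all directions.\<close>

lemma levy_measure_of_projection:
  fixes \<mu> \<nu> :: "(real ^ 'd) measure"
  assumes \<mu>: "prob_space \<mu>" "sets \<mu> = sets borel" and levy: "levy_measure_of \<mu> \<nu>"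
  obtains A \<gamma> where "\<And>z. norm z = 1 \<Longrightarrow>
    levy_khintchine_line (distr \<mu> borel ((\<bullet>) z)) \<nu> ((\<bullet>) z) norm (z \<bullet> (A *v z)) (\<gamma> \<bullet> z)"
proof -
  from levy obtain A \<gamma> where sets: "sets \<nu> = sets borel"
    and fin: "(\<integral>\<^sup>+ x. ennreal (min ((norm x)\<^sup>2) 1) \<partial>\<nu>) < \<infinity>"
    and A: "\<And>z. 0 \<le> z \<bullet> (A *v z)"
    and char: "\<And>z. (CLINT x|\<mu>. iexp (z \<bullet> x)) =
        exp (- complex_of_real (z \<bullet> (A *v z)) / 2
             + (CLINT x|\<nu>. iexp (z \<bullet> x) - 1
                  - \<i> * complex_of_real (z \<bullet> x) * indicator (cball 0 1) x)
             + \<i> * complex_of_real (\<gamma> \<bullet> z))"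
    unfolding levy_measure_of_def by blast
  interpret prob_space \<mu> by fact
  have [measurable]: "(\<bullet>) z \<in> borel_measurable \<mu>" "(\<bullet>) z \<in> borel_measurable \<nu>" for z
    by (intro borel_measurable_inner_const \<mu>(2) sets)+
  show ?thesis
  proof (rule that)
    fix z :: "real ^ 'd" assume z: "norm z = 1"
    have "real_distribution (distr \<mu> borel ((\<bullet>) z))"
      unfolding real_distribution_def real_distribution_axioms_def
      by (intro conjI prob_space_distr) simp_all
    moreover have "levy_khintchine_line_axioms (distr \<mu> borel ((\<bullet>) z)) \<nu> ((\<bullet>) z) norm
        (z \<bullet> (A *v z)) (\<gamma> \<bullet> z)"
    proof
      show "(\<bullet>) z \<in> borel_measurable \<nu>" by simp
      show "\<bar>z \<bullet> x\<bar> \<le> norm x" for x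
        using Cauchy_Schwarz_ineq2[of z x] z by simp
      show "norm \<in> borel_measurable \<nu>"
        unfolding measurable_cong_sets[OF sets refl] by simp
      show "0 \<le> z \<bullet> (A *v z)" by (rule A)
      show "(\<integral>\<^sup>+ x. ennreal (min ((norm x)\<^sup>2) 1) \<partial>\<nu>) < \<infinity>" by (rule fin)
      fix t :: real
      have q: "(t *\<^sub>R z) \<bullet> (A *v (t *\<^sub>R z)) = z \<bullet> (A *v z) * t\<^sup>2"
        by (simp only: matrix_vector_mult_scaleR inner_scaleR_left inner_scaleR_right
            power2_eq_square mult_ac)
      have ind: "indicator (cball 0 1) x = (indicator {x. norm x \<le> 1} x :: complex)"
        for x :: "real ^ 'd"
        by (simp add: indicator_def)
      have "char (distr \<mu> borel ((\<bullet>) z)) t = (CLINT x|\<mu>. iexp ((t *\<^sub>R z) \<bullet> x))"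
        unfolding char_def by (subst integral_distr) simp_all
      also note char
      also have "exp (- complex_of_real ((t *\<^sub>R z) \<bullet> (A *v (t *\<^sub>R z))) / 2
          + (CLINT x|\<nu>. iexp ((t *\<^sub>R z) \<bullet> x) - 1
            - \<i> * complex_of_real ((t *\<^sub>R z) \<bullet> x) * indicator (cball 0 1) x)
          + \<i> * complex_of_real (\<gamma> \<bullet> (t *\<^sub>R z))) =
        exp (- complex_of_real (z \<bullet> (A *v z) * t\<^sup>2) / 2
        + (CLINT x|\<nu>. iexp (t * (z \<bullet> x)) - 1
           - \<i> * complex_of_real (t * (z \<bullet> x)) * indicator {x. norm x \<le> 1} x)
        + \<i> * complex_of_real (t * (\<gamma> \<bullet> z)))"
        unfolding q by (simp only: ind inner_scaleR_left inner_scaleR_right)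
      finally show "char (distr \<mu> borel ((\<bullet>) z)) t = \<dots>" .
    qed
    ultimately show "levy_khintchine_line (distr \<mu> borel ((\<bullet>) z)) \<nu> ((\<bullet>) z) norm
        (z \<bullet> (A *v z)) (\<gamma> \<bullet> z)"
      by (rule levy_khintchine_line.intro)
  qed
qed

lemma eventually_tail_le:
  fixes \<mu> \<nu> :: "(real ^ 'd) measure"
  assumes \<mu>: "prob_space \<mu>" "sets \<mu> = sets borel" and levy: "levy_measure_of \<mu> \<nu>"
    and R: "0 < R" "R < c" "AE x in \<nu>. norm x \<le> R"
  shows "\<forall>\<^sub>F r in at_top. measure \<mu> {x. r < norm x} \<le> exp (- r * ln r / c)"
proof -
  interpret prob_space \<mu> by fact
  have Rc: "0 < R / c" "R / c < 1" using R by auto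
  from dense[OF Rc(2)] obtain v where v: "R / c < v" "v < 1" by blast
  \<comment> \<open>The one-dimensional rate is u^2 / R, so u^2 has to exceed R / c.\<close>
  define u where "u = sqrt v"
  have "0 < v" using v Rc by linarith
  with v have u: "0 < u" "u < 1" "R / c < u\<^sup>2" by (auto simp: u_def)
  have "1 / c < u\<^sup>2 / R" using u(3) R by (simp add: field_simps)
  \<comment> \<open>The gap between \<open>k\<close> and 1 / c absorbs the number of directions in
    the union bound.\<close>
  then obtain k where k: "1 / c < k" "k < u\<^sup>2 / R" using dense by blast
  obtain Z :: "(real ^ 'd) set" where Z: "finite Z" "Z \<subseteq> sphere 0 1" "Z \<noteq> {}"
      "\<And>x. \<exists>z\<in>Z. u * norm x \<le> z \<bullet> x"
    using finite_sphere_net[OF u(2)] by metis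
  obtain A \<gamma> where line: "\<And>z. norm z = 1 \<Longrightarrow>
    levy_khintchine_line (distr \<mu> borel ((\<bullet>) z)) \<nu> ((\<bullet>) z) norm (z \<bullet> (A *v z)) (\<gamma> \<bullet> z)"
    using levy_measure_of_projection[OF \<mu> levy] by blast
  have [measurable]: "(\<bullet>) z \<in> borel_measurable \<mu>" for z
    by (rule borel_measurable_inner_const[OF \<mu>(2)])
  have "\<forall>\<^sub>F r in at_top. \<forall>z\<in>Z. measure (distr \<mu> borel ((\<bullet>) z)) {u * r..} \<le> exp (- k * r * ln r)"
  proof (rule eventually_ball_finite[OF Z(1)], rule ballI)
    fix z assume "z \<in> Z"
    with Z(2) have "norm z = 1" by auto
    then interpret Z: levy_khintchine_line "distr \<mu> borel ((\<bullet>) z)" \<nu> "(\<bullet>) z" norm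
        "z \<bullet> (A *v z)" "\<gamma> \<bullet> z" by (rule line)
    show "\<forall>\<^sub>F r in at_top. measure (distr \<mu> borel ((\<bullet>) z)) {u * r..} \<le> exp (- k * r * ln r)"
      using R u k by (intro Z.eventually_upper_tail_le[where R=R]) auto
  qed
  moreover have "\<forall>\<^sub>F r in at_top. real (card Z) * exp (- k * r * ln r) \<le> exp (- r * ln r / c)"
  proof -
    define d where "d = k - 1 / c"
    have "0 < d" using k by (simp add: d_def)
    then have "\<forall>\<^sub>F r in at_top. real (card Z) * exp (- d * (r * ln r)) \<le> 1"
      by real_asymp
    then show ?thesis
    proof eventually_elim
      case (elim r)
      have "real (card Z) * exp (- k * r * ln r) =
          (real (card Z) * exp (- d * (r * ln r))) * exp (- r * ln r / c)"
        by (simp add: d_def exp_add[symmetric] algebra_simps)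
      also have "\<dots> \<le> 1 * exp (- r * ln r / c)"
        by (intro mult_right_mono elim) simp
      finally show ?case by simp
    qed
  qed
  ultimately show ?thesis using eventually_gt_at_top[of 0]
  proof eventually_elim
    case (elim r)
    have sp: "space \<mu> = UNIV" using sets_eq_imp_space_eq[OF \<mu>(2)] by simp
    have "measure \<mu> {x. r < norm x} \<le> measure \<mu> (\<Union>z\<in>Z. {x. u * r \<le> z \<bullet> x})"
    proof (rule finite_measure_mono)
      show "{x. r < norm x} \<subseteq> (\<Union>z\<in>Z. {x. u * r \<le> z \<bullet> x})"
      proof safe
        fix x :: "real ^ 'd" assume "r < norm x"
        obtain z where z: "z \<in> Z" "u * norm x \<le> z \<bullet> x" using Z(4) by blast
        have "u * r \<le> u * norm x" using u \<open>r < norm x\<close> by simp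
        with z(2) have "u * r \<le> z \<bullet> x" by linarith
        with z(1) show "x \<in> (\<Union>z\<in>Z. {x. u * r \<le> z \<bullet> x})" by blast
      qed
    qed (auto simp: \<mu>(2) intro!: sets.finite_UN Z(1))
    also have "\<dots> \<le> (\<Sum>z\<in>Z. measure \<mu> {x. u * r \<le> z \<bullet> x})"
      by (intro finite_measure_subadditive_finite Z(1)) (auto simp: \<mu>(2))
    also have "\<dots> = (\<Sum>z\<in>Z. measure (distr \<mu> borel ((\<bullet>) z)) {u * r..})"
      by (intro sum.cong refl, subst measure_distr) (simp_all add: vimage_def sp)
    also have "\<dots> \<le> (\<Sum>z\<in>Z. exp (- k * r * ln r))"
      using elim(1) by (intro sum_mono) auto
    also have "\<dots> \<le> exp (- r * ln r / c)"
      using elim(2) by simp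
    finally show ?case .
  qed
qed

text \<open>A net with factor \<open>r1 / R\<close> turns norm above \<open>R\<close> into some
  projection above \<open>r1\<close>. Positive mass is thus inherited by at least one of finitely
  many directions, and the line estimate in that direction suffices.\<close>

lemma eventually_tail_ge:
  fixes \<mu> \<nu> :: "(real ^ 'd) measure"
  assumes \<mu>: "prob_space \<mu>" "sets \<mu> = sets borel" and levy: "levy_measure_of \<mu> \<nu>"
    and c: "0 < c" "c < R" and pos: "0 < emeasure \<nu> {x. R < norm x}"
  shows "\<forall>\<^sub>F r in at_top. exp (- r * ln r / c) \<le> measure \<mu> {x. r < norm x}"
proof -
  interpret prob_space \<mu> by fact
  have sets\<nu>: "sets \<nu> = sets borel" using levy by (simp add: levy_measure_of_def)
  have sp: "space \<mu> = UNIV" "space \<nu> = UNIV"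
    using sets_eq_imp_space_eq[OF \<mu>(2)] sets_eq_imp_space_eq[OF sets\<nu>] by auto
  obtain r1 where r1: "c < r1" "r1 < R" using dense[OF c(2)] by blast
  have u: "r1 / R < 1" "0 < r1 / R" using r1 c by auto
  obtain Z :: "(real ^ 'd) set" where Z: "finite Z" "Z \<subseteq> sphere 0 1" "Z \<noteq> {}"
      "\<And>x. \<exists>z\<in>Z. r1 / R * norm x \<le> z \<bullet> x"
    using finite_sphere_net[OF u(1)] by metis
  have "\<exists>z\<in>Z. 0 < emeasure \<nu> {x. r1 < z \<bullet> x}"
  proof (rule ccontr)
    assume "\<not> ?thesis"
    then have null: "emeasure \<nu> {x. r1 < z \<bullet> x} = 0" if "z \<in> Z" for z using that by auto
    have "{x. R < norm x} \<subseteq> (\<Union>z\<in>Z. {x. r1 < z \<bullet> x})"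
    proof safe
      fix x :: "real ^ 'd" assume "R < norm x"
      obtain z where z: "z \<in> Z" "r1 / R * norm x \<le> z \<bullet> x" using Z(4) by blast
      have "r1 = r1 / R * R" using r1 c by simp
      also have "\<dots> < r1 / R * norm x" using u \<open>R < norm x\<close> by (intro mult_strict_left_mono) auto
      also note z(2)
      finally show "x \<in> (\<Union>z\<in>Z. {x. r1 < z \<bullet> x})" using z(1) by blast
    qed
    then have "emeasure \<nu> {x. R < norm x} \<le> emeasure \<nu> (\<Union>z\<in>Z. {x. r1 < z \<bullet> x})"
      by (intro emeasure_mono) (auto simp: sets\<nu> intro!: sets.finite_UN Z(1))
    also have "\<dots> \<le> (\<Sum>z\<in>Z. emeasure \<nu> {x. r1 < z \<bullet> x})"
      by (intro emeasure_subadditive_finite Z(1)) (auto simp: sets\<nu>)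
    finally show False using pos null by simp
  qed
  then obtain z where z: "z \<in> Z" "0 < emeasure \<nu> {x. r1 < z \<bullet> x}" by blast
  then have nz: "norm z = 1" using Z(2) by auto
  obtain A \<gamma> where line: "\<And>z. norm z = 1 \<Longrightarrow>
    levy_khintchine_line (distr \<mu> borel ((\<bullet>) z)) \<nu> ((\<bullet>) z) norm (z \<bullet> (A *v z)) (\<gamma> \<bullet> z)"
    using levy_measure_of_projection[OF \<mu> levy] by blast
  interpret Z: levy_khintchine_line "distr \<mu> borel ((\<bullet>) z)" \<nu> "(\<bullet>) z" norm
      "z \<bullet> (A *v z)" "\<gamma> \<bullet> z" by (rule line[OF nz])
  have [measurable]: "(\<bullet>) z \<in> borel_measurable \<mu>"
    by (rule borel_measurable_inner_const[OF \<mu>(2)])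
  have "\<forall>\<^sub>F r in at_top. exp (- r * ln r / c) \<le> measure (distr \<mu> borel ((\<bullet>) z)) {r + 1..}"
    using c r1 z by (intro Z.eventually_upper_tail_ge) (auto simp: sp)
  then show ?thesis
  proof eventually_elim
    case (elim r)
    have "measure (distr \<mu> borel ((\<bullet>) z)) {r + 1..} = measure \<mu> {x. r + 1 \<le> z \<bullet> x}"
      by (subst measure_distr) (simp_all add: vimage_def sp)
    also have "\<dots> \<le> measure \<mu> {x. r < norm x}"
    proof (rule measure_mono_fmeasurable)
      show "{x. r + 1 \<le> z \<bullet> x} \<subseteq> {x. r < norm x}"
      proof safe
        fix x assume "r + 1 \<le> z \<bullet> x"
        then show "r < norm x" using Z.abs_f_le[of x] by linarith
      qed
    qed (simp_all add: fmeasurable_eq_sets \<mu>(2))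
    finally show ?case using elim by linarith
  qed
qed

section \<open>The radial function\<close>

text \<open>If \<open>K r = 0\<close> for some r < c, then \<open>k \<xi> r\<close> vanishes for
  \<sigma>-almost every direction, and by monotonicity so does the radial density on all of s >
  c.\<close>

lemma radial_function_null:
  fixes \<nu> :: "(real ^ 'd) measure"
  assumes K: "radial_function \<nu> K"
    and c: "Inf (ereal ` {r. 0 < r \<and> K r = 0}) < ereal c"
  shows "emeasure \<nu> {x. c < norm x} = 0"
proof (cases "\<nu> = null_measure borel")
  case False
  then obtain \<sigma> k where p: "polar_decomposition \<nu> \<sigma> k"
    and K: "\<And>r. r > 0 \<Longrightarrow> K r = (\<integral>\<^sup>+ \<xi>. ennreal (k \<xi> r) \<partial>\<sigma>)"
    using K unfolding radial_function_def by auto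
  from c obtain r where r: "0 < r" "K r = 0" "r < c"
    by (auto simp: Inf_less_iff)
  have sp: "space \<sigma> = sphere 0 1" using p by (simp add: polar_decomposition_def)
  have "(\<lambda>\<xi>. k \<xi> r) \<in> borel_measurable \<sigma>"
    using p r by (simp add: polar_decomposition_def)
  then have "AE \<xi> in \<sigma>. k \<xi> r \<le> 0"
    using r K[of r] by (simp add: nn_integral_0_iff_AE ennreal_eq_0_iff)
  then have AE: "AE \<xi> in \<sigma>. \<forall>s>c. k \<xi> s \<le> 0"
    using AE_space
  proof eventually_elim
    case (elim \<xi>)
    have "k \<xi> s \<le> k \<xi> r" if "c < s" for s
      using p elim(2) r that unfolding polar_decomposition_def sp
      by (auto dest!: bspec[of _ _ \<xi>] elim!: monotone_onD)
    with elim(1) show ?case by force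
  qed
  have "emeasure \<nu> {x. c < norm x} = (\<integral>\<^sup>+ \<xi>. (\<integral>\<^sup>+ s\<in>{0<..}.
      indicator {x. c < norm x} (s *\<^sub>R \<xi>) * ennreal (k \<xi> s / s) \<partial>lborel) \<partial>\<sigma>)"
    using p by (simp add: polar_decomposition_def)
  also have "\<dots> = (\<integral>\<^sup>+ \<xi>. 0 \<partial>\<sigma>)"
  proof (rule nn_integral_cong_AE)
    show "AE \<xi> in \<sigma>. (\<integral>\<^sup>+ s\<in>{0<..}.
      indicator {x. c < norm x} (s *\<^sub>R \<xi>) * ennreal (k \<xi> s / s) \<partial>lborel) = 0"
      using AE AE_space
    proof eventually_elim
      case (elim \<xi>)
      have *: "indicator {x. c < norm x} (s *\<^sub>R \<xi>) * ennreal (k \<xi> s / s) * indicator {0<..} s = 0" for s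
        using elim by (auto simp: indicator_def sp ennreal_neg divide_nonpos_nonneg)
      show ?case unfolding * by simp
    qed
  qed
  finally show ?thesis by simp
qed simp

text \<open>Choose \<open>b\<close> above \<open>c\<close> and still below the infimum, so
  \<open>K b \<noteq> 0\<close>. By monotonicity the density on (c, b] is at least
  \<open>k \<xi> b / b\<close>, so this shell alone has mass at least (b - c) / b times
  \<open>K b\<close>.\<close>

lemma radial_function_pos:
  fixes \<nu> :: "(real ^ 'd) measure"
  assumes K: "radial_function \<nu> K"
    and c: "0 < c" "ereal c < Inf (ereal ` {r. 0 < r \<and> K r = 0})"
  shows "0 < emeasure \<nu> {x. c < norm x}"
proof (cases "\<nu> = null_measure borel")
  case True
  then have "K c = 0" using K c unfolding radial_function_def by simp
  then have "Inf (ereal ` {r. 0 < r \<and> K r = 0}) \<le> ereal c"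
    using c by (intro Inf_lower) auto
  then show ?thesis using c by simp
next
  case False
  then obtain \<sigma> k where p: "polar_decomposition \<nu> \<sigma> k"
    and K: "\<And>r. r > 0 \<Longrightarrow> K r = (\<integral>\<^sup>+ \<xi>. ennreal (k \<xi> r) \<partial>\<sigma>)"
    using K unfolding radial_function_def by auto
  have sp: "space \<sigma> = sphere 0 1" using p by (simp add: polar_decomposition_def)
  from c(2) obtain b where b: "c < b" "ereal b < Inf (ereal ` {r. 0 < r \<and> K r = 0})"
    using ereal_dense2[OF c(2)] by auto
  have "K b \<noteq> 0"
  proof
    assume "K b = 0"
    then have "Inf (ereal ` {r. 0 < r \<and> K r = 0}) \<le> ereal b"
      using c b by (intro Inf_lower) auto
    then show False using b by simp
  qed
  have meas: "(\<lambda>\<xi>. k \<xi> b) \<in> borel_measurable \<sigma>"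
    using p b c by (simp add: polar_decomposition_def)
  have "0 < ennreal ((b - c) / b) * K b"
    using \<open>K b \<noteq> 0\<close> b c by (simp add: ennreal_zero_less_mult_iff zero_less_iff_neq_zero)
  also have "\<dots> = (\<integral>\<^sup>+ \<xi>. ennreal ((b - c) / b) * ennreal (k \<xi> b) \<partial>\<sigma>)"
    using meas K[of b] b c by (simp add: nn_integral_cmult)
  also have "\<dots> \<le> (\<integral>\<^sup>+ \<xi>. (\<integral>\<^sup>+ s\<in>{0<..}.
      indicator {x. c < norm x} (s *\<^sub>R \<xi>) * ennreal (k \<xi> s / s) \<partial>lborel) \<partial>\<sigma>)"
  proof (rule nn_integral_mono)
    fix \<xi> assume "\<xi> \<in> space \<sigma>"
    then have \<xi>: "norm \<xi> = 1" "\<xi> \<in> sphere 0 1" by (auto simp: sp)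
    have kb: "0 \<le> k \<xi> b" using p \<xi> b c by (simp add: polar_decomposition_def)
    have "ennreal ((b - c) / b) * ennreal (k \<xi> b) = ennreal (k \<xi> b / b) * ennreal (b - c)"
      using b c kb by (simp add: ennreal_mult[symmetric] mult.commute)
    also have "\<dots> = (\<integral>\<^sup>+ s. ennreal (k \<xi> b / b) * indicator {c<..b} s \<partial>lborel)"
      using b by (simp add: nn_integral_cmult_indicator)
    also have "\<dots> \<le> (\<integral>\<^sup>+ s\<in>{0<..}.
      indicator {x. c < norm x} (s *\<^sub>R \<xi>) * ennreal (k \<xi> s / s) \<partial>lborel)"
    proof (rule nn_integral_mono)
      fix s :: real
      have "k \<xi> b / b \<le> k \<xi> s / s" if "c < s" "s \<le> b"
      proof (rule frac_le)
        have "antimono_on {0<..} (k \<xi>)" using p \<xi> by (simp add: polar_decomposition_def)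
        then show "k \<xi> b \<le> k \<xi> s" using that c by (auto elim!: monotone_onD)
        then show "0 \<le> k \<xi> s" using kb by linarith
      qed (use that c in auto)
      then show "ennreal (k \<xi> b / b) * indicator {c<..b} s \<le>
          indicator {x. c < norm x} (s *\<^sub>R \<xi>) * ennreal (k \<xi> s / s) * indicator {0<..} s"
        using \<xi> c by (auto simp: indicator_def intro: ennreal_leI)
    qed
    finally show "ennreal ((b - c) / b) * ennreal (k \<xi> b) \<le> (\<integral>\<^sup>+ s\<in>{0<..}.
      indicator {x. c < norm x} (s *\<^sub>R \<xi>) * ennreal (k \<xi> s / s) \<partial>lborel)" .
  qed
  also have "\<dots> = emeasure \<nu> {x. c < norm x}"
    using p by (simp add: polar_decomposition_def)
  finally show ?thesis .
qed

section \<open>Two inequalities for independent variables\<close>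

lemma (in prob_space) prob_norm_gt_less:
  fixes Y :: "'a \<Rightarrow> 'b::{real_normed_vector, second_countable_topology}"
  assumes [measurable]: "Y \<in> borel_measurable M" and e: "0 < e"
  obtains m where "0 < m" "\<And>r. m \<le> r \<Longrightarrow> prob {w \<in> space M. r < norm (Y w)} < e"
proof -
  have "(\<lambda>n. prob {w \<in> space M. real n < norm (Y w)}) \<longlonglongrightarrow>
      prob (\<Inter>n. {w \<in> space M. real n < norm (Y w)})"
    by (intro finite_Lim_measure_decseq) (auto simp: decseq_def intro: le_less_trans)
  also have "(\<Inter>n. {w \<in> space M. real n < norm (Y w)}) = {}"
  proof -
    have "\<exists>n. \<not> real n < norm (Y w)" for w
      using reals_Archimedean2[of "norm (Y w)"] by (meson less_asym)
    then show ?thesis by blast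
  qed
  finally have "(\<lambda>n. prob {w \<in> space M. real n < norm (Y w)}) \<longlonglongrightarrow> 0" by simp
  then have "\<forall>\<^sub>F n in sequentially. prob {w \<in> space M. real n < norm (Y w)} < e"
    using e by (rule order_tendstoD)
  then obtain n where n: "prob {w \<in> space M. real (Suc n) < norm (Y w)} < e"
    using eventually_sequentially by (meson le_Suc_eq order_refl)
  show ?thesis
  proof (rule that[of "real (Suc n)"])
    fix r assume "real (Suc n) \<le> r"
    then have "prob {w \<in> space M. r < norm (Y w)} \<le> prob {w \<in> space M. real (Suc n) < norm (Y w)}"
      by (intro finite_measure_mono) auto
    with n show "prob {w \<in> space M. r < norm (Y w)} < e" by linarith
  qed simp
qed

text \<open>
  Ottaviani's inequality: the first partial sum leaving the ball of radius \<open>r + m\<close> is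
  independent of the remaining increment, which is at most \<open>m\<close> with probability at least
  one half.
\<close>

lemma (in prob_space) ottaviani:
  fixes D :: "nat \<Rightarrow> 'a \<Rightarrow> 'b::{real_normed_vector, second_countable_topology}"
  assumes ind: "indep_vars (\<lambda>_. borel) D {..<n}"
    and small: "\<And>k. k \<le> n \<Longrightarrow> prob {w \<in> space M. m < norm (\<Sum>i\<in>{k..<n}. D i w)} \<le> 1 / 2"
  shows "prob {w \<in> space M. \<exists>k\<le>n. r + m < norm (\<Sum>i<k. D i w)} \<le>
    2 * prob {w \<in> space M. r < norm (\<Sum>i<n. D i w)}"
proof -
  have D: "D i \<in> borel_measurable M" if "i < n" for i
    using ind that by (auto simp: indep_vars_def)
  have ev: "{w \<in> space M. c < norm (\<Sum>i\<in>I. D i w)} \<in> events" if "I \<subseteq> {..<n}" for I c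
  proof -
    have [measurable]: "(\<lambda>w. \<Sum>i\<in>I. D i w) \<in> borel_measurable M"
      using that by (intro borel_measurable_sum D) auto
    show ?thesis by measurable
  qed
  define A where "A k = {w \<in> space M. r + m < norm (\<Sum>i<k. D i w)} -
    (\<Union>j\<in>{..<k}. {w \<in> space M. r + m < norm (\<Sum>i<j. D i w)})" for k
  define B where "B k = space M - {w \<in> space M. m < norm (\<Sum>i\<in>{k..<n}. D i w)}" for k
  have A: "A k \<in> events" if "k \<le> n" for k
    unfolding A_def using that by (intro sets.Diff sets.finite_UN ev) auto
  have B: "B k \<in> events" for k
    unfolding B_def by (intro sets.Diff sets.top ev) auto
  have prod: "prob (A k \<inter> B k) = prob (A k) * prob (B k)" if k: "k \<le> n" for k
  proof -
    let ?U = "{..<k}" and ?V = "{k..<n}"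
    let ?MU = "PiM ?U (\<lambda>_. borel :: 'b measure)" and ?MV = "PiM ?V (\<lambda>_. borel :: 'b measure)"
    let ?f = "\<lambda>w. restrict (\<lambda>i. D i w) ?U" and ?g = "\<lambda>w. restrict (\<lambda>i. D i w) ?V"
    have iv: "indep_var ?MU ?f ?MV ?g"
      using k by (intro indep_var_restrict[OF ind]) auto
    \<comment> \<open>\<open>A k\<close> depends only on the variables before \<open>k\<close> and
      \<open>B k\<close> only on those from \<open>k\<close> on. Writing them as preimages under the
      two restricted families makes independence of disjoint blocks applicable.\<close>
    define A' where "A' = {f \<in> space ?MU. r + m < norm (\<Sum>i<k. f i)} -
      (\<Union>j\<in>{..<k}. {f \<in> space ?MU. r + m < norm (\<Sum>i<j. f i)})"
    define B' where "B' = space ?MV - {f \<in> space ?MV. m < norm (\<Sum>i\<in>?V. f i)}"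
    have eU: "{f \<in> space ?MU. r + m < norm (\<Sum>i<j. f i)} \<in> sets ?MU" if "j \<le> k" for j
    proof -
      have [measurable]: "(\<lambda>f. \<Sum>i<j. f i) \<in> borel_measurable ?MU"
        using that by (intro borel_measurable_sum measurable_component_singleton) auto
      show ?thesis by measurable
    qed
    have [measurable]: "(\<lambda>f. \<Sum>i\<in>?V. f i) \<in> borel_measurable ?MV"
      by (intro borel_measurable_sum measurable_component_singleton) auto
    have eV: "{f \<in> space ?MV. m < norm (\<Sum>i\<in>?V. f i)} \<in> sets ?MV"
      by measurable
    have A': "A' \<in> sets ?MU"
      unfolding A'_def by (intro sets.Diff sets.finite_UN eU) auto
    have B': "B' \<in> sets ?MV"
      unfolding B'_def by (intro sets.Diff sets.top eV)
    have sU: "(\<Sum>i<j. ?f w i) = (\<Sum>i<j. D i w)" if "j \<le> k" for j w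
      using that by (intro sum.cong) auto
    have sV: "(\<Sum>i\<in>?V. ?g w i) = (\<Sum>i\<in>?V. D i w)" for w
      by (intro sum.cong) auto
    have spU: "?f w \<in> space ?MU" and spV: "?g w \<in> space ?MV" for w
      by (simp_all add: space_PiM)
    have fA: "?f -` A' \<inter> space M = A k"
      unfolding A'_def A_def using sU spU by auto
    have gB: "?g -` B' \<inter> space M = B k"
      unfolding B'_def B_def using sV spV by auto
    have "prob ((\<lambda>w. (?f w, ?g w)) -` (A' \<times> B') \<inter> space M) =
        prob (?f -` A' \<inter> space M) * prob (?g -` B' \<inter> space M)"
      by (rule indep_varD[OF iv A' B'])
    moreover have "(\<lambda>w. (?f w, ?g w)) -` (A' \<times> B') \<inter> space M =
        (?f -` A' \<inter> space M) \<inter> (?g -` B' \<inter> space M)"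
      by blast
    ultimately show ?thesis unfolding fA gB by simp
  qed
  have half: "1 / 2 \<le> prob (B k)" if "k \<le> n" for k
  proof -
    have "prob (B k) = 1 - prob {w \<in> space M. m < norm (\<Sum>i\<in>{k..<n}. D i w)}"
      unfolding B_def by (rule prob_compl) (intro ev, auto)
    then show ?thesis using small[OF that] by linarith
  qed
  have eq: "{w \<in> space M. \<exists>k\<le>n. r + m < norm (\<Sum>i<k. D i w)} = (\<Union>k\<in>{..n}. A k)"
  proof (intro equalityI subsetI)
    fix w assume w: "w \<in> {w \<in> space M. \<exists>k\<le>n. r + m < norm (\<Sum>i<k. D i w)}"
    let ?P = "\<lambda>k. r + m < norm (\<Sum>i<k. D i w)"
    from w obtain k where k: "k \<le> n" "?P k" by auto
    then have "?P (LEAST k. ?P k)" "(LEAST k. ?P k) \<le> k"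
      by (auto intro: LeastI Least_le)
    then have "w \<in> A (LEAST k. ?P k)" "(LEAST k. ?P k) \<le> n"
      using w k by (auto simp: A_def dest: not_less_Least)
    then show "w \<in> (\<Union>k\<in>{..n}. A k)" by blast
  qed (auto simp: A_def)
  have disj: "disjoint_family_on A {..n}"
    unfolding disjoint_family_on_def A_def by (auto simp: neq_iff)
  have "prob {w \<in> space M. \<exists>k\<le>n. r + m < norm (\<Sum>i<k. D i w)} = (\<Sum>k\<le>n. prob (A k))"
    unfolding eq using A disj by (intro finite_measure_finite_Union) auto
  also have "\<dots> \<le> (\<Sum>k\<le>n. 2 * prob (A k \<inter> B k))"
  proof (rule sum_mono)
    fix k assume "k \<in> {..n}"
    then have k: "k \<le> n" by simp
    have "prob (A k) * 1 \<le> prob (A k) * (2 * prob (B k))"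
      using half[OF k] by (intro mult_left_mono) auto
    then show "prob (A k) \<le> 2 * prob (A k \<inter> B k)" by (simp add: prod[OF k])
  qed
  also have "\<dots> = 2 * prob (\<Union>k\<in>{..n}. A k \<inter> B k)"
  proof -
    have "disjoint_family_on (\<lambda>k. A k \<inter> B k) {..n}"
      using disj unfolding disjoint_family_on_def by blast
    then have "prob (\<Union>k\<in>{..n}. A k \<inter> B k) = (\<Sum>k\<le>n. prob (A k \<inter> B k))"
      using A B by (intro finite_measure_finite_Union) auto
    then show ?thesis by (simp add: sum_distrib_left)
  qed
  also have "\<dots> \<le> 2 * prob {w \<in> space M. r < norm (\<Sum>i<n. D i w)}"
  proof (intro mult_left_mono finite_measure_mono)
    show "(\<Union>k\<in>{..n}. A k \<inter> B k) \<subseteq> {w \<in> space M. r < norm (\<Sum>i<n. D i w)}"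
    proof safe
      fix k w assume k: "k \<le> n" and w: "w \<in> A k" "w \<in> B k"
      have "(\<Sum>i<n. D i w) = (\<Sum>i<k. D i w) + (\<Sum>i\<in>{k..<n}. D i w)"
        using sum.atLeastLessThan_concat[of 0 k n "\<lambda>i. D i w"] k
        by (simp add: atLeast0LessThan)
      moreover have "norm (\<Sum>i<k. D i w) \<le> norm ((\<Sum>i<k. D i w) + (\<Sum>i\<in>{k..<n}. D i w)) +
          norm (\<Sum>i\<in>{k..<n}. D i w)"
        using norm_triangle_ineq4[of "(\<Sum>i<k. D i w) + (\<Sum>i\<in>{k..<n}. D i w)" "\<Sum>i\<in>{k..<n}. D i w"]
        by simp
      ultimately show "r < norm (\<Sum>i<n. D i w)" using w by (auto simp: A_def B_def)
    qed (auto simp: A_def)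
    show "{w \<in> space M. r < norm (\<Sum>i<n. D i w)} \<in> events"
      by (intro ev) auto
  qed simp
  finally show ?thesis .
qed

text \<open>If the event of no hit after \<open>j\<close> had positive probability, the product
  formula and 1 - p <= exp (- p) would bound all partial sums of the hit probabilities by minus its
  logarithm. Only independence of finite initial segments is used.\<close>

lemma (in prob_space) borel_cantelli_indep_vars:
  assumes ind: "\<And>n. indep_vars N Y {..<n}"
    and A: "\<And>i. A i \<in> sets (N i)"
    and div: "\<not> summable (\<lambda>i. prob (Y i -` A i \<inter> space M))"
  shows "AE w in M. \<exists>\<^sub>F i in sequentially. Y i w \<in> A i"
proof -
  define p where "p i = prob (Y i -` A i \<inter> space M)" for i
  have Y: "Y i \<in> measurable M (N i)" for i
    using ind[of "Suc i"] by (auto simp: indep_vars_def)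
  define E where "E j = {w \<in> space M. \<forall>i\<ge>j. Y i w \<notin> A i}" for j
  have E: "E j \<in> events" for j
  proof -
    have "{w \<in> space M. Y i w \<notin> A i} \<in> events" for i
      using A measurable_sets[OF Y A] by (simp add: vimage_def sets.sets_Collect_neg Int_def conj_commute)
    moreover have "E j = (\<Inter>i\<in>{j..}. {w \<in> space M. Y i w \<notin> A i})"
      unfolding E_def by auto
    ultimately show ?thesis by (simp add: sets.countable_INT')
  qed
  have null: "prob (E j) = 0" for j
  proof (rule ccontr)
    assume "prob (E j) \<noteq> 0"
    then have pos: "0 < prob (E j)" by (simp add: less_le)
    have bound: "(\<Sum>i\<in>{j..<n}. p i) \<le> - ln (prob (E j))" if "j < n" for n
    proof -
      have "prob (E j) \<le> prob (\<Inter>i\<in>{j..<n}. Y i -` (space (N i) - A i) \<inter> space M)"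
      proof (rule finite_measure_mono)
        show "E j \<subseteq> (\<Inter>i\<in>{j..<n}. Y i -` (space (N i) - A i) \<inter> space M)"
          using measurable_space[OF Y] by (auto simp: E_def)
        show "(\<Inter>i\<in>{j..<n}. Y i -` (space (N i) - A i) \<inter> space M) \<in> events"
          using that A by (intro sets.finite_INT measurable_sets[OF Y]) auto
      qed
      also have "\<dots> = (\<Prod>i\<in>{j..<n}. prob (Y i -` (space (N i) - A i) \<inter> space M))"
        using that A by (intro indep_varsD[OF ind[of n]]) auto
      also have "\<dots> \<le> (\<Prod>i\<in>{j..<n}. exp (- p i))"
      proof (rule prod_mono)
        fix i
        have "Y i -` (space (N i) - A i) \<inter> space M = space M - (Y i -` A i \<inter> space M)"
          using measurable_space[OF Y] by auto
        then have "prob (Y i -` (space (N i) - A i) \<inter> space M) = 1 - p i"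
          using measurable_sets[OF Y A] by (simp add: p_def prob_compl)
        also have "\<dots> \<le> exp (- p i)"
          using exp_ge_add_one_self[of "- p i"] by linarith
        finally show "0 \<le> prob (Y i -` (space (N i) - A i) \<inter> space M) \<and>
          prob (Y i -` (space (N i) - A i) \<inter> space M) \<le> exp (- p i)" by simp
      qed
      also have "\<dots> = exp (- (\<Sum>i\<in>{j..<n}. p i))"
        by (simp add: exp_sum sum_negf[symmetric])
      finally have "ln (prob (E j)) \<le> - (\<Sum>i\<in>{j..<n}. p i)"
        using pos by (metis exp_gt_zero ln_exp ln_le_cancel_iff)
      then show ?thesis by simp
    qed
    have "summable (\<lambda>i. p (i + j))"
    proof (rule summableI_nonneg_bounded)
      fix n
      show "(\<Sum>i<n. p (i + j)) \<le> max 0 (- ln (prob (E j)))"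
      proof (cases "n = 0")
        case False
        have "(\<Sum>i<n. p (i + j)) = (\<Sum>i\<in>{j..<n + j}. p i)"
          using sum.shift_bounds_nat_ivl[of p 0 j n] by (simp add: atLeast0LessThan)
        then show ?thesis using bound[of "n + j"] False by simp
      qed simp
    qed (simp add: p_def)
    then have "summable p" by (simp add: summable_iff_shift)
    moreover have "p = (\<lambda>i. prob (Y i -` A i \<inter> space M))"
      by (rule ext) (simp add: p_def)
    ultimately show False using div by simp
  qed
  have "AE w in M. \<forall>j. w \<notin> E j"
    unfolding AE_all_countable using E null by (auto intro!: AE_not_in simp: null_sets_def emeasure_eq_measure)
  then show ?thesis
    using AE_space
  proof eventually_elim
    case (elim w)
    then show ?case by (auto simp: E_def frequently_sequentially)
  qed
qed

section \<open>Selfsimilar additive processes\<close>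

context selfsimilar_additive_process
begin

lemma selfsimilar_prob:
  assumes c: "0 < c" and J: "finite J" "J \<subseteq> {0..}" and A: "A \<in> sets (\<Pi>\<^sub>M t\<in>J. borel)"
  shows "prob {w \<in> space M. (\<lambda>t\<in>J. X (c * t) w) \<in> A} =
    prob {w \<in> space M. (\<lambda>t\<in>J. (c powr H) *\<^sub>R X t w) \<in> A}"
proof -
  have 1: "(\<lambda>w. \<lambda>t\<in>J. X (c * t) w) \<in> measurable M (\<Pi>\<^sub>M t\<in>J. borel)"
    using J c by (intro measurable_restrict random_variable) auto
  have 2: "(\<lambda>w. \<lambda>t\<in>J. (c powr H) *\<^sub>R X t w) \<in> measurable M (\<Pi>\<^sub>M t\<in>J. borel)"
    using J c by (intro measurable_restrict borel_measurable_scaleR random_variable borel_measurable_const) auto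
  show ?thesis
    using arg_cong[OF selfsimilar[OF c J], of "\<lambda>N. measure N A"]
    by (simp add: measure_distr[OF 1 A] measure_distr[OF 2 A] vimage_def Int_def conj_commute)
qed

lemma selfsimilar_prob_norm_diff:
  assumes c: "0 < c" and "0 \<le> u" "0 \<le> v"
  shows "prob {w \<in> space M. c powr H * r < norm (X (c * u) w - X (c * v) w)} =
    prob {w \<in> space M. r < norm (X u w - X v w)}"
proof -
  let ?N = "\<Pi>\<^sub>M t\<in>{u, v}. borel :: (real ^ 'd) measure"
  let ?A = "{f \<in> space ?N. c powr H * r < norm (f u - f v)}"
  have A: "?A \<in> sets ?N"
    by (intro borel_measurable_less borel_measurable_const borel_measurable_norm
        borel_measurable_diff measurable_component_singleton) auto
  have "norm ((c powr H) *\<^sub>R x - (c powr H) *\<^sub>R y) = c powr H * norm (x - y)" for x y :: "real ^ 'd"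
    by (simp add: scaleR_diff_right[symmetric])
  then show ?thesis
    using selfsimilar_prob[OF c _ _ A] assms by (simp add: space_PiM)
qed

lemma selfsimilar_prob_norm:
  assumes c: "0 < c" and "0 \<le> u"
  shows "prob {w \<in> space M. c powr H * r < norm (X (c * u) w)} =
    prob {w \<in> space M. r < norm (X u w)}"
proof -
  let ?N = "\<Pi>\<^sub>M t\<in>{u}. borel :: (real ^ 'd) measure"
  let ?A = "{f \<in> space ?N. c powr H * r < norm (f u)}"
  have A: "?A \<in> sets ?N"
    by (intro borel_measurable_less borel_measurable_const borel_measurable_norm
        measurable_component_singleton) auto
  show ?thesis
    using selfsimilar_prob[OF c _ _ A] assms by (simp add: space_PiM)
qed

lemma events_norm:
  assumes "0 \<le> t"
  shows "{w \<in> space M. r < norm (X t w)} \<in> events"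
proof -
  note [measurable] = random_variable[OF assms]
  show ?thesis by measurable
qed

lemma events_norm_diff:
  assumes "0 \<le> t" "0 \<le> s"
  shows "{w \<in> space M. r < norm (X t w - X s w)} \<in> events"
proof -
  note [measurable] = random_variable[OF assms(1)] random_variable[OF assms(2)]
  show ?thesis by measurable
qed

text \<open>Time 0 is fixed by every time scaling, so the law of \<open>X 0\<close> is invariant
  under all dilations: its tail at any r > 0 equals its tail at an arbitrarily large level, hence is
  0.\<close>

lemma AE_zero: "AE w in M. X 0 w = 0"
proof -
  note [measurable] = random_variable[OF order_refl]
  have "prob {w \<in> space M. r < norm (X 0 w)} = 0" if r: "0 < r" for r
  proof (rule ccontr)
    let ?p = "prob {w \<in> space M. r < norm (X 0 w)}"
    assume "?p \<noteq> 0"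
    then have "0 < ?p" by (simp add: less_le)
    then obtain m where m: "0 < m" "\<And>r. m \<le> r \<Longrightarrow> prob {w \<in> space M. r < norm (X 0 w)} < ?p"
      using prob_norm_gt_less[OF random_variable[OF order_refl]] by blast
    define c where "c = (r / m) powr (1 / H)"
    have "c powr H * m = r" "0 < c"
      using r m exponent_pos by (simp_all add: c_def powr_powr)
    then have "?p = prob {w \<in> space M. m < norm (X 0 w)}"
      using selfsimilar_prob_norm[of c 0 m] by simp
    with m(2)[OF order_refl] show False by simp
  qed
  then have "AE w in M. w \<notin> {w \<in> space M. 1 / real (Suc n) < norm (X 0 w)}" for n
    using events_norm[of 0]
    by (intro AE_not_in) (simp add: null_sets_def emeasure_eq_measure)
  then have "AE w in M. \<not> 1 / real (Suc n) < norm (X 0 w)" for n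
    using AE_space by eventually_elim auto
  then have "AE w in M. \<forall>n. \<not> 1 / real (Suc n) < norm (X 0 w)"
    by (simp add: AE_all_countable)
  then show ?thesis
  proof eventually_elim
    case (elim w)
    show ?case
    proof (rule ccontr)
      assume "X 0 w \<noteq> 0"
      then obtain n where "inverse (real (Suc n)) < norm (X 0 w)"
        using reals_Archimedean[of "norm (X 0 w)"] by auto
      with elim show False by (simp add: inverse_eq_divide)
    qed
  qed
qed

section \<open>Scaling of the tail and the maximal inequality\<close>

definition tail :: "real \<Rightarrow> real" where
  "tail r = prob {w \<in> space M. r < norm (X 1 w)}"

lemma tail_less: "0 < e \<Longrightarrow> \<exists>m>0. \<forall>r\<ge>m. tail r < e"
  using prob_norm_gt_less[OF random_variable[of 1], of e] unfolding tail_def by (metis zero_le_one)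

lemma prob_norm_X: "0 < t \<Longrightarrow> prob {w \<in> space M. t powr H * r < norm (X t w)} = tail r"
  using selfsimilar_prob_norm[of t 1 r] by (simp add: tail_def)

text \<open>Rescaling by \<open>s\<close> instead of \<open>t\<close> only lowers the threshold.
  Time 0 admits no such rescaling and is settled by the almost sure value 0.\<close>

lemma prob_norm_X_le:
  assumes s: "0 \<le> s" "s \<le> t" and t: "0 < t" and r: "0 < r"
  shows "prob {w \<in> space M. t powr H * r < norm (X s w)} \<le> tail r"
proof (cases "s = 0")
  case True
  have "prob {w \<in> space M. t powr H * r < norm (X s w)} \<le> prob {}"
  proof (rule finite_measure_mono_AE)
    show "AE w in M. w \<in> {w \<in> space M. t powr H * r < norm (X s w)} \<longrightarrow> w \<in> {}"
      using AE_zero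
    proof eventually_elim
      case (elim w)
      have "0 \<le> t powr H * r" using r by (intro mult_nonneg_nonneg) auto
      moreover have "norm (X s w) = 0" using elim True by simp
      ultimately show ?case by simp
    qed
  qed simp
  also have "prob {} \<le> tail r" by (simp add: tail_def)
  finally show ?thesis .
next
  case False
  with s have s0: "0 < s" by simp
  have "prob {w \<in> space M. t powr H * r < norm (X s w)} \<le>
      prob {w \<in> space M. s powr H * r < norm (X s w)}"
  proof (rule finite_measure_mono)
    have "s powr H * r \<le> t powr H * r"
      using s s0 r exponent_pos by (intro mult_right_mono powr_mono2) auto
    then show "{w \<in> space M. t powr H * r < norm (X s w)} \<subseteq> {w \<in> space M. s powr H * r < norm (X s w)}"
      by auto
    show "{w \<in> space M. s powr H * r < norm (X s w)} \<in> events"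
      by (rule events_norm[OF s(1)])
  qed
  then show ?thesis using prob_norm_X[OF s0] by simp
qed

text \<open>One step of the expansion of \<open>X 1\<close> over scales: the second summand of X(1)
  = (X(1) - X(1/a)) + X(1/a) is distributed as a^(- H) X(1), which returns the same tail function at
  a rescaled level.\<close>

lemma tail_subdivision:
  assumes a: "0 < a" and r: "0 < r"
  shows "tail r \<le> prob {w \<in> space M. (1 - \<eta>) * r < norm (X 1 w - X (1 / a) w)} + tail (a powr H * \<eta> * r)"
proof -
  have [measurable]: "X 1 \<in> borel_measurable M" "X (1 / a) \<in> borel_measurable M"
    using a by (auto intro: random_variable)
  have "tail r \<le> prob ({w \<in> space M. (1 - \<eta>) * r < norm (X 1 w - X (1 / a) w)} \<union>
      {w \<in> space M. \<eta> * r < norm (X (1 / a) w)})"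
    unfolding tail_def
  proof (rule finite_measure_mono)
    show "{w \<in> space M. r < norm (X 1 w)} \<subseteq>
      {w \<in> space M. (1 - \<eta>) * r < norm (X 1 w - X (1 / a) w)} \<union>
      {w \<in> space M. \<eta> * r < norm (X (1 / a) w)}"
    proof safe
      fix w assume "r < norm (X 1 w)" "\<not> \<eta> * r < norm (X (1 / a) w)"
      moreover have "norm (X 1 w) \<le> norm (X 1 w - X (1 / a) w) + norm (X (1 / a) w)"
        by (metis diff_add_cancel norm_triangle_ineq)
      ultimately show "(1 - \<eta>) * r < norm (X 1 w - X (1 / a) w)"
        by (simp add: algebra_simps)
    qed
  qed measurable
  also have "\<dots> \<le> prob {w \<in> space M. (1 - \<eta>) * r < norm (X 1 w - X (1 / a) w)} +
      prob {w \<in> space M. \<eta> * r < norm (X (1 / a) w)}"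
    by (rule measure_Un_le) measurable
  also have "prob {w \<in> space M. \<eta> * r < norm (X (1 / a) w)} = tail (a powr H * \<eta> * r)"
    using prob_norm_X[of "1 / a" "a powr H * \<eta> * r"] a by (simp add: powr_divide)
  finally show ?thesis .
qed

text \<open>The supremum over [0, t] is observed on dyadic grids, where it is a finite measurable
  event accessible to Ottaviani's inequality. Refining the grid only enlarges the event.\<close>

definition exceeds :: "real \<Rightarrow> real \<Rightarrow> nat \<Rightarrow> 'w set" where
  "exceeds t r j = {w \<in> space M. \<exists>k\<le>2 ^ j. r < norm (X (t * real k / 2 ^ j) w)}"

lemma exceeds_sets: assumes "0 < t" shows "exceeds t r j \<in> events"
proof -
  have "exceeds t r j = (\<Union>k\<in>{..2 ^ j}. {w \<in> space M. r < norm (X (t * real k / 2 ^ j) w)})"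
    unfolding exceeds_def by auto
  also have "\<dots> \<in> events"
    using assms by (intro sets.finite_UN events_norm) auto
  finally show ?thesis .
qed

lemma prob_exceeds_le:
  assumes t: "0 < t" and m: "0 < m" "tail (m / 2) \<le> 1 / 4"
  shows "prob (exceeds t (t powr H * (r + m)) j) \<le> 2 * tail r"
proof -
  let ?n = "2 ^ j :: nat"
  define s where "s k = t * real k / 2 ^ j" for k :: nat
  define D where "D k w = X (s (Suc k)) w - X (s k) w" for k w
  have s: "0 \<le> s k" for k using t by (simp add: s_def)
  have [measurable]: "X (s k) \<in> borel_measurable M" for k by (rule random_variable[OF s])
  have sn: "s ?n = t" by (simp add: s_def)
  have "strict_mono_on {..?n} s"
    using t by (auto simp: s_def strict_mono_on_def divide_strict_right_mono)
  then have ind: "indep_vars (\<lambda>_. borel) D {..<?n}"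
    unfolding D_def using independent_increments[of s ?n] s by simp
  have sumD: "(\<Sum>i\<in>{k..<n}. D i w) = X (s n) w - X (s k) w" if "k \<le> n" for k n w
    using sum_Suc_diff'[OF that, of "\<lambda>k. X (s k) w"] by (simp add: D_def)
  have sumD0: "(\<Sum>i<n. D i w) = X (s n) w - X 0 w" for n w
    using sumD[of 0 n w] by (simp add: atLeast0LessThan s_def)
  \<comment> \<open>The remaining increment X(t) - X(s k) exceeds its level only if one endpoint
    exceeds half of it; each has probability at most 1/4, which gives the 1/2 required by
    Ottaviani.\<close>
  have small: "prob {w \<in> space M. t powr H * m < norm (\<Sum>i\<in>{k..<?n}. D i w)} \<le> 1 / 2"
    if k: "k \<le> ?n" for k
  proof -
    have le: "s k \<le> t"
    proof -
      have "s k \<le> s ?n" unfolding s_def using k t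
        by (intro divide_right_mono mult_left_mono) (simp_all only: of_nat_le_iff, auto)
      then show ?thesis by (simp add: sn)
    qed
    have "prob {w \<in> space M. t powr H * m < norm (\<Sum>i\<in>{k..<?n}. D i w)} \<le>
      prob ({w \<in> space M. t powr H * (m / 2) < norm (X t w)} \<union>
        {w \<in> space M. t powr H * (m / 2) < norm (X (s k) w)})"
    proof (rule finite_measure_mono)
      show "{w \<in> space M. t powr H * m < norm (\<Sum>i\<in>{k..<?n}. D i w)} \<subseteq>
        {w \<in> space M. t powr H * (m / 2) < norm (X t w)} \<union>
        {w \<in> space M. t powr H * (m / 2) < norm (X (s k) w)}"
      proof safe
        fix w assume "t powr H * m < norm (\<Sum>i\<in>{k..<?n}. D i w)"
          "\<not> t powr H * (m / 2) < norm (X (s k) w)"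
        then show "t powr H * (m / 2) < norm (X t w)"
          using norm_triangle_ineq4[of "X t w" "X (s k) w"] by (simp add: sumD[OF k] sn)
      qed
      show "{w \<in> space M. t powr H * (m / 2) < norm (X t w)} \<union>
        {w \<in> space M. t powr H * (m / 2) < norm (X (s k) w)} \<in> events"
        using t s by (intro sets.Un events_norm) auto
    qed
    also have "\<dots> \<le> prob {w \<in> space M. t powr H * (m / 2) < norm (X t w)} +
        prob {w \<in> space M. t powr H * (m / 2) < norm (X (s k) w)}"
      using t s by (intro measure_Un_le events_norm) auto
    also have "\<dots> \<le> tail (m / 2) + tail (m / 2)"
      using prob_norm_X_le[of t t "m / 2"] prob_norm_X_le[OF s le t, of "m / 2"] t m
      by (intro add_mono) auto
    finally show ?thesis using m by simp
  qed
  have "prob (exceeds t (t powr H * (r + m)) j) \<le>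
      prob {w \<in> space M. \<exists>k\<le>?n. t powr H * r + t powr H * m < norm (\<Sum>i<k. D i w)}"
  proof (rule finite_measure_mono_AE)
    show "AE w in M. w \<in> exceeds t (t powr H * (r + m)) j \<longrightarrow>
      w \<in> {w \<in> space M. \<exists>k\<le>?n. t powr H * r + t powr H * m < norm (\<Sum>i<k. D i w)}"
      using AE_zero
      by eventually_elim (auto simp: exceeds_def sumD0 s_def ring_distribs)
    have "{w \<in> space M. \<exists>k\<le>?n. t powr H * r + t powr H * m < norm (\<Sum>i<k. D i w)} =
        (\<Union>k\<in>{..?n}. {w \<in> space M. t powr H * r + t powr H * m < norm (X (s k) w - X 0 w)})"
      unfolding sumD0 by auto
    also have "\<dots> \<in> events"
      by (intro sets.finite_UN events_norm_diff s) auto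
    finally show "{w \<in> space M. \<exists>k\<le>?n. t powr H * r + t powr H * m < norm (\<Sum>i<k. D i w)} \<in> events" .
  qed
  also have "\<dots> \<le> 2 * prob {w \<in> space M. t powr H * r < norm (\<Sum>i<?n. D i w)}"
    by (rule ottaviani[OF ind small])
  also have "prob {w \<in> space M. t powr H * r < norm (\<Sum>i<?n. D i w)} =
      prob {w \<in> space M. t powr H * r < norm (X t w)}"
  proof (rule finite_measure_eq_AE)
    show "AE w in M. w \<in> {w \<in> space M. t powr H * r < norm (\<Sum>i<?n. D i w)} \<longleftrightarrow>
      w \<in> {w \<in> space M. t powr H * r < norm (X t w)}"
      using AE_zero by eventually_elim (simp add: sumD0 sn)
    show "{w \<in> space M. t powr H * r < norm (\<Sum>i<?n. D i w)} \<in> events"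
      unfolding sumD0 by (intro events_norm_diff s) auto
    show "{w \<in> space M. t powr H * r < norm (X t w)} \<in> events"
      using t by (intro events_norm) auto
  qed
  finally show ?thesis using prob_norm_X[OF t] by simp
qed

lemma exceeds_mono: "exceeds t r j \<subseteq> exceeds t r (Suc j)"
proof
  fix w assume "w \<in> exceeds t r j"
  then obtain k where "w \<in> space M" "k \<le> 2 ^ j" "r < norm (X (t * real k / 2 ^ j) w)"
    by (auto simp: exceeds_def)
  then show "w \<in> exceeds t r (Suc j)"
    unfolding exceeds_def by (auto intro!: exI[of _ "2 * k"])
qed

lemma prob_UN_exceeds_le:
  assumes t: "0 < t" and m: "0 < m" "tail (m / 2) \<le> 1 / 4"
  shows "prob (\<Union>j. exceeds t (t powr H * (r + m)) j) \<le> 2 * tail r"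
proof (rule LIMSEQ_le_const2)
  show "(\<lambda>j. prob (exceeds t (t powr H * (r + m)) j)) \<longlonglongrightarrow>
      prob (\<Union>j. exceeds t (t powr H * (r + m)) j)"
    by (intro finite_Lim_measure_incseq incseq_SucI exceeds_mono) (auto intro: exceeds_sets[OF t])
qed (use prob_exceeds_le[OF assms] in blast)

text \<open>By right-continuity an exceedance at \<open>s < t\<close> persists on an interval to the
  right of \<open>s\<close>, which contains a dyadic point. The endpoint \<open>t\<close> has no
  room to its right but is itself a grid point.\<close>

lemma norm_le_of_not_exceeds:
  assumes t: "0 < t" and w: "w \<in> space M" "w \<notin> (\<Union>j. exceeds t r j)"
    and right: "\<And>s. 0 \<le> s \<Longrightarrow> ((\<lambda>u. X u w) \<longlongrightarrow> X s w) (at_right s)"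
    and s: "0 \<le> s" "s \<le> t"
  shows "norm (X s w) \<le> r"
proof (rule ccontr)
  assume "\<not> norm (X s w) \<le> r"
  then have gt: "r < norm (X s w)" by simp
  show False
  proof (cases "s = t")
    case True
    then have "w \<in> exceeds t r 0" using w gt by (auto simp: exceeds_def intro!: exI[of _ 1])
    with w show False by blast
  next
    case False
    with s have "s < t" by simp
    have "\<forall>\<^sub>F u in at_right s. r < norm (X u w)"
      using tendsto_norm[OF right[OF s(1)]] gt by (rule order_tendstoD)
    then obtain b where b: "s < b" "\<And>u. s < u \<Longrightarrow> u < b \<Longrightarrow> r < norm (X u w)"
      unfolding eventually_at_right_field by blast
    define e where "e = min (b - s) (t - s) / t"
    have "0 < e" using b \<open>s < t\<close> t by (simp add: e_def)
    then obtain j where j: "(1 / 2) ^ j < e"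
      using real_arch_pow_inv[of e "1 / 2"] by auto
    \<comment> \<open>The first grid index strictly after \<open>s\<close>; adding 1 to the floor
      keeps it strict when \<open>s\<close> is a grid point.\<close>
    define k where "k = nat \<lfloor>s * 2 ^ j / t\<rfloor> + 1"
    have "0 \<le> s * 2 ^ j / t" using s t by simp
    then have k: "s * 2 ^ j / t < real k" "real k \<le> s * 2 ^ j / t + 1"
      unfolding k_def by linarith+
    have lo: "s < t * real k / 2 ^ j"
      using k(1) t by (simp add: field_simps)
    have "t * real k / 2 ^ j \<le> t * (s * 2 ^ j / t + 1) / 2 ^ j"
      using k(2) t by (intro divide_right_mono mult_left_mono) auto
    also have "\<dots> = s + t * (1 / 2) ^ j"
      using t by (simp add: field_simps power_one_over)
    also have "\<dots> < s + t * e" using j t by simp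
    also have "\<dots> = s + min (b - s) (t - s)" using t by (simp add: e_def)
    finally have hi: "t * real k / 2 ^ j < b" "t * real k / 2 ^ j < t" by auto
    have "k \<le> 2 ^ j"
    proof -
      have "real k < 2 ^ j" using hi(2) t by (simp add: field_simps)
      then have "real k < real (2 ^ j)" by simp
      then show ?thesis by (simp only: of_nat_less_iff)
    qed
    moreover have "r < norm (X (t * real k / 2 ^ j) w)"
      by (rule b(2)[OF lo hi(1)])
    ultimately have "w \<in> exceeds t r j" using w by (auto simp: exceeds_def)
    with w show False by blast
  qed
qed

end

section \<open>The law of the iterated logarithm\<close>

definition rate :: "real \<Rightarrow> real" where
  "rate t = ln (ln t) / ln (ln (ln t))"

lemma divide_ln_mono:
  fixes x y :: real
  assumes "exp 1 \<le> x" "x \<le> y"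
  shows "x / ln x \<le> y / ln y"
proof -
  have pos: "0 < x" "0 < y" using assms exp_gt_zero[of 1] by linarith+
  have "1 \<le> ln x" "1 \<le> ln y" using assms pos by (simp_all add: ln_ge_iff)
  then have "0 < ln x" "0 < ln y" by linarith+
  then show ?thesis
    using ln_x_over_x_mono[OF assms] pos by (simp add: field_simps)
qed

section \<open>The upper bound for the limsup\<close>

context selfsimilar_additive_process
begin

text \<open>The chain c2 < c1 < c' < c pays for three losses: c1 / c2 > 1 gives summability, c' / c1
  = a^H covers passing from \<open>t\<close> to the next power of \<open>a\<close>, and c / c'
  absorbs the quotient of ln (ln (a t)) and ln (ln t).\<close>

lemma eventually_norm_le:
  assumes c2: "0 < c2" "c2 < c"
    and tail: "\<forall>\<^sub>F r in at_top. tail r \<le> exp (- r * ln r / c2)"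
  shows "AE w in M. \<forall>\<^sub>F t in at_top. norm (X t w) \<le> c * (t powr H * rate t)"
proof -
  obtain c' where c': "c2 < c'" "c' < c" using dense[OF c2(2)] by blast
  obtain c1 where c1: "c2 < c1" "c1 < c'" using dense[OF c'(1)] by blast
  define a where "a = (c' / c1) powr (1 / H)"
  have aH: "a powr H = c' / c1"
    using c1 c2 exponent_pos by (simp add: a_def powr_powr)
  have a: "1 < a" unfolding a_def using c1 c2 exponent_pos by (intro gr_one_powr) auto
  define l where "l = ln a"
  have l: "0 < l" using a by (simp add: l_def)
  obtain m where m: "0 < m" "tail (m / 2) \<le> 1 / 4"
  proof -
    obtain m where "0 < m" "\<forall>r\<ge>m. tail r < 1 / 4" using tail_less[of "1 / 4"] by auto
    then show ?thesis by (intro that[of "2 * m"]) (auto intro: less_imp_le)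
  qed
  \<comment> \<open>The subtraction of \<open>m\<close> anticipates the loss in the maximal
    inequality, so that the level used in \<open>E n\<close> is exactly c1 times the rate at
    a^n.\<close>
  define r where "r x = c1 * (ln (x * l) / ln (ln (x * l))) - m" for x :: real
  define E where "E n = (\<Union>j. exceeds (a ^ n) ((a ^ n) powr H * (r (real n) + m)) j)" for n
  have E_sets: "E n \<in> events" for n
    unfolding E_def using a exceeds_sets[of "a ^ n"] by (intro sets.countable_UN) auto
  have E_le: "prob (E n) \<le> 2 * tail (r (real n))" for n
    unfolding E_def using a by (intro prob_UN_exceeds_le m) auto
  have "1 < c1 / c2" using c1 c2 by simp
  then obtain p where p: "1 < p" "p < c1 / c2" using dense by blast
  \<comment> \<open>r ln r / c2 grows like (c1 / c2) ln x, so the tail at \<open>r x\<close> is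
    below a power of x with exponent less than -1.\<close>
  have "((\<lambda>x. (r x * ln (r x) / c2) / ln x) \<longlongrightarrow> c1 * inverse c2) at_top"
    unfolding r_def using c1 c2 l by real_asymp
  then have "\<forall>\<^sub>F x in at_top. p < (r x * ln (r x) / c2) / ln x"
    using p(2)[unfolded divide_inverse] by (rule order_tendstoD)
  moreover have "filterlim r at_top at_top"
    unfolding r_def using c1 c2 l by real_asymp
  then have "\<forall>\<^sub>F x in at_top. tail (r x) \<le> exp (- r x * ln (r x) / c2)"
    by (rule eventually_compose_filterlim[OF tail])
  ultimately have "\<forall>\<^sub>F x in at_top. tail (r x) \<le> x powr (- p)"
    using eventually_gt_at_top[of 1]
  proof eventually_elim
    case (elim x)
    have "0 < ln x" using elim by simp
    with elim(1) have "p * ln x < r x * ln (r x) / c2"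
      by (subst (asm) pos_less_divide_eq)
    then have "p * ln x \<le> r x * ln (r x) / c2" by simp
    then have "exp (- r x * ln (r x) / c2) \<le> exp (- p * ln x)" by simp
    also have "\<dots> = x powr (- p)" using elim by (simp add: powr_def)
    finally show ?case using elim by linarith
  qed
  then have ev: "\<forall>\<^sub>F n in sequentially. tail (r (real n)) \<le> real n powr (- p)"
    by (rule eventually_compose_filterlim[OF _ filterlim_real_sequentially])
  have "summable (\<lambda>n. prob (E n))"
  proof (rule summable_comparison_test_ev)
    show "summable (\<lambda>n. 2 * real n powr (- p))"
      using p by (intro summable_mult) (simp add: summable_real_powr_iff)
    show "\<forall>\<^sub>F n in sequentially. norm (prob (E n)) \<le> 2 * real n powr (- p)"
      using ev
    proof eventually_elim
      case (elim n)
      then show ?case using E_le[of n] by simp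
    qed
  qed
  then have "AE w in M. \<forall>\<^sub>F n in sequentially. w \<in> space M - E n"
    by (intro borel_cantelli_AE1 E_sets) (simp_all add: emeasure_eq_measure)
  then show ?thesis using cadlag
  proof eventually_elim
    case (elim w)
    then obtain N where N: "\<And>n. N \<le> n \<Longrightarrow> w \<in> space M - E n"
      by (auto simp: eventually_sequentially)
    have right: "((\<lambda>u. X u w) \<longlongrightarrow> X s w) (at_right s)" if "0 \<le> s" for s
      using elim(2) that by blast
    have "((\<lambda>t. ln (ln (a * t)) / ln (ln t)) \<longlongrightarrow> 1) at_top"
      using a by real_asymp
    moreover have "1 < c / c'" using c' c2 by simp
    ultimately have "\<forall>\<^sub>F t in at_top. ln (ln (a * t)) / ln (ln t) < c / c'"
      by (rule order_tendstoD)
    moreover have "\<forall>\<^sub>F t :: real in at_top. 0 < ln (ln (ln t))" by real_asymp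
    moreover have "\<forall>\<^sub>F t :: real in at_top. 0 < ln (ln t)" by real_asymp
    moreover have "\<forall>\<^sub>F t :: real in at_top. 0 < ln t" by real_asymp
    moreover have "\<forall>\<^sub>F t in at_top. real N \<le> ln t / l" using l by real_asymp
    ultimately show ?case using eventually_gt_at_top[of 0]
    proof eventually_elim
      case (elim t)
      \<comment> \<open>The least \<open>n\<close> with t <= a^n, which also satisfies a^n <= a
        t.\<close>
      define n where "n = nat \<lceil>ln t / l\<rceil>"
      have n1: "ln t / l \<le> real n" unfolding n_def by linarith
      have "0 \<le> ln t / l" using elim l by simp
      then have n2: "real n \<le> ln t / l + 1" unfolding n_def by linarith
      have "N \<le> n" using n1 elim(5) by linarith
      have lo: "ln t \<le> real n * l" using n1 l by (simp add: pos_divide_le_eq)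
      have "real n * l \<le> (ln t / l + 1) * l" using n2 l by (intro mult_right_mono) auto
      also have "\<dots> = ln (a * t)" using l a elim by (simp add: ln_mult l_def field_simps)
      finally have hi: "real n * l \<le> ln (a * t)" .
      have an: "ln (a ^ n) = real n * l" using a by (simp add: ln_realpow l_def)
      have pos: "0 < a ^ n" "0 < a * t" using a elim by simp_all
      have tn: "t \<le> a ^ n" using lo unfolding an[symmetric] ln_le_cancel_iff[OF elim(6) pos(1)] .
      have nt: "a ^ n \<le> a * t" using hi unfolding an[symmetric] ln_le_cancel_iff[OF pos] .
      have "norm (X t w) \<le> (a ^ n) powr H * (r (real n) + m)"
        using N[OF \<open>N \<le> n\<close>] a tn elim right
        by (intro norm_le_of_not_exceeds[of "a ^ n"]) (auto simp: E_def)
      also have "r (real n) + m = c1 * (ln (real n * l) / ln (ln (real n * l)))"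
        by (simp add: r_def)
      also have "(a ^ n) powr H * \<dots> \<le> (a * t) powr H * (c1 * (ln (ln (a * t)) / ln (ln (ln t))))"
      proof (intro mult_mono frac_le)
        show "(a ^ n) powr H \<le> (a * t) powr H"
          using nt a exponent_pos by (intro powr_mono2) auto
        have nl: "0 < real n * l" using lo elim by linarith
        then show "ln (real n * l) \<le> ln (ln (a * t))" using hi by (intro ln_mono)
        have "ln (ln t) \<le> ln (real n * l)" using lo elim(4) by (rule ln_mono)
        then show le: "ln (ln (ln t)) \<le> ln (ln (real n * l))" using elim(3) by (rule ln_mono)
        show "0 \<le> ln (ln (a * t))"
          using \<open>ln (real n * l) \<le> ln (ln (a * t))\<close> \<open>ln (ln t) \<le> ln (real n * l)\<close> elim by linarith
        have "0 < ln (real n * l)" using \<open>ln (ln t) \<le> ln (real n * l)\<close> elim by linarith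
        moreover have "0 < ln (ln (real n * l))" using le elim(2) by linarith
        ultimately show q: "0 \<le> ln (real n * l) / ln (ln (real n * l))"
          by (intro divide_nonneg_pos) linarith+
        show "0 \<le> c1 * (ln (real n * l) / ln (ln (real n * l)))"
          using q c1 c2 by (intro mult_nonneg_nonneg) linarith+
      qed (use c1 c2 elim in auto)
      also have "\<dots> = t powr H * (c' * ln (ln (a * t)) / ln (ln (ln t)))"
        using a c1 c2 elim by (simp add: powr_mult aH)
      also have "\<dots> \<le> t powr H * (c * ln (ln t) / ln (ln (ln t)))"
      proof (intro mult_left_mono divide_right_mono)
        have "ln (ln (a * t)) \<le> c / c' * ln (ln t)"
          using elim by (simp add: pos_divide_less_eq)
        then have "c' * ln (ln (a * t)) \<le> c' * (c / c' * ln (ln t))"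
          using c' c2 by (intro mult_left_mono) auto
        then show "c' * ln (ln (a * t)) \<le> c * ln (ln t)" using c' c2 by simp
      qed (use elim in auto)
      finally show ?case by (simp add: rate_def algebra_simps)
    qed
  qed
qed

section \<open>The lower bound for the limsup\<close>

lemma tail_le_of_increment:
  fixes \<eta> \<kappa> B :: real
  assumes a: "0 < a" "a powr H * \<eta> = 2" and \<eta>: "0 < \<eta>" "\<eta> < 1" and \<kappa>: "0 < \<kappa>" and B: "0 \<le> B"
    and inc: "\<forall>\<^sub>F r in at_top. prob {w \<in> space M. r < norm (X 1 w - X (1 / a) w)} \<le> B * exp (- \<kappa> * r * ln r)"
  shows "\<forall>\<^sub>F r in at_top. tail r \<le> 2 * B * exp (- \<kappa> * ((1 - \<eta>) * r) * ln ((1 - \<eta>) * r))"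
proof -
  define q where "q r = prob {w \<in> space M. r < norm (X 1 w - X (1 / a) w)}" for r
  obtain r0 where r0: "\<And>r. r0 \<le> r \<Longrightarrow> q r \<le> B * exp (- \<kappa> * r * ln r)"
    using inc unfolding q_def eventually_at_top_linorder by blast
  have "\<forall>\<^sub>F r in at_top. r0 \<le> (1 - \<eta>) * r" using \<eta> by real_asymp
  moreover have "\<forall>\<^sub>F r in at_top. 1 \<le> (1 - \<eta>) * r" using \<eta> by real_asymp
  moreover have "\<forall>\<^sub>F r in at_top. exp (- \<kappa> * ((1 - \<eta>) * r) * ln ((1 - \<eta>) * r)) \<le> 1 / 2"
    using \<eta> \<kappa> by real_asymp
  ultimately show ?thesis using eventually_gt_at_top[of 0]
  proof eventually_elim
    case (elim r)
    define y where "y = (1 - \<eta>) * r"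
    define \<theta> where "\<theta> = exp (- \<kappa> * y * ln y)"
    have y: "r0 \<le> y" "1 \<le> y" and \<theta>: "0 < \<theta>" "\<theta> \<le> 1 / 2"
      using elim by (simp_all add: y_def \<theta>_def)
    \<comment> \<open>The choice \<open>a powr H * \<eta> = 2\<close> makes the level double at each
      scale, so the expansion runs over 2^j r.\<close>
    have step: "tail (2 ^ j * r) \<le> q (2 ^ j * y) + tail (2 ^ Suc j * r)" for j
    proof -
      have "0 < 2 ^ j * r" using elim by simp
      from tail_subdivision[OF a(1) this, of \<eta>]
      have "tail (2 ^ j * r) \<le> q ((1 - \<eta>) * (2 ^ j * r)) + tail (2 * (2 ^ j * r))"
        unfolding q_def a(2) .
      then show ?thesis by (simp add: y_def mult_ac)
    qed
    have iter: "tail r \<le> (\<Sum>j<n. q (2 ^ j * y)) + tail (2 ^ n * r)" for n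
    proof (induction n)
      case (Suc n)
      then show ?case using step[of n] by simp
    qed simp
    \<comment> \<open>Superlinear growth of y ln y together with 2^j >= j + 1 gives \<theta>^(j+1)
      at scale \<open>j\<close>. As \<theta> is at most 1/2, the sum over scales costs only a factor
      2.\<close>
    have q_le: "q (2 ^ j * y) \<le> B * \<theta> * (1 / 2) ^ j" for j
    proof -
      have j: "real j + 1 \<le> 2 ^ j"
        using less_exp[of j] by (metis Suc_leI add.commute of_nat_Suc of_nat_le_iff of_nat_numeral of_nat_power)
      have y2: "y \<le> 2 ^ j * y" using y by simp
      have "y * ln y * (real j + 1) \<le> (y * ln y) * 2 ^ j"
        using j y by (intro mult_left_mono) auto
      also have "\<dots> = (2 ^ j * y) * ln y" by simp
      also have "\<dots> \<le> (2 ^ j * y) * ln (2 ^ j * y)"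
        using y y2 by (intro mult_left_mono ln_mono) auto
      finally have "\<kappa> * (y * ln y * (real j + 1)) \<le> \<kappa> * ((2 ^ j * y) * ln (2 ^ j * y))"
        using \<kappa> by (intro mult_left_mono) auto
      then have "exp (- \<kappa> * (2 ^ j * y) * ln (2 ^ j * y)) \<le> exp (real (Suc j) * (- \<kappa> * y * ln y))"
        by (simp add: algebra_simps)
      also have "\<dots> = \<theta> ^ Suc j" unfolding \<theta>_def by (rule exp_of_nat_mult)
      also have "\<dots> \<le> \<theta> * (1 / 2) ^ j"
        using \<theta> by (simp add: power_mono mult_left_mono)
      finally have "B * exp (- \<kappa> * (2 ^ j * y) * ln (2 ^ j * y)) \<le> B * (\<theta> * (1 / 2) ^ j)"
        using B by (intro mult_left_mono)
      moreover have "q (2 ^ j * y) \<le> B * exp (- \<kappa> * (2 ^ j * y) * ln (2 ^ j * y))"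
        using y y2 by (intro r0) linarith
      ultimately show ?thesis by simp
    qed
    \<comment> \<open>The remainder of the expansion is the tail at 2^n r, which becomes smaller
      than any \<open>e\<close>.\<close>
    have "tail r \<le> 2 * B * \<theta> + e" if e: "0 < e" for e
    proof -
      obtain m where m: "0 < m" "\<And>s. m \<le> s \<Longrightarrow> tail s < e" using tail_less[OF e] by blast
      obtain n where "m / r < 2 ^ n" using real_arch_pow[of 2 "m / r"] by auto
      then have "m \<le> 2 ^ n * r" using elim by (simp add: pos_divide_less_eq)
      then have "tail r \<le> (\<Sum>j<n. q (2 ^ j * y)) + e" using iter[of n] m(2)[of "2 ^ n * r"] by linarith
      also have "(\<Sum>j<n. q (2 ^ j * y)) \<le> (\<Sum>j<n. B * \<theta> * (1 / 2) ^ j)"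
        by (intro sum_mono q_le)
      also have "\<dots> = B * \<theta> * (\<Sum>j<n. (1 / 2) ^ j)" by (simp add: sum_distrib_left)
      also have "\<dots> \<le> B * \<theta> * 2"
      proof (intro mult_left_mono)
        show "(\<Sum>j<n. (1 / 2 :: real) ^ j) \<le> 2" by (subst sum_gp_strict) simp
      qed (use B \<theta> in auto)
      finally show ?thesis by simp
    qed
    then have "tail r \<le> 2 * B * \<theta>" by (rule field_le_epsilon)
    then show ?case by (simp add: \<theta>_def y_def)
  qed
qed

text \<open>Terms of a summable, eventually decreasing sequence are O(1/n). Inverting the rate turns
  this polynomial bound in \<open>n\<close> into exp (- \<kappa> r ln r) at every large real level
  \<open>r\<close>. The factor (1 - \<eta>)^2 in the hypothesis pays once for this inversion and
  once for summing over scales.\<close>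

lemma increment_not_summable:
  assumes c1: "0 < c1" and tail: "\<forall>\<^sub>F r in at_top. exp (- r * ln r / c1) \<le> tail r"
    and a: "1 < a" "a powr H * \<eta> = 2" and \<eta>: "0 < \<eta>" "\<eta> < 1"
    and c': "0 < c'" "c' < (1 - \<eta>)\<^sup>2 * c1"
  shows "\<not> summable (\<lambda>n. prob {w \<in> space M. c' * rate (a ^ Suc n) < norm (X 1 w - X (1 / a) w)})"
proof
  define q where "q r = prob {w \<in> space M. r < norm (X 1 w - X (1 / a) w)}" for r
  define p where "p n = q (c' * rate (a ^ Suc n))" for n
  assume "summable (\<lambda>n. prob {w \<in> space M. c' * rate (a ^ Suc n) < norm (X 1 w - X (1 / a) w)})"
  then have sm: "summable p" by (simp add: p_def[abs_def] q_def)
  have q_nonneg: "0 \<le> q r" for r by (simp add: q_def)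
  have q_mono: "q s \<le> q r" if "r \<le> s" for r s
    unfolding q_def using that a by (intro finite_measure_mono events_norm_diff) auto
  define l where "l = ln a"
  have l: "0 < l" using a by (simp add: l_def)
  define \<Psi> where "\<Psi> y = ln y / ln (ln y)" for y :: real
  have rate: "rate (a ^ Suc n) = \<Psi> (real (Suc n) * l)" for n
    using a ln_realpow[of a "Suc n"] by (simp add: rate_def \<Psi>_def l_def)
  \<comment> \<open>x / ln x increases from e on; with x replaced by a logarithm the threshold
    becomes e^e.\<close>
  have \<Psi>_mono: "\<Psi> x \<le> \<Psi> y" if "exp (exp 1) \<le> x" "x \<le> y" for x y
  proof -
    have "0 < x" using that exp_gt_zero[of "exp 1"] by linarith
    then show ?thesis
      unfolding \<Psi>_def using that by (intro divide_ln_mono ln_mono) (simp_all add: ln_ge_iff)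
  qed
  obtain N where N: "exp (exp 1) \<le> real N * l"
  proof -
    obtain N where "exp (exp 1) / l < real N" using reals_Archimedean2 by blast
    then show ?thesis using l by (intro that[of N]) (simp add: pos_divide_less_eq)
  qed
  have p_anti: "p n \<le> p k" if "N \<le> k" "k \<le> n" for k n
  proof -
    have "real N * l \<le> real (Suc k) * l" using that l by (intro mult_right_mono) auto
    with N have "exp (exp 1) \<le> real (Suc k) * l" by linarith
    moreover have "real (Suc k) * l \<le> real (Suc n) * l"
      using that l by (intro mult_right_mono) auto
    ultimately have "\<Psi> (real (Suc k) * l) \<le> \<Psi> (real (Suc n) * l)" by (rule \<Psi>_mono)
    then show ?thesis unfolding p_def rate using c' by (intro q_mono mult_left_mono) auto
  qed
  define S where "S = suminf p"
  have S: "0 \<le> S" unfolding S_def using sm by (intro suminf_nonneg) (auto simp: p_def q_nonneg)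
  have p_le: "real (n + 1 - N) * p n \<le> S" if "N \<le> n" for n
  proof -
    have "real (n + 1 - N) * p n = (\<Sum>k\<in>{N..n}. p n)" by simp
    also have "\<dots> \<le> (\<Sum>k\<in>{N..n}. p k)" by (intro sum_mono p_anti) auto
    also have "\<dots> \<le> S" unfolding S_def
      by (intro sum_le_suminf[OF sm]) (auto simp: p_def q_nonneg)
    finally show ?thesis .
  qed
  define \<kappa> where "\<kappa> = (1 - \<eta>) / c'"
  have \<kappa>: "0 < \<kappa>" using \<eta> c' by (simp add: \<kappa>_def)
  have "\<forall>\<^sub>F r in at_top. q r \<le> 2 * S * exp (- \<kappa> * r * ln r)"
  proof -
    \<comment> \<open>For n about exp (\<kappa> r ln r) the level c' times the rate is about c'
      \<kappa> r = (1 - \<eta>) r, hence eventually below \<open>r\<close>. The summand 1 covers the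
      shift from \<open>n\<close> to \<open>Suc n\<close>.\<close>
    have "((\<lambda>r. c' * \<Psi> ((exp (\<kappa> * r * ln r) + 1) * l) / r) \<longlongrightarrow> c' * \<kappa>) at_top"
      unfolding \<Psi>_def using \<kappa> l c' by real_asymp
    moreover have "c' * \<kappa> < 1" using c' \<eta> by (simp add: \<kappa>_def)
    ultimately have "\<forall>\<^sub>F r in at_top. c' * \<Psi> ((exp (\<kappa> * r * ln r) + 1) * l) / r < 1"
      by (rule order_tendstoD)
    moreover have "\<forall>\<^sub>F r in at_top. 2 * real N + 1 \<le> exp (\<kappa> * r * ln r)"
      using \<kappa> by real_asymp
    ultimately show ?thesis using eventually_gt_at_top[of 0]
    proof eventually_elim
      case (elim r)
      define e where "e = exp (\<kappa> * r * ln r)"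
      define n where "n = nat \<lfloor>e\<rfloor>"
      have e: "2 * real N + 1 \<le> e" "0 < e" using elim by (simp_all add: e_def)
      have n: "real n \<le> e" "e < real n + 1" unfolding n_def using e by linarith+
      have Nn: "N \<le> n" using n e by linarith
      have "real N * l \<le> real (Suc n) * l" using Nn l by (intro mult_right_mono) auto
      with N have "exp (exp 1) \<le> real (Suc n) * l" by linarith
      moreover have "real (Suc n) * l \<le> (e + 1) * l" using n l by (intro mult_right_mono) auto
      ultimately have "\<Psi> (real (Suc n) * l) \<le> \<Psi> ((e + 1) * l)"
        by (rule \<Psi>_mono)
      then have "c' * rate (a ^ Suc n) \<le> c' * \<Psi> ((e + 1) * l)"
        unfolding rate using c' by (intro mult_left_mono) auto
      also have "\<dots> \<le> r" using elim by (simp add: e_def pos_divide_less_eq)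
      finally have "q r \<le> p n" unfolding p_def by (rule q_mono)
      moreover have "e / 2 * p n \<le> S"
      proof -
        \<comment> \<open>n + 1 exceeds \<open>e\<close>, and e >= 2 N + 1 makes the removal of the
          first \<open>N\<close> terms cost at most half of it.\<close>
        have "e / 2 \<le> real (n + 1 - N)" using e n Nn by (simp add: of_nat_diff)
        then have "e / 2 * p n \<le> real (n + 1 - N) * p n"
          by (intro mult_right_mono) (simp_all add: p_def q_nonneg)
        also have "\<dots> \<le> S" by (rule p_le[OF Nn])
        finally show ?thesis .
      qed
      ultimately have "e / 2 * q r \<le> S"
        using e by (meson divide_nonneg_nonneg less_imp_le mult_left_mono order_trans zero_le_numeral)
      then have "q r \<le> 2 * S / e" using e by (simp add: pos_le_divide_eq mult.commute)
      then show ?case by (simp add: e_def exp_minus field_simps)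
    qed
  qed
  then have "\<forall>\<^sub>F r in at_top. tail r \<le> 2 * (2 * S) * exp (- \<kappa> * ((1 - \<eta>) * r) * ln ((1 - \<eta>) * r))"
    unfolding q_def using a \<eta> \<kappa> S by (intro tail_le_of_increment[where a=a]) auto
  moreover have "\<forall>\<^sub>F r in at_top. 2 * (2 * S) * exp (- \<kappa> * ((1 - \<eta>) * r) * ln ((1 - \<eta>) * r))
      < exp (- r * ln r / c1)"
  proof -
    \<comment> \<open>Positive because \<kappa> (1 - \<eta>) = (1 - \<eta>)^2 / c' exceeds 1 / c1.
      The term d r ln r dominates both the constant and the term linear in \<open>r\<close> coming
      from ln (1 - \<eta>).\<close>
    define d where "d = \<kappa> * (1 - \<eta>) - 1 / c1"
    have d: "0 < d" using c' c1 \<eta> by (simp add: d_def \<kappa>_def power2_eq_square field_simps)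
    have "\<forall>\<^sub>F r in at_top. 2 * (2 * S) * exp (- (d * (r * ln r) + \<kappa> * (1 - \<eta>) * ln (1 - \<eta>) * r)) < 1"
      using d by real_asymp
    then show ?thesis using eventually_gt_at_top[of 0]
    proof eventually_elim
      case (elim r)
      have "- \<kappa> * ((1 - \<eta>) * r) * ln ((1 - \<eta>) * r) =
          - (d * (r * ln r) + \<kappa> * (1 - \<eta>) * ln (1 - \<eta>) * r) + - r * ln r / c1"
      proof -
        have "ln ((1 - \<eta>) * r) = ln (1 - \<eta>) + ln r" using elim(2) \<eta> by (simp add: ln_mult)
        then show ?thesis unfolding d_def by (simp only:) (simp add: algebra_simps)
      qed
      then have "2 * (2 * S) * exp (- \<kappa> * ((1 - \<eta>) * r) * ln ((1 - \<eta>) * r)) =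
          (2 * (2 * S) * exp (- (d * (r * ln r) + \<kappa> * (1 - \<eta>) * ln (1 - \<eta>) * r))) * exp (- r * ln r / c1)"
        by (simp only: exp_add mult.assoc)
      also have "\<dots> < 1 * exp (- r * ln r / c1)"
        by (intro mult_strict_right_mono elim) simp
      finally show ?case by simp
    qed
  qed
  ultimately have "\<forall>\<^sub>F r :: real in at_top. False" using tail
    by eventually_elim linarith
  then show False by simp
qed

text \<open>If the norm stayed below c times the normalisation, then X(a^(n+1)) - X(a^n) would be at
  most (1 + \<eta>/2) c times the normalisation at a^(n+1), since \<open>a\<close> is so large that
  the earlier time carries only the fraction \<eta>/2. The increments, being independent with
  divergent tail sums, exceed the larger level (1 + \<eta>) c infinitely often.\<close>

lemma frequently_norm_gt:
  assumes c: "0 < c" "c < c1" and tail: "\<forall>\<^sub>F r in at_top. exp (- r * ln r / c1) \<le> tail r"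
  shows "AE w in M. \<exists>\<^sub>F t in at_top. c * (t powr H * rate t) < norm (X t w)"
proof -
  \<comment> \<open>As \<eta> tends to 0 the required gap tends to c1 - c > 0, so a suitable \<eta>
    in (0, 1) exists.\<close>
  have "((\<lambda>\<eta>. (1 - \<eta>)\<^sup>2 * c1 - (1 + \<eta>) * c) \<longlongrightarrow> (1 - 0)\<^sup>2 * c1 - (1 + 0) * c) (at_right 0)"
    by (intro tendsto_intros)
  moreover have "0 < (1 - 0)\<^sup>2 * c1 - (1 + 0) * c" using c by simp
  ultimately have "\<forall>\<^sub>F \<eta> in at_right 0. 0 < (1 - \<eta>)\<^sup>2 * c1 - (1 + \<eta>) * c"
    by (rule order_tendstoD)
  moreover have "\<forall>\<^sub>F \<eta> :: real in at_right 0. \<eta> < 1"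
    by (rule eventually_at_rightI[of 0 1]) auto
  moreover have "\<forall>\<^sub>F \<eta> :: real in at_right 0. 0 < \<eta>" by (rule eventually_at_right_less)
  ultimately have "\<forall>\<^sub>F \<eta> in at_right 0. 0 < \<eta> \<and> \<eta> < 1 \<and> (1 + \<eta>) * c < (1 - \<eta>)\<^sup>2 * c1"
    by eventually_elim auto
  then obtain \<eta> where \<eta>: "0 < \<eta>" "\<eta> < 1" and cc: "(1 + \<eta>) * c < (1 - \<eta>)\<^sup>2 * c1"
    using eventually_happens'[OF trivial_limit_at_right_real] by blast
  define a where "a = (2 / \<eta>) powr (1 / H)"
  have aH: "a powr H = 2 / \<eta>" using \<eta> exponent_pos by (simp add: a_def powr_powr)
  have a: "1 < a" unfolding a_def using \<eta> exponent_pos by (intro gr_one_powr) auto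
  let ?c' = "(1 + \<eta>) * c"
  define Y where "Y n w = X (a ^ Suc n) w - X (a ^ n) w" for n w
  define A where "A n = {x :: real ^ 'd. (a ^ Suc n) powr H * (?c' * rate (a ^ Suc n)) < norm x}" for n
  have ind: "indep_vars (\<lambda>_. borel) Y {..<n}" for n
    unfolding Y_def using a
    by (intro independent_increments) (auto simp: strict_mono_on_def power_strict_increasing)
  have pre: "prob (Y n -` A n \<inter> space M) =
      prob {w \<in> space M. ?c' * rate (a ^ Suc n) < norm (X 1 w - X (1 / a) w)}" for n
  proof -
    have "Y n -` A n \<inter> space M = {w \<in> space M. (a ^ Suc n) powr H * (?c' * rate (a ^ Suc n)) <
        norm (X (a ^ Suc n * 1) w - X (a ^ Suc n * (1 / a)) w)}"
      using a by (auto simp: Y_def A_def)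
    then show ?thesis
      using selfsimilar_prob_norm_diff[of "a ^ Suc n" 1 "1 / a" "?c' * rate (a ^ Suc n)"] a by simp
  qed
  have "\<not> summable (\<lambda>n. prob (Y n -` A n \<inter> space M))"
    unfolding pre
    by (rule increment_not_summable[OF _ tail a _ \<eta>]) (use c cc aH \<eta> in auto)
  then have "AE w in M. \<exists>\<^sub>F n in sequentially. Y n w \<in> A n"
    by (intro borel_cantelli_indep_vars[OF ind]) (auto simp: A_def)
  then show ?thesis
  proof eventually_elim
    case (elim w)
    show ?case
    proof (rule ccontr)
      assume "\<not> (\<exists>\<^sub>F t in at_top. c * (t powr H * rate t) < norm (X t w))"
      then have "\<forall>\<^sub>F t in at_top. norm (X t w) \<le> c * (t powr H * rate t)"
        by (simp add: not_frequently not_less)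
      moreover have lim: "filterlim (\<lambda>n. a ^ n) at_top sequentially"
        using a by real_asymp
      ultimately have ev1: "\<forall>\<^sub>F n in sequentially.
          norm (X (a ^ n) w) \<le> c * ((a ^ n) powr H * rate (a ^ n))"
        by (rule eventually_compose_filterlim)
      then have ev2: "\<forall>\<^sub>F n in sequentially.
          norm (X (a ^ Suc n) w) \<le> c * ((a ^ Suc n) powr H * rate (a ^ Suc n))"
        by (subst eventually_sequentially_Suc)
      \<comment> \<open>Beyond this point the double logarithm is at least e, so the rate is
        nonnegative and increasing.\<close>
      have ev3: "\<forall>\<^sub>F n in sequentially. exp (exp (exp 1)) \<le> a ^ n"
        using lim by (simp add: filterlim_at_top)
      have "\<forall>\<^sub>F n in sequentially. Y n w \<notin> A n"
        using ev1 ev2 ev3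
      proof eventually_elim
        case (elim n)
        have mono: "rate (a ^ n) \<le> rate (a ^ Suc n)"
        proof -
          have le: "a ^ n \<le> a ^ Suc n" using a by simp
          have p0: "0 < a ^ n" using a by simp
          have p1: "exp (exp 1) \<le> ln (a ^ n)" using elim p0 by (simp add: ln_ge_iff del: ln_realpow)
          then have p2: "0 < ln (a ^ n)" using exp_gt_zero[of "exp 1"] by linarith
          have p3: "exp 1 \<le> ln (ln (a ^ n))" using p1 p2 by (simp add: ln_ge_iff del: ln_realpow)
          have "ln (a ^ n) \<le> ln (a ^ Suc n)" using le p0 by (rule ln_mono)
          then have "ln (ln (a ^ n)) \<le> ln (ln (a ^ Suc n))" using p2 by (rule ln_mono)
          with p3 show ?thesis unfolding rate_def by (rule divide_ln_mono)
        qed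
        have nn: "0 \<le> rate (a ^ Suc n)"
        proof -
          have "0 < a ^ n" using a by simp
          then have "exp (exp 1) \<le> ln (a ^ n)" using elim by (simp add: ln_ge_iff del: ln_realpow)
          moreover have "ln (a ^ n) \<le> ln (a ^ Suc n)" using a by (intro ln_mono) auto
          ultimately have 1: "exp (exp 1) \<le> ln (a ^ Suc n)" by linarith
          then have "0 < ln (a ^ Suc n)" using exp_gt_zero[of "exp 1"] by linarith
          with 1 have 2: "exp 1 \<le> ln (ln (a ^ Suc n))" by (subst ln_ge_iff)
          then have "0 < ln (ln (a ^ Suc n))" using exp_gt_zero[of 1] by linarith
          with 2 have "1 \<le> ln (ln (ln (a ^ Suc n)))" by (subst ln_ge_iff)
          with 2 show ?thesis unfolding rate_def using exp_gt_zero[of 1]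
            by (intro divide_nonneg_nonneg) linarith+
        qed
        let ?T = "(a ^ Suc n) powr H"
        have Tn: "(a ^ n) powr H = ?T * (\<eta> / 2)"
        proof -
          have "?T = a powr H * (a ^ n) powr H" using a by (simp add: powr_mult)
          then show ?thesis using \<eta> by (simp add: aH)
        qed
        have "norm (Y n w) \<le> norm (X (a ^ Suc n) w) + norm (X (a ^ n) w)"
          unfolding Y_def by (rule norm_triangle_ineq4)
        also have "\<dots> \<le> c * (?T * rate (a ^ Suc n)) + c * (?T * (\<eta> / 2) * rate (a ^ Suc n))"
        proof (rule add_mono[OF elim(2)])
          have "norm (X (a ^ n) w) \<le> c * (?T * (\<eta> / 2) * rate (a ^ n))"
            using elim(1) unfolding Tn .
          also have "\<dots> \<le> c * (?T * (\<eta> / 2) * rate (a ^ Suc n))"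
            using c \<eta> mono by (intro mult_left_mono) auto
          finally show "norm (X (a ^ n) w) \<le> c * (?T * (\<eta> / 2) * rate (a ^ Suc n))" .
        qed
        also have "\<dots> = ?T * ((1 + \<eta> / 2) * c * rate (a ^ Suc n))"
          by (simp add: algebra_simps)
        also have "\<dots> \<le> ?T * (?c' * rate (a ^ Suc n))"
          using c \<eta> nn by (intro mult_left_mono mult_right_mono) auto
        finally show ?case by (simp add: A_def not_less del: power_Suc)
      qed
      with elim show False by (simp add: frequently_def)
    qed
  qed
qed

end

section \<open>From tail bounds to the limit and the limsup\<close>

lemma neg_log_divide:
  "0 < y \<Longrightarrow> neg_log p / ereal y = (if p \<le> 0 then \<infinity> else ereal (- ln p / y))"
  by (simp add: neg_log_def)

text \<open>A real b > 0 strictly between the test point and \<open>inverse C\<close> corresponds to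
  the constant c = 1/b strictly on one side of \<open>C\<close>. This includes C = 0 and C =
  \<infinity>, where one of the two families of tail bounds is vacuous.\<close>

lemma tendsto_neg_log_tail:
  fixes T :: "real \<Rightarrow> real" and C :: ereal
  assumes C: "0 \<le> C" and T: "\<And>r. T r \<le> 1"
    and upper: "\<And>c. 0 < c \<Longrightarrow> C < ereal c \<Longrightarrow> \<forall>\<^sub>F r in at_top. T r \<le> exp (- r * ln r / c)"
    and lower: "\<And>c. 0 < c \<Longrightarrow> ereal c < C \<Longrightarrow> \<forall>\<^sub>F r in at_top. exp (- r * ln r / c) \<le> T r"
  shows "((\<lambda>r. neg_log (T r) / ereal (r * ln r)) \<longlongrightarrow> inverse C) at_top"
proof (rule order_tendstoI)
  fix a assume a: "a < inverse C"
  show "\<forall>\<^sub>F r in at_top. a < neg_log (T r) / ereal (r * ln r)"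
  \<comment> \<open>Negative test points give no positive \<open>b\<close>, but are trivial because
    \<open>T r \<le> 1\<close> makes the quotient nonnegative.\<close>
  proof (cases "a < 0")
    case True
    show ?thesis using eventually_gt_at_top[of 1]
    proof eventually_elim
      case (elim r)
      have "0 < r * ln r" using elim by (intro mult_pos_pos) auto
      moreover have "0 \<le> - ln (T r)" if "0 < T r" using T[of r] that by simp
      ultimately have "0 \<le> neg_log (T r) / ereal (r * ln r)"
        unfolding neg_log_divide[OF \<open>0 < r * ln r\<close>]
        by (auto simp only: zero_ereal_def ereal_less_eq not_le intro!: divide_nonneg_pos split: if_splits)
      with True show ?case by (rule less_le_trans)
    qed
  next
    case False
    then have "0 \<le> a" by simp
    obtain b where b: "a < ereal b" "ereal b < inverse C" using ereal_dense2[OF a] by blast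
    then have "0 < b" using \<open>0 \<le> a\<close> by (metis ereal_less(2) le_less_trans)
    have "C < ereal (1 / b)"
      using C b(2) \<open>0 < b\<close> by (cases C) (auto simp: field_simps split: if_splits)
    then have "\<forall>\<^sub>F r in at_top. T r \<le> exp (- r * ln r / (1 / b))"
      using \<open>0 < b\<close> by (intro upper) auto
    then show ?thesis using eventually_gt_at_top[of 1]
    proof eventually_elim
      case (elim r)
      have pos: "0 < r * ln r" using elim by (intro mult_pos_pos) auto
      have "ereal b \<le> neg_log (T r) / ereal (r * ln r)"
      proof (cases "T r \<le> 0")
        case False
        then have "ln (T r) \<le> ln (exp (- r * ln r / (1 / b)))"
          using elim by (intro ln_mono) auto
        then have "b * (r * ln r) \<le> - ln (T r)" by (simp add: mult_ac)
        then have "b \<le> - ln (T r) / (r * ln r)" unfolding pos_le_divide_eq[OF pos] .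
        then show ?thesis
          unfolding neg_log_divide[OF pos] if_not_P[OF False] ereal_less_eq .
      qed (simp add: neg_log_divide[OF pos])
      with b(1) show ?case by (rule less_le_trans)
    qed
  qed
next
  fix a assume a: "inverse C < a"
  obtain b where b: "inverse C < ereal b" "ereal b < a" using ereal_dense2[OF a] by blast
  have "0 \<le> inverse C" using C by (rule inverse_ereal_ge0I)
  with b(1) have "0 < b" by (metis ereal_less(2) le_less_trans)
  have "ereal (1 / b) < C"
    using C b(1) \<open>0 < b\<close> by (cases C) (auto simp: field_simps split: if_splits)
  then have "\<forall>\<^sub>F r in at_top. exp (- r * ln r / (1 / b)) \<le> T r"
    using \<open>0 < b\<close> by (intro lower) auto
  then show "\<forall>\<^sub>F r in at_top. neg_log (T r) / ereal (r * ln r) < a"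
    using eventually_gt_at_top[of 1]
  proof eventually_elim
    case (elim r)
    have pos: "0 < r * ln r" using elim by (intro mult_pos_pos) auto
    have T0: "0 < T r" using elim(1) exp_gt_zero[of "- r * ln r / (1 / b)"] by linarith
    have "ln (exp (- r * ln r / (1 / b))) \<le> ln (T r)"
      using elim by (intro ln_mono) auto
    then have "- ln (T r) \<le> b * (r * ln r)" by (simp add: mult_ac)
    then have "- ln (T r) / (r * ln r) \<le> b" unfolding pos_divide_le_eq[OF pos] .
    then have "neg_log (T r) / ereal (r * ln r) \<le> ereal b"
      unfolding neg_log_divide[OF pos] if_not_P[OF T0[folded not_le]] ereal_less_eq .
    with b(2) show ?case by simp
  qed
qed

text \<open>The exceptional null set depends on the comparison constant \<open>q\<close>.
  Restricting to rational \<open>q\<close> leaves countably many null sets, and density of the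
  rationals in the extended reals recovers equality.\<close>

lemma (in selfsimilar_additive_process) AE_Limsup_eq:
  fixes C :: ereal
  assumes C: "0 \<le> C"
    and upper: "\<And>c. 0 < c \<Longrightarrow> C < ereal c \<Longrightarrow> \<forall>\<^sub>F r in at_top. tail r \<le> exp (- r * ln r / c)"
    and lower: "\<And>c. 0 < c \<Longrightarrow> ereal c < C \<Longrightarrow> \<forall>\<^sub>F r in at_top. exp (- r * ln r / c) \<le> tail r"
  shows "AE w in M. Limsup at_top (\<lambda>t. ereal (norm (X t w) / (t powr H * rate t))) = C"
proof -
  let ?L = "\<lambda>w. Limsup at_top (\<lambda>t. ereal (norm (X t w) / (t powr H * rate t)))"
  have pos: "\<forall>\<^sub>F t in at_top. 0 < t powr H * rate t"
    unfolding rate_def using exponent_pos by real_asymp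
  have nonneg: "0 \<le> ?L w" for w
  proof (rule le_Limsup)
    show "\<forall>\<^sub>F t in at_top. 0 \<le> ereal (norm (X t w) / (t powr H * rate t))"
      using pos by eventually_elim simp
  qed simp
  have up: "AE w in M. C < ereal q \<longrightarrow> ?L w \<le> ereal q" for q
  proof (cases "C < ereal q")
    case True
    obtain c where c: "C < ereal c" "ereal c < ereal q" using ereal_dense2[OF True] by blast
    then have c0: "0 < c" using C by (metis ereal_less(2) le_less_trans)
    have "AE w in M. \<forall>\<^sub>F t in at_top. norm (X t w) \<le> q * (t powr H * rate t)"
      using c c0 by (intro eventually_norm_le[of c] upper) auto
    then show ?thesis
    proof eventually_elim
      case (elim w)
      have "\<forall>\<^sub>F t in at_top. ereal (norm (X t w) / (t powr H * rate t)) \<le> ereal q"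
        using elim pos by eventually_elim (simp add: pos_divide_le_eq)
      then show ?case by (intro impI Limsup_bounded)
    qed
  qed simp
  have low: "AE w in M. ereal q < C \<longrightarrow> ereal q \<le> ?L w" for q
  proof (cases "0 < q \<and> ereal q < C")
    case True
    then obtain c where c: "ereal q < ereal c" "ereal c < C" using ereal_dense2 by blast
    then have "AE w in M. \<exists>\<^sub>F t in at_top. q * (t powr H * rate t) < norm (X t w)"
      using True by (intro frequently_norm_gt[of q c] lower) auto
    then show ?thesis
    proof eventually_elim
      case (elim w)
      show ?case
      proof (rule impI, rule ccontr)
        assume "\<not> ereal q \<le> ?L w"
        then have "\<forall>\<^sub>F t in at_top. ereal (norm (X t w) / (t powr H * rate t)) < ereal q"
          by (intro Limsup_lessD) simp
        then have "\<forall>\<^sub>F t in at_top. \<not> q * (t powr H * rate t) < norm (X t w)"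
          using pos by eventually_elim (simp add: pos_divide_less_eq)
        with elim show False by (simp add: frequently_def)
      qed
    qed
  next
    case False
    have "ereal q \<le> ?L w" if "ereal q < C" for w
    proof -
      have "ereal q \<le> 0" using False that by auto
      then show ?thesis using nonneg by (rule order_trans)
    qed
    then show ?thesis by simp
  qed
  have "AE w in M. \<forall>q\<in>range real_of_rat. C < ereal q \<longrightarrow> ?L w \<le> ereal q"
    using up by (subst AE_ball_countable) auto
  moreover have "AE w in M. \<forall>q\<in>range real_of_rat. ereal q < C \<longrightarrow> ereal q \<le> ?L w"
    using low by (subst AE_ball_countable) auto
  ultimately show ?thesis
  proof eventually_elim
    case (elim w)
    show ?case
    proof (rule antisym)
      show "?L w \<le> C"
      proof (rule ccontr)
        assume "\<not> ?L w \<le> C"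
        then have "C < ?L w" by simp
        from ereal_dense3[OF this] obtain q :: rat
          where "C < ereal (real_of_rat q)" "ereal (real_of_rat q) < ?L w" by blast
        with elim(1) show False by (meson not_le rangeI)
      qed
      show "C \<le> ?L w"
      proof (rule ccontr)
        assume "\<not> C \<le> ?L w"
        then have "?L w < C" by simp
        from ereal_dense3[OF this] obtain q :: rat
          where "?L w < ereal (real_of_rat q)" "ereal (real_of_rat q) < C" by blast
        with elim(2) show False by (meson not_le rangeI)
      qed
    qed
  qed
qed

text \<open>Nonnegativity separates the two infinities, which share the inverse 0.\<close>

lemma ereal_inverse_inject:
  fixes a b :: ereal
  assumes "0 \<le> a" "0 \<le> b" "inverse a = inverse b"
  shows "a = b"
  using assms by (cases a; cases b) (auto split: if_splits)

theorem proposition2p26: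
  fixes M :: "'w measure" and H :: real and X :: "real \<Rightarrow> 'w \<Rightarrow> real ^ 'd"
    and \<mu> \<nu> :: "(real ^ 'd) measure" and K :: "real \<Rightarrow> ennreal" and C :: ereal
  assumes process: "selfsimilar_additive_process M H X"
    and nondeterministic: "\<not> deterministic_process M H X"
    and mu: "\<mu> = distr M borel (X 1)"
    and nu: "levy_measure_of \<mu> \<nu>"
    and K: "radial_function \<nu> K"
    and C: "0 \<le> C"
  shows "((AE w in M. Limsup at_top (\<lambda>t. ereal (norm (X t w) /
             (t powr H * (ln ^^ 2) t / (ln ^^ 3) t))) = C)
          \<longleftrightarrow> C = Inf (ereal ` {r. r > 0 \<and> K r = 0}))
       \<and> ((AE w in M. Limsup at_top (\<lambda>t. ereal (norm (X t w) /
             (t powr H * (ln ^^ 2) t / (ln ^^ 3) t))) = C)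
          \<longleftrightarrow> ((\<lambda>r. neg_log (measure \<mu> {x. norm x > r}) / ereal (r * ln r))
                 \<longlongrightarrow> inverse C) at_top)"
proof -
  interpret selfsimilar_additive_process M H X by (rule process)
  define C0 where "C0 = Inf (ereal ` {r. r > 0 \<and> K r = 0})"
  have C0: "0 \<le> C0" unfolding C0_def by (intro Inf_greatest) auto
  have X1: "X 1 \<in> borel_measurable M" by (rule random_variable) simp
  have prob: "prob_space \<mu>" unfolding mu by (rule prob_space_distr[OF X1])
  have sets: "sets \<mu> = sets borel" by (simp add: mu)
  have sets\<nu>: "sets \<nu> = sets borel" using nu by (simp add: levy_measure_of_def)
  have tail: "measure \<mu> {x. r < norm x} = tail r" for r
  proof -
    have "measure \<mu> {x. r < norm x} = prob (X 1 -` {x. r < norm x} \<inter> space M)"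
      unfolding mu by (rule measure_distr[OF X1]) simp
    also have "X 1 -` {x. r < norm x} \<inter> space M = {w \<in> space M. r < norm (X 1 w)}" by auto
    finally show ?thesis by (simp add: tail_def)
  qed
  have upper: "\<forall>\<^sub>F r in at_top. tail r \<le> exp (- r * ln r / c)" if c: "0 < c" "C0 < ereal c" for c
  proof -
    obtain R where R: "C0 < ereal R" "ereal R < ereal c" using ereal_dense2[OF c(2)] by blast
    have R0: "0 < R" using R(1) C0 by (metis ereal_less(2) le_less_trans)
    have "{x. R < norm x} \<in> null_sets \<nu>"
      using radial_function_null[OF K] R(1) by (auto simp: null_sets_def sets\<nu> C0_def)
    then have "AE x in \<nu>. norm x \<le> R"
      by (rule AE_I') auto
    then show ?thesis
      using eventually_tail_le[OF prob sets nu R0] R(2) unfolding tail by simp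
  qed
  have lower: "\<forall>\<^sub>F r in at_top. exp (- r * ln r / c) \<le> tail r" if c: "0 < c" "ereal c < C0" for c
  proof -
    obtain R where R: "ereal c < ereal R" "ereal R < C0" using ereal_dense2[OF c(2)] by blast
    then have "0 < emeasure \<nu> {x. R < norm x}"
      using c by (intro radial_function_pos[OF K]) (auto simp: C0_def)
    then show ?thesis
      using eventually_tail_ge[OF prob sets nu c(1)] R(1) unfolding tail by simp
  qed
  have tail_le_1: "tail r \<le> 1" for r by (simp add: tail_def)
  let ?L = "\<lambda>w. Limsup at_top (\<lambda>t. ereal (norm (X t w) / (t powr H * (ln ^^ 2) t / (ln ^^ 3) t)))"
  have L: "AE w in M. ?L w = C0"
    using AE_Limsup_eq[OF C0 upper lower] by (simp add: rate_def eval_nat_numeral)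
  have lim: "((\<lambda>r. neg_log (measure \<mu> {x. norm x > r}) / ereal (r * ln r)) \<longlongrightarrow> inverse C0) at_top"
    unfolding tail by (rule tendsto_neg_log_tail[OF C0 tail_le_1 upper lower])
  have iff1: "(AE w in M. ?L w = C) \<longleftrightarrow> C = C0"
  proof
    assume "AE w in M. ?L w = C"
    \<comment> \<open>An almost sure statement that does not mention the sample point is true
      outright on a probability space.\<close>
    then have "AE w in M. C = C0" using L by eventually_elim simp
    then show "C = C0" by simp
  qed (use L in simp)
  have iff2: "((\<lambda>r. neg_log (measure \<mu> {x. norm x > r}) / ereal (r * ln r)) \<longlongrightarrow> inverse C) at_top
      \<longleftrightarrow> C = C0"
  proof
    assume "((\<lambda>r. neg_log (measure \<mu> {x. norm x > r}) / ereal (r * ln r)) \<longlongrightarrow> inverse C) at_top"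
    then have "inverse C = inverse C0"
      using lim by (intro tendsto_unique[of at_top]) auto
    then show "C = C0" by (rule ereal_inverse_inject[OF C C0])
  qed (use lim in simp)
  show ?thesis
    unfolding iff1 iff2 C0_def[symmetric] by simp
qed

end
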